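(* Let $f_0\in\mathcal F$, let $X_1,\dots,X_n$ be i.i.d. with density $f_0$, and let $\pi$ be a prior of the type described in the context, in case (PH) or case (D). Assume that $\|\log(f_0)\|_\infty<\infty$ and that there exists $\gamma>1/2$ such that $\log(f_0)\in\mathcal B^\gamma_{p,q}$ with $p\ge 2$ and $1\le q\le\infty$ (with $p=q=2$ if the Fourier basis is used, and $\gamma<r$ if the wavelet basis is used). Then $$\mathbb P^\pi\left\{f_\theta:\ h(f_0,f_\theta)\le\frac{\log n}{L(n)}\,\epsilon_n\;\Big|\;X^n\right\}=1+o_P(1)$$ and $$\mathbb P^\pi\left\{f_\theta:\ \|\theta_0-\theta\|_2\le\frac{(\log n)^2}{L(n)}\,\epsilon_n\;\Big|\;X^n\right\}=1+o_P(1),$$ where in case (PH) $$\epsilon_n=\epsilon_0\left(\frac{\log n}{n}\right)^{\frac{\gamma}{2\gamma+1}},$$ in case (D) $$\epsilon_n=\epsilon_0(\log n)\,n^{-\frac{\beta}{2\beta+1}}\ \text{ if }\gamma\ge\beta,\qquad \epsilon_n=\epsilon_0\,n^{-\frac{\gamma}{2\beta+1}}\ \text{ if }\gamma<\beta,$$ and $\epsilon_0$ is a large enough constant.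
   Context: $\mathcal F=\{f\ge 0:\ f\text{ is 1-periodic},\ \int_0^1 f(x)\,dx=1,\ \log f\in\mathbb L_2([0,1])\}$. $X^n=(X_1,\dots,X_n)$; $\mathbb P^\pi\{\cdot\mid X^n\}$ is the posterior distribution; $o_P(1)$ is convergence to $0$ in probability under the true law, as $n\to\infty$. Hellinger distance: $h(f,f')=\left[\int(\sqrt f-\sqrt{f'})^2dx\right]^{1/2}$. Basis: $(\phi_\lambda)_{\lambda\in\mathbb N}$ is an orthonormal basis of $\mathbb L_2[0,1]$ with $\phi_0=1_{[0,1]}$, being either the Fourier basis, $\phi_{2\lambda-1}(x)=\sqrt2\sin(2\pi\lambda x)$, $\phi_{2\lambda}(x)=\sqrt2\cos(2\pi\lambda x)$ for $\lambda\ge1$; or the wavelet basis, $\phi_\lambda=\varPsi_{jk}$ for $\lambda=2^j+k$, $j\in\mathbb N$, $0\le k\le 2^j-1$, where $\varPsi_{jk}(x)=2^{j/2}\sum_{l\in\mathbb Z}\varPsi(2^jx-k+2^jl)$ and the mother wavelet $\varPsi$ is supported in $[-A,A]$, belongs to the Hölder space $C^r$ and has $r$ vanishing moments. Spaces: for a periodic $f=\sum_\lambda\theta_\lambda\phi_\lambda$, in the Fourier case $\mathcal B^\gamma_{2,2}=W^\gamma$ is the Sobolev space with norm $\|f\|_\gamma=(\theta_0^2+\sum_{\lambda\ge1}\lambda^{2\gamma}\theta_\lambda^2)^{1/2}<\infty$. In the wavelet case, with $\theta_{-10}=\int_0^1 f$ and $\theta_{jk}=\int_0^1 f\varPsi_{jk}$,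 $\mathcal B^\gamma_{p,q}$ is the set of $f\in\mathbb L_2[0,1]$ with $\|f\|_{\gamma,p,q}=|\theta_{-10}|+\left(\sum_{j\ge0}2^{jq(\gamma+\frac12-\frac1p)}\left(\sum_{k=0}^{2^j-1}|\theta_{jk}|^p\right)^{q/p}\right)^{1/q}<\infty$ (with suprema when $p$ or $q$ is infinite). Models: $\theta_0=(\theta_{0\lambda})_{\lambda\ge1}$ is defined by $\log f_0-\int_0^1\log f_0=\sum_{\lambda\ge1}\theta_{0\lambda}\phi_\lambda$. For $k\ge1$, $\mathcal F_k=\{f_\theta=\exp(\sum_{\lambda=1}^k\theta_\lambda\phi_\lambda-c(\theta)):\ \theta\in\mathbb R^k\}$ with $c(\theta)=\log\int_0^1\exp(\sum_{\lambda=1}^k\theta_\lambda\phi_\lambda(x))dx$. In $\|\theta_0-\theta\|_2$ (the $\ell_2$ norm), $\theta\in\mathbb R^k$ is extended by zeros. Prior: the prior $\pi$ on $\bigcup_k\mathcal F_k$ draws $k$ from a distribution $p$ on $\{1,2,\dots\}$ and then, given $k$, draws $\theta\in\mathbb R^k$ from $\pi_k$. Let $1/2<\beta<1$ be fixed. Let $g$ be a continuous positive density on $\mathbb R$, bounded up to a multiplicative constant by $x\mapsto\exp(-c|x|^{p_*})$ for some positive constants $c,p_*$, and such that for all $M>0$ there exist $a,b>0$ with $g(y+u)\ge a\exp\{-b(|y|^{p_*}+|u|^{p_*})\}$ for all $|y|\le M$ and all $u\in\mathbb R$. Under $\pi_k$, the variables $\theta_\lambda/\sqrt{\tau_\lambda}$,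 $1\le\lambda\le k$, are i.i.d. with density $g$, where $\tau_\lambda=\tau_0\lambda^{-2\beta}$, $\tau_0>0$, and $\beta<1/2+p_*/2$ if $p_*\le2$, $\beta<1/2+1/p_*$ if $p_*>2$. The prior $p$ on $k$ is of one of two types. Case (PH): there are $c_1,c_2>0$ such that $\exp(-c_1kL(k))\le p(k)\le\exp(-c_2kL(k))$ for all $k\ge1$ (for all $k\ge 2$ if $L=\log$), where $L$ is one of the two functions $L(x)=1$ or $L(x)=\log x$. Case (D): $p(k)=\delta_{k_n^*}(k)$ with $k_n^*=n^{1/(2\beta+1)}$ (understood as an integer, by rounding). In case (D), $L(n)$ is understood as $1$. *)

theory Defs
  imports "HOL-Probability.Probability" "HOL-Probability.Essential_Supremum"
begin

abbreviation int01 :: "(real \<Rightarrow> real) \<Rightarrow> real" where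
  "int01 f \<equiv> (LINT x:{0..1}|lborel. f x)"

definition in_L2 :: "(real \<Rightarrow> real) \<Rightarrow> bool" where
  "in_L2 f \<longleftrightarrow> set_borel_measurable lborel {0..1} f \<and>
     set_integrable lborel {0..1} (\<lambda>x. (f x)\<^sup>2)"

text \<open>The partial sums of \<open>\<Sum>l\<in>I. a l * \<phi> l\<close> converge to \<open>f\<close> in \<open>L2[0,1]\<close>.\<close>

definition L2_sums :: "(nat \<Rightarrow> real \<Rightarrow> real) \<Rightarrow> nat set \<Rightarrow> (nat \<Rightarrow> real) \<Rightarrow> (real \<Rightarrow> real) \<Rightarrow> bool" where
  "L2_sums \<phi> I a f \<longleftrightarrow>
     (\<lambda>N. int01 (\<lambda>x. (f x - (\<Sum>l\<in>I \<inter> {..N}. a l * \<phi> l x))\<^sup>2)) \<longlonglongrightarrow> 0"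

definition orthonormal_basis :: "(nat \<Rightarrow> real \<Rightarrow> real) \<Rightarrow> bool" where
  "orthonormal_basis \<phi> \<longleftrightarrow>
     (\<forall>l. in_L2 (\<phi> l)) \<and>
     (\<forall>l m. int01 (\<lambda>x. \<phi> l x * \<phi> m x) = (if l = m then 1 else 0)) \<and>
     (\<forall>f. in_L2 f \<longrightarrow> L2_sums \<phi> UNIV (\<lambda>l. int01 (\<lambda>x. f x * \<phi> l x)) f)"

text \<open>Since \<open>ln 0 = 0\<close> in HOL, \<open>log f \<in> L2\<close> needs the explicit requirement that \<open>f\<close> is
  positive almost everywhere.\<close>

definition density_class :: "(real \<Rightarrow> real) set" where
  "density_class = {f. f \<in> borel_measurable borel \<and> (\<forall>x. f x \<ge> 0) \<and> (\<forall>x. f (x + 1) = f x) \<and>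
     set_integrable lborel {0..1} f \<and> int01 f = 1 \<and>
     (AE x\<in>{0..1} in lborel. f x > 0) \<and> in_L2 (\<lambda>x. ln (f x))}"

definition hellinger :: "(real \<Rightarrow> real) \<Rightarrow> (real \<Rightarrow> real) \<Rightarrow> real" where
  "hellinger f f' = sqrt (int01 (\<lambda>x. (sqrt (f x) - sqrt (f' x))\<^sup>2))"

definition is_fourier_basis :: "(nat \<Rightarrow> real \<Rightarrow> real) \<Rightarrow> bool" where
  "is_fourier_basis \<phi> \<longleftrightarrow> orthonormal_basis \<phi> \<and> \<phi> 0 = indicator {0..1} \<and>
     (\<forall>l\<ge>1. \<phi> (2 * l - 1) = (\<lambda>x. sqrt 2 * sin (2 * pi * real l * x)) \<and>
             \<phi> (2 * l) = (\<lambda>x. sqrt 2 * cos (2 * pi * real l * x)))"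

text \<open>The Hoelder space of (possibly non-integer) order \<open>r > 0\<close>: with \<open>m\<close> the largest integer
  strictly below \<open>r\<close>, the function is \<open>m\<close> times differentiable and its \<open>m\<close>-th derivative is
  Hoelder continuous of exponent \<open>r - m \<in> (0,1]\<close>.  For integer \<open>r\<close> this asks for a Lipschitz
  derivative of order \<open>r - 1\<close>.  Boundedness of the derivatives is not
  imposed separately; it is automatic for the compactly supported functions considered here.\<close>

definition holder :: "real \<Rightarrow> (real \<Rightarrow> real) \<Rightarrow> bool" where
  "holder r f \<longleftrightarrow> (let m = nat (\<lceil>r\<rceil> - 1) in
     (\<forall>i<m. \<forall>x. (deriv ^^ i) f field_differentiable at x) \<and>
     (\<exists>C. \<forall>x y. \<bar>(deriv ^^ m) f x - (deriv ^^ m) f y\<bar> \<le> C * \<bar>x - y\<bar> powr (r - real m)))"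

definition mother_wavelet :: "real \<Rightarrow> (real \<Rightarrow> real) \<Rightarrow> bool" where
  "mother_wavelet r \<Psi> \<longleftrightarrow> r > 0 \<and>
     (\<exists>A>0. \<forall>x. x \<notin> {-A..A} \<longrightarrow> \<Psi> x = 0) \<and> holder r \<Psi> \<and>
     (\<forall>s::nat. real s < r \<longrightarrow> (LINT x|lborel. x ^ s * \<Psi> x) = 0)"

text \<open>The sum has only finitely many nonzero terms when \<open>\<Psi>\<close> has compact support.\<close>

definition periodized_wavelet :: "(real \<Rightarrow> real) \<Rightarrow> nat \<Rightarrow> nat \<Rightarrow> real \<Rightarrow> real" where
  "periodized_wavelet \<Psi> j k x =
     2 powr (real j / 2) * (\<Sum>\<^sub>\<infinity>l::int. \<Psi> (2 ^ j * x - real k + 2 ^ j * real_of_int l))"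

definition is_wavelet_basis :: "real \<Rightarrow> (nat \<Rightarrow> real \<Rightarrow> real) \<Rightarrow> bool" where
  "is_wavelet_basis r \<phi> \<longleftrightarrow> orthonormal_basis \<phi> \<and> \<phi> 0 = indicator {0..1} \<and>
     (\<exists>\<Psi>. mother_wavelet r \<Psi> \<and>
        (\<forall>j. \<forall>k<2 ^ j. \<phi> (2 ^ j + k) = periodized_wavelet \<Psi> j k))"

text \<open>Powers of extended nonnegative reals, for positive exponents.\<close>

definition enn_powr :: "ennreal \<Rightarrow> real \<Rightarrow> ennreal" where
  "enn_powr x a = (if x = \<infinity> then \<infinity> else ennreal (enn2real x powr a))"

definition lp_enorm :: "ereal \<Rightarrow> nat set \<Rightarrow> (nat \<Rightarrow> ennreal) \<Rightarrow> ennreal" where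
  "lp_enorm p I a =
     (if p = \<infinity> then (SUP i\<in>I. a i)
      else enn_powr (\<Sum>\<^sub>\<infinity>i\<in>I. enn_powr (a i) (real_of_ereal p)) (1 / real_of_ereal p))"

definition sobolev_norm :: "real \<Rightarrow> (nat \<Rightarrow> real) \<Rightarrow> ennreal" where
  "sobolev_norm \<gamma> \<theta> =
     enn_powr (ennreal ((\<theta> 0)\<^sup>2) +
       (\<Sum>\<^sub>\<infinity>l\<in>{1..}. ennreal (real l powr (2 * \<gamma>) * (\<theta> l)\<^sup>2))) (1 / 2)"

definition sobolev :: "(nat \<Rightarrow> real \<Rightarrow> real) \<Rightarrow> real \<Rightarrow> (real \<Rightarrow> real) set" where
  "sobolev \<phi> \<gamma> = {f. in_L2 f \<and> (\<exists>\<theta>. L2_sums \<phi> UNIV \<theta> f \<and> sobolev_norm \<gamma> \<theta> < \<infinity>)}"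

text \<open>\<open>\<phi>\<close> is a wavelet basis here, so \<open>\<phi> (2 ^ j + k)\<close> is the wavelet at level \<open>j\<close> and
  position \<open>k\<close>; \<open>p\<close> and \<open>q\<close> may be infinite.\<close>

definition besov_norm ::
  "(nat \<Rightarrow> real \<Rightarrow> real) \<Rightarrow> real \<Rightarrow> ereal \<Rightarrow> ereal \<Rightarrow> (real \<Rightarrow> real) \<Rightarrow> ennreal" where
  "besov_norm \<phi> \<gamma> p q f =
     ennreal \<bar>int01 f\<bar> +
     lp_enorm q UNIV (\<lambda>j. ennreal (2 powr (real j * (\<gamma> + 1/2 - real_of_ereal (1 / p)))) *
       lp_enorm p {..<2 ^ j} (\<lambda>k. ennreal \<bar>int01 (\<lambda>x. f x * \<phi> (2 ^ j + k) x)\<bar>))"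

definition besov ::
  "(nat \<Rightarrow> real \<Rightarrow> real) \<Rightarrow> real \<Rightarrow> ereal \<Rightarrow> ereal \<Rightarrow> (real \<Rightarrow> real) set" where
  "besov \<phi> \<gamma> p q = {f. in_L2 f \<and> besov_norm \<phi> \<gamma> p q f < \<infinity>}"

definition log_normalizer :: "(nat \<Rightarrow> real \<Rightarrow> real) \<Rightarrow> nat \<Rightarrow> (nat \<Rightarrow> real) \<Rightarrow> real" where
  "log_normalizer \<phi> k \<theta> = ln (int01 (\<lambda>x. exp (\<Sum>l=1..k. \<theta> l * \<phi> l x)))"

definition model_density :: "(nat \<Rightarrow> real \<Rightarrow> real) \<Rightarrow> nat \<Rightarrow> (nat \<Rightarrow> real) \<Rightarrow> real \<Rightarrow> real" where
  "model_density \<phi> k \<theta> x = exp ((\<Sum>l=1..k. \<theta> l * \<phi> l x) - log_normalizer \<phi> k \<theta>)"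

definition l2_dist :: "(nat \<Rightarrow> real) \<Rightarrow> (nat \<Rightarrow> real) \<Rightarrow> real" where
  "l2_dist \<theta> \<theta>' = sqrt (\<Sum>\<^sub>\<infinity>l\<in>{1..}. (\<theta> l - \<theta>' l)\<^sup>2)"

definition coordinate_density :: "real \<Rightarrow> (real \<Rightarrow> real) \<Rightarrow> bool" where
  "coordinate_density pstar g \<longleftrightarrow>
     continuous_on UNIV g \<and> (\<forall>x. g x > 0) \<and> integrable lborel g \<and> (LINT x|lborel. g x) = 1 \<and>
     (\<exists>C>0. \<exists>c>0. \<forall>x. g x \<le> C * exp (- c * \<bar>x\<bar> powr pstar)) \<and>
     (\<forall>M>0. \<exists>a>0. \<exists>b>0. \<forall>y u. \<bar>y\<bar> \<le> M \<longrightarrow>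
        g (y + u) \<ge> a * exp (- b * (\<bar>y\<bar> powr pstar + \<bar>u\<bar> powr pstar)))"

text \<open>The law of \<open>\<theta> \<in> R^k\<close> given \<open>k\<close>, as a law on real sequences: \<open>\<theta>\<close> has coordinates
  \<open>1, ..., k\<close> and is extended by zeros.\<close>

definition prior_given_k :: "(real \<Rightarrow> real) \<Rightarrow> real \<Rightarrow> real \<Rightarrow> nat \<Rightarrow> (nat \<Rightarrow> real) measure" where
  "prior_given_k g \<tau>0 \<beta> k =
     distr (\<Pi>\<^sub>M l\<in>{1..k}. density lborel (\<lambda>x. ennreal (g x))) (\<Pi>\<^sub>M l\<in>UNIV. borel)
       (\<lambda>y l. if l \<in> {1..k} then sqrt (\<tau>0 * real l powr (- 2 * \<beta>)) * y l else 0)"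

text \<open>The prior is carried by the parameters: \<open>(k, \<theta>)\<close> stands for \<open>model_density \<phi> k \<theta>\<close>.\<close>

definition param_space :: "(nat \<times> (nat \<Rightarrow> real)) measure" where
  "param_space = count_space UNIV \<Otimes>\<^sub>M (\<Pi>\<^sub>M l\<in>UNIV. borel)"

definition prior :: "nat pmf \<Rightarrow> (real \<Rightarrow> real) \<Rightarrow> real \<Rightarrow> real \<Rightarrow> (nat \<times> (nat \<Rightarrow> real)) measure" where
  "prior pk g \<tau>0 \<beta> =
     measure_pmf pk \<bind> (\<lambda>k. distr (prior_given_k g \<tau>0 \<beta> k) param_space (Pair k))"

text \<open>\<open>pk n\<close> is the prior on \<open>k\<close> used at sample size \<open>n\<close>.  In the first case it does not
  depend on \<open>n\<close>.\<close>

definition case_PH :: "(nat \<Rightarrow> nat pmf) \<Rightarrow> (real \<Rightarrow> real) \<Rightarrow> bool" where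
  "case_PH pk L \<longleftrightarrow> (\<exists>p. (\<forall>n. pk n = p) \<and> set_pmf p \<subseteq> {1..} \<and>
     (\<exists>k0. (L = (\<lambda>_. 1) \<and> k0 = 1 \<or> L = ln \<and> k0 = 2) \<and>
        (\<exists>c1>0. \<exists>c2>0. \<forall>k\<ge>k0. exp (- c1 * real k * L (real k)) \<le> pmf p k \<and>
                                 pmf p k \<le> exp (- c2 * real k * L (real k)))))"

text \<open>\<open>kn n\<close> is any rounding (floor, ceiling, nearest integer) of \<open>n powr (1 / (2\<beta> + 1))\<close>;
  it is automatically at least 1 for \<open>n \<ge> 1\<close>.\<close>

definition case_D :: "real \<Rightarrow> (nat \<Rightarrow> nat pmf) \<Rightarrow> (real \<Rightarrow> real) \<Rightarrow> bool" where
  "case_D \<beta> pk L \<longleftrightarrow> L = (\<lambda>_. 1) \<and>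
     (\<exists>kn. (\<forall>n\<ge>1. \<bar>real (kn n) - real n powr (1 / (2 * \<beta> + 1))\<bar> < 1) \<and>
           (\<forall>n. pk n = return_pmf (kn n)))"

definition likelihood ::
  "(nat \<Rightarrow> real \<Rightarrow> real) \<Rightarrow> nat \<Rightarrow> (nat \<Rightarrow> real) \<Rightarrow> nat \<times> (nat \<Rightarrow> real) \<Rightarrow> real" where
  "likelihood \<phi> n x = (\<lambda>(k, \<theta>). \<Prod>i=1..n. model_density \<phi> k \<theta> (x i))"

definition posterior ::
  "(nat \<Rightarrow> real \<Rightarrow> real) \<Rightarrow> (nat \<times> (nat \<Rightarrow> real)) measure \<Rightarrow> nat \<Rightarrow> (nat \<Rightarrow> real) \<Rightarrow>
   (nat \<times> (nat \<Rightarrow> real)) measure" where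
  "posterior \<phi> \<pi> n x =
     density \<pi> (\<lambda>t. ennreal (likelihood \<phi> n x t) / (\<integral>\<^sup>+ s. ennreal (likelihood \<phi> n x s) \<partial>\<pi>))"

definition tendsto_in_prob :: "'w measure \<Rightarrow> (nat \<Rightarrow> 'w \<Rightarrow> real) \<Rightarrow> real \<Rightarrow> bool" where
  "tendsto_in_prob M Y c \<longleftrightarrow> (\<forall>n. Y n \<in> borel_measurable M) \<and>
     (\<forall>\<delta>>0. (\<lambda>n. measure M {\<omega> \<in> space M. \<bar>Y n \<omega> - c\<bar> > \<delta>}) \<longlonglongrightarrow> 0)"

text \<open>The rates, without the multiplicative constant \<open>\<epsilon>0\<close>.\<close>

definition rate_PH :: "real \<Rightarrow> nat \<Rightarrow> real" where
  "rate_PH \<gamma> n = (ln (real n) / real n) powr (\<gamma> / (2 * \<gamma> + 1))"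

definition rate_D :: "real \<Rightarrow> real \<Rightarrow> nat \<Rightarrow> real" where
  "rate_D \<beta> \<gamma> n =
     (if \<gamma> \<ge> \<beta> then ln (real n) * real n powr (- \<beta> / (2 * \<beta> + 1))
      else real n powr (- \<gamma> / (2 * \<beta> + 1)))"

end

theory Submission
  imports Defs "HOL-Real_Asymp.Real_Asymp"
begin

text \<open>
  The posterior mass of a set of parameters is the prior average of the likelihood ratio to \<open>f0\<close> over
  the set, divided by the average over all parameters. Denominator and numerator are treated separately,
  and besides Fubini's theorem the only probabilistic tool is Markov's inequality for products over the
  sample.

  Denominator. The projection of \<open>log f0\<close> to the first \<open>k\<close> basis functions gives a density \<open>f\<close> for which
  the integral of \<open>f0\<^sup>2 / f\<close> is at most \<open>exp (C * k powr (- 2 * \<gamma>))\<close> (\<open>chi_square_projection\<close>), so its likelihood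
  ratio is rarely below \<open>exp (- C * n * k powr (- 2 * \<gamma>))\<close>. Around the coefficients of the projection the prior
  charges boxes of polynomially small width with mass at least \<open>exp (- C * k * ln n)\<close> (\<open>emeasure_prior_near\<close>):
  the normalised coefficients \<open>l powr \<beta> * \<theta>0 l\<close> have a sum of \<open>pstar\<close>-th powers of order \<open>k\<close>
  (\<open>weighted_coefficients_powr_sum\<close>). In such a box the likelihood is constant up to a factor.

  Numerator. The sieve consists of the parameters with at most \<open>K\<close> coefficients, all of them polynomially
  bounded. A grid of polynomially small width on it has \<open>exp (C * K * ln n)\<close> cells, and the likelihood is
  constant up to a factor on every cell. If the Hellinger distance to \<open>f0\<close> exceeds \<open>r\<close>, then the square root
  of the likelihood ratio has mean at most \<open>exp (- n * r\<^sup>2 / 2)\<close> (\<open>hellinger_affinity\<close>), and a union bound over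
  the cells that meet this region controls its contribution. Outside the sieve it suffices that the
  likelihood ratio has mean at most one, so that its prior average is of the order of the prior mass
  (\<open>evidence_expectation\<close>).

  Hence the posterior concentrates on the Hellinger ball of radius \<open>r\<close> as soon as \<open>n * r\<^sup>2\<close> dominates
  \<open>n * k powr (- 2 * \<gamma>)\<close>, \<open>k * ln n\<close> and \<open>K * ln n\<close>, and the prior gives little mass to dimensions above
  \<open>K\<close> (\<open>posterior_concentration_bound\<close>, \<open>posterior_rate_bound\<close>). The choice of \<open>k\<close> and \<open>K\<close> for the two kinds
  of priors is made in \<open>rates_PH\<close> and \<open>rates_D\<close>.

  From the Hellinger to the \<open>l2\<close> distance there is a deterministic step (\<open>l2_dist_le_hellinger\<close>). On the
  sieve the uniform distance of the log densities is at most a constant plus \<open>sqrt K\<close> times the \<open>l2\<close> distance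
  of the coefficients; as \<open>sqrt K * r\<close> tends to zero, the two distances are comparable.

  The basis enters through the fact that the sum of squares of its functions over a dyadic block of indices
  is at most of the order of the size of the block, and the target through the fact that the squared
  coefficients over the block starting at \<open>2 ^ j\<close> sum to at most \<open>C * 2 powr (- 2 * \<gamma> * j)\<close>. Both bases have the first property
  (\<open>fourier_basis_block_bounded\<close>, \<open>wavelet_basis_block_bounded\<close>), and both smoothness classes imply the
  second (\<open>sobolev_block_decay\<close>, \<open>besov_block_decay\<close>).
\<close>

section \<open>Orthonormal expansions on the unit interval\<close>

abbreviation U01 :: "real measure" where
  "U01 \<equiv> restrict_space lborel {0..1}"

lemma int01_eq: "int01 f = (LINT x|U01. f x)"
  by (simp add: set_lebesgue_integral_def integral_restrict_space)

lemma prob_space_U01: "prob_space U01"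
  by (intro prob_spaceI) (simp add: emeasure_restrict_space space_restrict_space)

interpretation U01: prob_space U01
  by (rule prob_space_U01)

lemma borel_measurable_U01: "f \<in> borel_measurable borel \<Longrightarrow> f \<in> borel_measurable U01"
  for f :: "real \<Rightarrow> 'b::topological_space"
  by (intro measurable_restrict_space1) simp

lemma in_L2_iff: "in_L2 f \<longleftrightarrow> f \<in> borel_measurable U01 \<and> integrable U01 (\<lambda>x. (f x)\<^sup>2)"
  unfolding in_L2_def set_borel_measurable_def set_integrable_def
  by (simp add: borel_measurable_restrict_space_iff integrable_restrict_space)

lemma in_L2_mult_integrable:
  assumes "in_L2 f" "in_L2 g"
  shows "integrable U01 (\<lambda>x. f x * g x)"
proof (rule Bochner_Integration.integrable_bound)
  show "integrable U01 (\<lambda>x. (f x)\<^sup>2 + (g x)\<^sup>2)"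
    using assms by (auto simp: in_L2_iff)
  show "(\<lambda>x. f x * g x) \<in> borel_measurable U01"
    using assms by (auto simp: in_L2_iff)
  have "\<bar>a * b\<bar> \<le> a\<^sup>2 + b\<^sup>2" for a b :: real
  proof -
    have "2 * \<bar>a * b\<bar> \<le> a\<^sup>2 + b\<^sup>2"
      using sum_squares_bound[of "\<bar>a\<bar>" "\<bar>b\<bar>"] by (simp add: abs_mult)
    moreover have "0 \<le> \<bar>a * b\<bar>" by simp
    ultimately show ?thesis by linarith
  qed
  then show "AE x in U01. norm (f x * g x) \<le> norm ((f x)\<^sup>2 + (g x)\<^sup>2)"
    by auto
qed

lemma in_L2_const: "in_L2 (\<lambda>x. c)"
  by (simp add: in_L2_iff)

lemma in_L2_integrable: "in_L2 f \<Longrightarrow> integrable U01 f"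
  using in_L2_mult_integrable[OF _ in_L2_const[of 1]] by simp

lemma in_L2_scale: "in_L2 f \<Longrightarrow> in_L2 (\<lambda>x. c * f x)"
  by (auto simp: in_L2_iff power_mult_distrib)

lemma in_L2_add:
  assumes "in_L2 f" "in_L2 g"
  shows "in_L2 (\<lambda>x. f x + g x)"
proof -
  have "(\<lambda>x. (f x + g x)\<^sup>2) = (\<lambda>x. (f x)\<^sup>2 + (g x)\<^sup>2 + 2 * (f x * g x))"
    by (auto simp: power2_eq_square algebra_simps)
  then show ?thesis
    using assms in_L2_mult_integrable[OF assms] unfolding in_L2_iff by auto
qed

lemma in_L2_diff: "in_L2 f \<Longrightarrow> in_L2 g \<Longrightarrow> in_L2 (\<lambda>x. f x - g x)"
  using in_L2_add[of f "\<lambda>x. (-1) * g x"] in_L2_scale[of g "-1"] by simp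

lemma in_L2_sum: "(\<And>l. l \<in> J \<Longrightarrow> in_L2 (g l)) \<Longrightarrow> in_L2 (\<lambda>x. \<Sum>l\<in>J. g l x)"
  by (induction J rule: infinite_finite_induct)
     (auto simp: in_L2_const[of 0, simplified] intro!: in_L2_add)

lemma in_L2_AE_bounded:
  assumes "f \<in> borel_measurable U01" "AE x in U01. \<bar>f x\<bar> \<le> b"
  shows "in_L2 f"
proof -
  have "integrable U01 (\<lambda>x. (f x)\<^sup>2)"
  proof (rule U01.integrable_const_bound)
    show "AE x in U01. norm ((f x)\<^sup>2) \<le> b\<^sup>2"
      using assms(2) by eventually_elim (use power_mono[of "\<bar>f _\<bar>" b 2] in auto)
  qed (use assms in auto)
  then show ?thesis using assms by (simp add: in_L2_iff)
qed

definition orthonormal_on :: "(nat \<Rightarrow> real \<Rightarrow> real) \<Rightarrow> nat set \<Rightarrow> bool" where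
  "orthonormal_on \<phi> J \<longleftrightarrow> (\<forall>l\<in>J. in_L2 (\<phi> l)) \<and>
     (\<forall>l\<in>J. \<forall>m\<in>J. (LINT x|U01. \<phi> l x * \<phi> m x) = (if l = m then 1 else 0))"

lemma orthonormal_on_subset: "orthonormal_on \<phi> J \<Longrightarrow> I \<subseteq> J \<Longrightarrow> orthonormal_on \<phi> I"
  unfolding orthonormal_on_def by blast

lemma L2_norm_diff_expansion:
  assumes u: "in_L2 u" and J: "finite J" "orthonormal_on \<phi> J"
  shows "(LINT x|U01. (u x - (\<Sum>l\<in>J. a l * \<phi> l x))\<^sup>2) =
    (LINT x|U01. (u x)\<^sup>2) - 2 * (\<Sum>l\<in>J. a l * (LINT x|U01. u x * \<phi> l x)) + (\<Sum>l\<in>J. (a l)\<^sup>2)"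
proof -
  have phi: "in_L2 (\<phi> l)" if "l \<in> J" for l using J that by (auto simp: orthonormal_on_def)
  have [simp]: "integrable U01 (\<lambda>x. u x * \<phi> l x)" if "l \<in> J" for l
    using in_L2_mult_integrable[OF u phi[OF that]] .
  have [simp]: "integrable U01 (\<lambda>x. \<phi> l x * \<phi> m x)" if "l \<in> J" "m \<in> J" for l m
    using in_L2_mult_integrable[OF phi[OF that(1)] phi[OF that(2)]] .
  have [simp]: "integrable U01 (\<lambda>x. (u x)\<^sup>2)" using u by (simp add: in_L2_iff)
  have "(LINT x|U01. (u x - (\<Sum>l\<in>J. a l * \<phi> l x))\<^sup>2) =
    (LINT x|U01. (u x)\<^sup>2 - 2 * (\<Sum>l\<in>J. a l * (u x * \<phi> l x)) +
       (\<Sum>l\<in>J. \<Sum>m\<in>J. a l * a m * (\<phi> l x * \<phi> m x)))"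
    by (intro Bochner_Integration.integral_cong)
       (auto simp: power2_diff sum_distrib_left sum_distrib_right power2_eq_square[of "sum _ _"]
          sum_product algebra_simps intro!: sum.cong)
  also have "\<dots> = (LINT x|U01. (u x)\<^sup>2) - 2 * (\<Sum>l\<in>J. a l * (LINT x|U01. u x * \<phi> l x)) +
       (\<Sum>l\<in>J. \<Sum>m\<in>J. a l * a m * (LINT x|U01. \<phi> l x * \<phi> m x))"
    by simp
  also have "(\<Sum>l\<in>J. \<Sum>m\<in>J. a l * a m * (LINT x|U01. \<phi> l x * \<phi> m x)) =
     (\<Sum>l\<in>J. \<Sum>m\<in>J. if m = l then (a l)\<^sup>2 else 0)"
    using J by (intro sum.cong refl) (auto simp: orthonormal_on_def power2_eq_square)
  also have "\<dots> = (\<Sum>l\<in>J. (a l)\<^sup>2)" using J by simp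
  finally show ?thesis .
qed

lemma bessel_inequality:
  assumes "in_L2 u" "finite J" "orthonormal_on \<phi> J"
  shows "(\<Sum>l\<in>J. (LINT x|U01. u x * \<phi> l x)\<^sup>2) \<le> (LINT x|U01. (u x)\<^sup>2)"
proof -
  define a where "a l = (LINT x|U01. u x * \<phi> l x)" for l
  have "0 \<le> (LINT x|U01. (u x - (\<Sum>l\<in>J. a l * \<phi> l x))\<^sup>2)" by simp
  also have "\<dots> = (LINT x|U01. (u x)\<^sup>2) - (\<Sum>l\<in>J. (a l)\<^sup>2)"
    using L2_norm_diff_expansion[OF assms, of a] by (simp add: a_def power2_eq_square)
  finally show ?thesis by (simp add: a_def)
qed

text \<open>In an \<open>L2\<close> expansion the coefficients are forced: pairing with a basis function is
  continuous for the \<open>L2\<close> norm.\<close>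

lemma L2_sums_coefficient:
  assumes f: "in_L2 f" and o: "orthonormal_on \<phi> I" and s: "L2_sums \<phi> I a f" and l: "l \<in> I"
  shows "a l = (LINT x|U01. f x * \<phi> l x)"
proof -
  define c where "c = (LINT x|U01. f x * \<phi> l x)"
  have phi: "in_L2 (\<phi> m)" if "m \<in> I" for m using o that by (auto simp: orthonormal_on_def)
  have "(c - a l)\<^sup>2 \<le> int01 (\<lambda>x. (f x - (\<Sum>m\<in>I \<inter> {..N}. a m * \<phi> m x))\<^sup>2)" if N: "N \<ge> l" for N
  proof -
    let ?S = "\<lambda>x. \<Sum>m\<in>I \<inter> {..N}. a m * \<phi> m x"
    have S: "in_L2 ?S" by (intro in_L2_sum in_L2_scale phi) auto
    have "(LINT x|U01. ?S x * \<phi> l x) = (LINT x|U01. (\<Sum>m\<in>I \<inter> {..N}. a m * (\<phi> m x * \<phi> l x)))"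
      by (simp add: sum_distrib_right mult.assoc)
    also have "\<dots> = (\<Sum>m\<in>I \<inter> {..N}. a m * (LINT x|U01. \<phi> m x * \<phi> l x))"
      using in_L2_mult_integrable[OF phi phi[OF l]] by (subst Bochner_Integration.integral_sum) auto
    also have "\<dots> = (\<Sum>m\<in>I \<inter> {..N}. if m = l then a l else 0)"
      using o l by (intro sum.cong) (auto simp: orthonormal_on_def)
    also have "\<dots> = a l" using N l by simp
    finally have "(LINT x|U01. (f x - ?S x) * \<phi> l x) = c - a l"
      using in_L2_mult_integrable[OF f phi[OF l]] in_L2_mult_integrable[OF S phi[OF l]]
      by (simp add: left_diff_distrib c_def)
    then show ?thesis
      using bessel_inequality[OF in_L2_diff[OF f S], of "{l}" \<phi>] orthonormal_on_subset[OF o, of "{l}"] l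
      by (simp add: int01_eq)
  qed
  then have "(c - a l)\<^sup>2 \<le> 0"
    using s unfolding L2_sums_def
    by (intro tendsto_lowerbound[OF _ _ sequentially_bot]) (auto simp: eventually_sequentially)
  then show ?thesis by (simp add: c_def)
qed

section \<open>Dyadic blocks\<close>

abbreviation dyadic_block :: "nat \<Rightarrow> nat set" where
  "dyadic_block j \<equiv> {2 ^ j..<2 ^ (j + 1)}"

lemma sum_dyadic_blocks:
  fixes a :: "nat \<Rightarrow> real"
  shows "i \<le> J \<Longrightarrow> (\<Sum>l\<in>{2 ^ i..<2 ^ J}. a l) = (\<Sum>j\<in>{i..<J}. \<Sum>l\<in>dyadic_block j. a l)"
proof (induction J rule: dec_induct)
  case (step n)
  have "(2::nat) ^ i \<le> 2 ^ n" using step by (intro power_increasing) auto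
  then have "(\<Sum>l\<in>{2 ^ i..<2 ^ n}. a l) + (\<Sum>l\<in>{2 ^ n..<2 ^ Suc n}. a l) = (\<Sum>l\<in>{2 ^ i..<2 ^ Suc n}. a l)"
    by (intro sum.atLeastLessThan_concat) auto
  with step show ?case by simp
qed simp

lemma dyadic_bracket:
  assumes "(k::nat) \<ge> 1"
  obtains j where "2 ^ j \<le> k" "k < 2 ^ (j + 1)"
  using ex_power_ivl1[of 2 k] assms by auto

lemma two_powr_nat: "(2::real) powr (a * real j) = (2 powr a) ^ j"
  by (simp add: powr_powr powr_realpow[symmetric])

text \<open>Sobolev and Besov smoothness enter only through this consequence. A dyadic block is a band of
frequencies for the Fourier basis and a resolution level for the wavelet basis.\<close>

definition block_decay :: "real \<Rightarrow> real \<Rightarrow> (nat \<Rightarrow> real) \<Rightarrow> bool" where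
  "block_decay \<gamma> C \<theta> \<longleftrightarrow> (\<forall>j. (\<Sum>l\<in>dyadic_block j. (\<theta> l)\<^sup>2) \<le> C * (2 powr (- 2 * \<gamma>)) ^ j)"

lemma block_decay_nonneg: "block_decay \<gamma> C \<theta> \<Longrightarrow> C \<ge> 0"
proof -
  assume "block_decay \<gamma> C \<theta>"
  then have "(\<theta> 1)\<^sup>2 \<le> C" unfolding block_decay_def by (elim allE[of _ 0]) (simp add: numeral_2_eq_2)
  then show ?thesis using zero_le_power2 order_trans by blast
qed

lemma block_decay_mono:
  assumes "block_decay \<gamma> C \<theta>" "\<gamma>' \<le> \<gamma>"
  shows "block_decay \<gamma>' C \<theta>"
  unfolding block_decay_def
proof
  fix j
  have "C * (2 powr (- 2 * \<gamma>)) ^ j \<le> C * (2 powr (- 2 * \<gamma>')) ^ j"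
    using assms block_decay_nonneg[OF assms(1)] by (intro mult_left_mono power_mono) auto
  with assms(1) show "(\<Sum>l\<in>dyadic_block j. (\<theta> l)\<^sup>2) \<le> C * (2 powr (- 2 * \<gamma>')) ^ j"
    unfolding block_decay_def by (meson order_trans)
qed

lemma geometric_sum_le:
  fixes q :: real
  assumes "0 \<le> q" "q < 1"
  shows "(\<Sum>j\<in>{i..<J}. q ^ j) \<le> q ^ i / (1 - q)"
proof (cases "i \<le> J")
  case True
  then have "(1 - q) * (\<Sum>j\<in>{i..<J}. q ^ j) = q ^ i - q ^ J"
  proof (induction J rule: dec_induct)
    case (step n)
    then have "(1 - q) * (\<Sum>j\<in>{i..<Suc n}. q ^ j) = q ^ i - q ^ n + (1 - q) * q ^ n"
      by (simp add: distrib_left)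
    then show ?case by (simp add: left_diff_distrib)
  qed simp
  also have "\<dots> \<le> q ^ i" using assms by simp
  finally show ?thesis using assms by (simp add: field_simps)
qed (use assms in simp)

lemma block_decay_tail:
  assumes "block_decay \<gamma> C \<theta>" "\<gamma> > 0" "k \<ge> 1"
  shows "(\<Sum>l\<in>{k<..N}. (\<theta> l)\<^sup>2) \<le> C * 2 powr (2 * \<gamma>) / (1 - 2 powr (- 2 * \<gamma>)) * real k powr (- 2 * \<gamma>)"
proof -
  let ?q = "2 powr (- 2 * \<gamma>) :: real"
  have C: "C \<ge> 0" by (rule block_decay_nonneg[OF assms(1)])
  have q: "0 < ?q" "?q < 1" using assms by (auto simp: powr_less_one)
  obtain j where j: "2 ^ j \<le> k" "k < 2 ^ (j + 1)" using dyadic_bracket assms by blast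
  define J where "J = max j N"
  have "N < 2 ^ N" by simp
  also have "(2::nat) ^ N \<le> 2 ^ J" by (simp add: J_def)
  finally have N: "N < 2 ^ J" .
  have "(\<Sum>l\<in>{k<..N}. (\<theta> l)\<^sup>2) \<le> (\<Sum>l\<in>{2 ^ j..<2 ^ J}. (\<theta> l)\<^sup>2)"
    using j N by (intro sum_mono2) auto
  also have "\<dots> = (\<Sum>i\<in>{j..<J}. \<Sum>l\<in>dyadic_block i. (\<theta> l)\<^sup>2)"
    by (rule sum_dyadic_blocks) (simp add: J_def)
  also have "\<dots> \<le> (\<Sum>i\<in>{j..<J}. C * ?q ^ i)"
    using assms(1) unfolding block_decay_def by (intro sum_mono) blast
  also have "\<dots> = C * (\<Sum>i\<in>{j..<J}. ?q ^ i)" by (simp add: sum_distrib_left)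
  also have "\<dots> \<le> C * (?q ^ j / (1 - ?q))"
    using q C by (intro mult_left_mono geometric_sum_le) auto
  also have "?q ^ j = (2 ^ j) powr (- 2 * \<gamma>)"
    by (simp add: powr_realpow[symmetric] powr_powr mult.commute)
  also have "\<dots> = 2 powr (2 * \<gamma>) * (2 * 2 ^ j) powr (- 2 * \<gamma>)"
    by (simp add: powr_mult powr_add[symmetric])
  also have "(2 * 2 ^ j) powr (- 2 * \<gamma>) \<le> real k powr (- 2 * \<gamma>)"
  proof -
    have "real k < 2 * 2 ^ j" using j(2)
      by (metis Suc_eq_plus1 of_nat_less_iff of_nat_numeral of_nat_power power_Suc)
    then show ?thesis using assms by (intro powr_mono2') auto
  qed
  finally show ?thesis using C q by (simp add: mult_left_mono divide_right_mono mult.assoc)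
qed

lemma sum_mult_le_sqrt:
  fixes a b :: "'a \<Rightarrow> real"
  assumes "(\<Sum>l\<in>J. (a l)\<^sup>2) \<le> S" "(\<Sum>l\<in>J. (b l)\<^sup>2) \<le> T"
  shows "(\<Sum>l\<in>J. \<bar>a l * b l\<bar>) \<le> sqrt S * sqrt T"
proof -
  have "(\<Sum>l\<in>J. \<bar>a l * b l\<bar>) \<le> L2_set a J * L2_set b J"
    using L2_set_mult_ineq[of a b J] by (simp add: abs_mult)
  also have "\<dots> \<le> sqrt S * sqrt T"
    using assms order_trans[OF sum_nonneg assms(1)]
    by (intro mult_mono) (auto simp: L2_set_def intro: sum_nonneg)
  finally show ?thesis .
qed

text \<open>Cauchy-Schwarz in each block leaves a geometric series with ratio \<open>2 powr (1/2 - \<gamma>)\<close>. Smoothness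
above \<open>1/2\<close> therefore bounds the partial sums of the expansion uniformly in their length.\<close>

lemma block_decay_absolute_sum:
  fixes \<phi> :: "nat \<Rightarrow> real"
  assumes d: "block_decay \<gamma> C \<theta>" and \<gamma>: "\<gamma> > 1/2"
    and \<phi>: "\<And>j. (\<Sum>l\<in>dyadic_block j. (\<phi> l)\<^sup>2) \<le> B * 2 ^ j"
  shows "(\<Sum>l=1..k. \<bar>\<theta> l * \<phi> l\<bar>) \<le> sqrt (C * B) / (1 - 2 powr (1/2 - \<gamma>))"
proof -
  let ?q = "2 powr (1/2 - \<gamma>) :: real"
  have C: "C \<ge> 0" by (rule block_decay_nonneg[OF d])
  have "(\<Sum>l\<in>dyadic_block 0. (\<phi> l)\<^sup>2) \<ge> 0" by (rule sum_nonneg) simp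
  with \<phi>[of 0] have B: "B \<ge> 0" by simp
  have q: "0 < ?q" "?q < 1" using \<gamma> by (auto simp: powr_less_one)
  have "(\<Sum>l=1..k. \<bar>\<theta> l * \<phi> l\<bar>) \<le> (\<Sum>l\<in>{2 ^ 0..<2 ^ k}. \<bar>\<theta> l * \<phi> l\<bar>)"
    by (intro sum_mono2) (auto intro: le_less_trans[OF _ less_exp])
  also have "\<dots> = (\<Sum>i\<in>{0..<k}. \<Sum>l\<in>dyadic_block i. \<bar>\<theta> l * \<phi> l\<bar>)"
    by (rule sum_dyadic_blocks) simp
  also have "\<dots> \<le> (\<Sum>i\<in>{0..<k}. sqrt (C * B) * ?q ^ i)"
  proof (rule sum_mono)
    fix i
    have "(\<Sum>l\<in>dyadic_block i. \<bar>\<theta> l * \<phi> l\<bar>) \<le> sqrt (C * (2 powr (- 2 * \<gamma>)) ^ i) * sqrt (B * 2 ^ i)"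
      using d \<phi>[of i] unfolding block_decay_def by (intro sum_mult_le_sqrt) blast+
    also have "\<dots> = sqrt ((C * B) * ((2 powr (- 2 * \<gamma>) * 2) ^ i))"
      by (simp add: real_sqrt_mult[symmetric] power_mult_distrib mult_ac)
    also have "2 powr (- 2 * \<gamma>) * 2 = ?q\<^sup>2"
    proof -
      have "?q\<^sup>2 = 2 powr (1/2 - \<gamma> + (1/2 - \<gamma>))" unfolding power2_eq_square powr_add ..
      also have "1/2 - \<gamma> + (1/2 - \<gamma>) = - 2 * \<gamma> + 1" by simp
      finally show ?thesis unfolding powr_add by simp
    qed
    also have "sqrt (C * B * (?q\<^sup>2) ^ i) = sqrt (C * B) * ?q ^ i"
      by (simp add: real_sqrt_mult real_sqrt_power)
    finally show "(\<Sum>l\<in>dyadic_block i. \<bar>\<theta> l * \<phi> l\<bar>) \<le> sqrt (C * B) * ?q ^ i" .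
  qed
  also have "\<dots> = sqrt (C * B) * (\<Sum>i\<in>{0..<k}. ?q ^ i)" by (simp add: sum_distrib_left)
  also have "\<dots> \<le> sqrt (C * B) * (?q ^ 0 / (1 - ?q))"
    using q C B by (intro mult_left_mono geometric_sum_le) auto
  finally show ?thesis by simp
qed

lemma block_bound_partial_sum:
  fixes \<phi> :: "nat \<Rightarrow> real"
  assumes \<phi>: "\<And>j. (\<Sum>l\<in>dyadic_block j. (\<phi> l)\<^sup>2) \<le> B * 2 ^ j"
  shows "(\<Sum>l=1..k. (\<phi> l)\<^sup>2) \<le> 2 * B * real k"
proof (cases "k = 0")
  case False
  have "(\<Sum>l\<in>dyadic_block 0. (\<phi> l)\<^sup>2) \<ge> 0" by (rule sum_nonneg) simp
  with \<phi>[of 0] have B: "B \<ge> 0" by simp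
  obtain j where j: "2 ^ j \<le> k" "k < 2 ^ (j + 1)" using dyadic_bracket[of k] False by auto
  have "(\<Sum>l=1..k. (\<phi> l)\<^sup>2) \<le> (\<Sum>l\<in>{2 ^ 0..<2 ^ (j + 1)}. (\<phi> l)\<^sup>2)"
    using j by (intro sum_mono2) auto
  also have "\<dots> = (\<Sum>i\<in>{0..<j + 1}. \<Sum>l\<in>dyadic_block i. (\<phi> l)\<^sup>2)"
    by (rule sum_dyadic_blocks) simp
  also have "\<dots> \<le> (\<Sum>i\<in>{0..<j + 1}. B * 2 ^ i)" by (intro sum_mono \<phi>)
  also have "\<dots> = B * (2 ^ (j + 1) - 1)"
    by (simp add: sum_distrib_left[symmetric] mask_eq_sum_exp[symmetric] lessThan_atLeast0[symmetric] sum_gp_strict)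
  also have "\<dots> \<le> B * (2 * real k)"
  proof (intro mult_left_mono B)
    have "(2::real) ^ j \<le> real k" using j(1) by simp
    then show "(2::real) ^ (j + 1) - 1 \<le> 2 * real k"
      unfolding power_add power_one_right by linarith
  qed
  finally show ?thesis by simp
qed simp

section \<open>The two bases\<close>

text \<open>This stands in for the explicit form of both bases. It makes the supremum of a combination of the first
\<open>k\<close> functions at most of order \<open>sqrt k\<close> times the \<open>l2\<close> norm of its coefficients.\<close>

definition block_bounded :: "real \<Rightarrow> (nat \<Rightarrow> real \<Rightarrow> real) \<Rightarrow> bool" where
  "block_bounded B \<phi> \<longleftrightarrow> (\<forall>j. \<forall>x\<in>{0..1}. (\<Sum>l\<in>dyadic_block j. (\<phi> l x)\<^sup>2) \<le> B * 2 ^ j)"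

lemma orthonormal_basis_imp_on: "orthonormal_basis \<phi> \<Longrightarrow> orthonormal_on \<phi> J"
  by (simp add: orthonormal_basis_def orthonormal_on_def int01_eq)

lemma fourier_basis_cases:
  assumes "is_fourier_basis \<phi>" "l \<ge> 1"
  obtains m where "\<phi> l = (\<lambda>x. sqrt 2 * sin (2 * pi * real m * x))"
    | m where "\<phi> l = (\<lambda>x. sqrt 2 * cos (2 * pi * real m * x))"
proof (cases "even l")
  case True
  then obtain m where "l = 2 * m" by blast
  with assms that(2)[of m] show ?thesis unfolding is_fourier_basis_def by auto
next
  case False
  then obtain m where "l = 2 * m + 1" by (blast elim: oddE)
  then have "l = 2 * (m + 1) - 1" "m + 1 \<ge> 1" by auto
  with assms that(1)[of "m + 1"] show ?thesis unfolding is_fourier_basis_def by metis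
qed

lemma fourier_basis_measurable:
  assumes "is_fourier_basis \<phi>" "l \<ge> 1"
  shows "\<phi> l \<in> borel_measurable borel"
  by (rule fourier_basis_cases[OF assms]) auto

lemma fourier_basis_block_bounded:
  assumes "is_fourier_basis \<phi>"
  shows "block_bounded 2 \<phi>"
  unfolding block_bounded_def
proof (intro allI ballI)
  fix j x
  have "(\<phi> l x)\<^sup>2 \<le> 2" if "l \<in> dyadic_block j" for l
  proof -
    have "1 \<le> (2::nat) ^ j" by simp
    then have "l \<ge> 1" using that by (meson atLeastLessThan_iff order_trans)
    from fourier_basis_cases[OF assms this] show ?thesis
      by cases (simp_all add: power_mult_distrib abs_square_le_1)
  qed
  then have "(\<Sum>l\<in>dyadic_block j. (\<phi> l x)\<^sup>2) \<le> (\<Sum>l\<in>dyadic_block j. 2)" by (rule sum_mono)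
  then show "(\<Sum>l\<in>dyadic_block j. (\<phi> l x)\<^sup>2) \<le> 2 * 2 ^ j" by simp
qed

text \<open>For order at most one the Hoelder condition bounds the increments of the function itself; for larger
order the function is differentiable.\<close>

lemma mother_wavelet_continuous:
  assumes "mother_wavelet r \<Psi>"
  shows "continuous_on UNIV \<Psi>"
proof -
  define m where "m = nat (\<lceil>r\<rceil> - 1)"
  have r: "r > 0" and h1: "\<forall>i<m. \<forall>x. (deriv ^^ i) \<Psi> field_differentiable at x"
    and h2: "\<exists>C. \<forall>x y. \<bar>(deriv ^^ m) \<Psi> x - (deriv ^^ m) \<Psi> y\<bar> \<le> C * \<bar>x - y\<bar> powr (r - real m)"
    using assms unfolding mother_wavelet_def holder_def m_def Let_def by blast+
  show ?thesis
  proof (cases "m = 0")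
    case True
    with h2 obtain C where C: "\<And>x y. \<bar>\<Psi> x - \<Psi> y\<bar> \<le> C * \<bar>x - y\<bar> powr r" by auto
    have "isCont \<Psi> x" for x
      unfolding isCont_def
    proof -
      have "((\<lambda>y. C * \<bar>y - x\<bar> powr r) \<longlongrightarrow> C * \<bar>x - x\<bar> powr r) (at x)"
        using r by (intro tendsto_intros tendsto_powr') auto
      then have "((\<lambda>y. C * \<bar>y - x\<bar> powr r) \<longlongrightarrow> 0) (at x)" using r by simp
      then have "((\<lambda>y. \<Psi> y - \<Psi> x) \<longlongrightarrow> 0) (at x)"
        by (rule Lim_null_comparison[rotated]) (use C in auto)
      then show "\<Psi> \<midarrow>x\<rightarrow> \<Psi> x" by (simp add: LIM_zero_iff)
    qed
    then show ?thesis by (simp add: continuous_on_eq_continuous_at)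
  next
    case False
    with h1 have "\<And>x. \<Psi> field_differentiable at x" by (metis funpow_0 not_gr_zero)
    then show ?thesis
      by (simp add: continuous_on_eq_continuous_at field_differentiable_imp_continuous_at)
  qed
qed

lemma mother_wavelet_bounded_support:
  assumes "mother_wavelet r \<Psi>"
  obtains A N where "A > 0" "\<And>x. \<bar>x\<bar> > A \<Longrightarrow> \<Psi> x = 0" "N > 0" "\<And>x. \<bar>\<Psi> x\<bar> \<le> N"
proof -
  obtain A where A: "A > 0" "\<forall>x. x \<notin> {-A..A} \<longrightarrow> \<Psi> x = 0"
    using assms unfolding mother_wavelet_def by blast
  have "compact (\<Psi> ` {-A..A})"
    using mother_wavelet_continuous[OF assms]
    by (intro compact_continuous_image) (auto intro: continuous_on_subset)
  then obtain N where N: "\<And>x. x \<in> {-A..A} \<Longrightarrow> norm (\<Psi> x) \<le> N" "N > 0"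
    using compact_imp_bounded[of "\<Psi> ` {-A..A}"] unfolding bounded_pos by (metis imageI)
  have "\<bar>\<Psi> x\<bar> \<le> N" for x
    using N A(2) by (cases "x \<in> {-A..A}") auto
  moreover have "\<Psi> x = 0" if "\<bar>x\<bar> > A" for x
    using A(2) that by (auto simp: abs_if split: if_splits)
  ultimately show ?thesis using A(1) N(2) by (intro that[of A N])
qed

lemma finite_translates:
  fixes y s A :: real
  assumes "s > 0"
  shows "finite {l::int. \<bar>y + s * of_int l\<bar> \<le> A}"
proof (rule finite_subset)
  show "{l::int. \<bar>y + s * of_int l\<bar> \<le> A} \<subseteq> {\<lceil>(- A - y) / s\<rceil>..\<lfloor>(A - y) / s\<rfloor>}"
    using assms by (auto simp: ceiling_le_iff le_floor_iff field_simps abs_le_iff)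
qed simp

text \<open>By compact support the sum over all translates is locally finite. On the finitely many indices below
it is an ordinary sum, which gives measurability as a limit and the counting bound after that.\<close>

lemma periodized_wavelet_eq_sum:
  assumes "\<And>x. \<bar>x\<bar> > A \<Longrightarrow> \<Psi> x = 0"
  shows "periodized_wavelet \<Psi> j k x = 2 powr (real j / 2) *
    (\<Sum>l\<in>{l::int. \<bar>2 ^ j * x - real k + 2 ^ j * of_int l\<bar> \<le> A}. \<Psi> (2 ^ j * x - real k + 2 ^ j * of_int l))"
proof -
  let ?I = "{l::int. \<bar>2 ^ j * x - real k + 2 ^ j * of_int l\<bar> \<le> A}"
  have "(\<Sum>\<^sub>\<infinity>l. \<Psi> (2 ^ j * x - real k + 2 ^ j * of_int l)) =
        (\<Sum>\<^sub>\<infinity>l\<in>?I. \<Psi> (2 ^ j * x - real k + 2 ^ j * of_int l))"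
    by (rule infsum_cong_neutral) (use assms in \<open>auto simp: not_le\<close>)
  then show ?thesis
    unfolding periodized_wavelet_def using finite_translates[of "2 ^ j" "2 ^ j * x - real k" A] by simp
qed

lemma periodized_wavelet_measurable:
  assumes "mother_wavelet r \<Psi>"
  shows "periodized_wavelet \<Psi> j k \<in> borel_measurable borel"
proof -
  obtain A N where A: "A > 0" "\<And>x. \<bar>x\<bar> > A \<Longrightarrow> \<Psi> x = 0"
    using mother_wavelet_bounded_support[OF assms] by metis
  have [measurable]: "\<Psi> \<in> borel_measurable borel"
    by (rule borel_measurable_continuous_onI[OF mother_wavelet_continuous[OF assms]])
  define T where "T N x = 2 powr (real j / 2) * (\<Sum>l\<in>{- int N..int N}. \<Psi> (2 ^ j * x - real k + 2 ^ j * of_int l))" for N x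
  have "(\<lambda>N. T N x) \<longlonglongrightarrow> periodized_wavelet \<Psi> j k x" for x
  proof -
    let ?I = "{l::int. \<bar>2 ^ j * x - real k + 2 ^ j * of_int l\<bar> \<le> A}"
    have fin: "finite ?I" using finite_translates[of "2 ^ j" "2 ^ j * x - real k" A] by simp
    define N0 where "N0 = nat (\<Sum>l\<in>?I. \<bar>l\<bar>)"
    have "T N x = periodized_wavelet \<Psi> j k x" if "N \<ge> N0" for N
    proof -
      have "?I \<subseteq> {- int N..int N}"
      proof
        fix l assume l: "l \<in> ?I"
        then have "\<bar>l\<bar> \<le> (\<Sum>l\<in>?I. \<bar>l\<bar>)" using fin by (intro member_le_sum) auto
        also have "\<dots> \<le> int N" using that by (simp add: N0_def)
        finally show "l \<in> {- int N..int N}" by auto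
      qed
      then have "(\<Sum>l\<in>{- int N..int N}. \<Psi> (2 ^ j * x - real k + 2 ^ j * of_int l)) =
          (\<Sum>l\<in>?I. \<Psi> (2 ^ j * x - real k + 2 ^ j * of_int l))"
        by (intro sum.mono_neutral_right) (auto simp: not_le A(2))
      then show ?thesis
        unfolding T_def using periodized_wavelet_eq_sum[of A \<Psi> j k x, OF A(2)] by simp
    qed
    then show ?thesis by (intro tendsto_eventually) (auto simp: eventually_sequentially)
  qed
  then show ?thesis
  proof (rule borel_measurable_LIMSEQ_metric[where f=T, rotated])
    show "T N \<in> borel_measurable borel" for N unfolding T_def by measurable
  qed
qed

text \<open>At level \<open>j\<close> the shifts \<open>k - 2 ^ j * l\<close> with \<open>k < 2 ^ j\<close> run through distinct integers, so that at
  most \<open>2 * A + 1\<close> translates of the mother wavelet are nonzero at a given point.\<close>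

lemma wavelet_level_bound:
  assumes A: "\<And>x. \<bar>x\<bar> > A \<Longrightarrow> \<Psi> x = 0" "A > 0" and N: "\<And>x. \<bar>\<Psi> x\<bar> \<le> N"
  shows "(\<Sum>k<2 ^ j. (periodized_wavelet \<Psi> j k x)\<^sup>2) \<le> (N * (2 * A + 1))\<^sup>2 * 2 ^ j"
proof -
  let ?y = "2 ^ j * x"
  define I where "I k = {l::int. \<bar>?y - real k + 2 ^ j * of_int l\<bar> \<le> A}" for k
  define s where "s k = (\<Sum>l\<in>I k. \<Psi> (?y - real k + 2 ^ j * of_int l))" for k
  define h :: "nat \<times> int \<Rightarrow> int" where "h = (\<lambda>(k, l). int k - 2 ^ j * l)"
  have N0: "N \<ge> 0" using N[of 0] abs_ge_zero order_trans by blast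
  have fin: "finite (I k)" for k
    unfolding I_def using finite_translates[of "2 ^ j" "?y - real k" A] by simp
  have "inj_on h (Sigma {..<2 ^ j} I)"
  proof (rule inj_onI, clarify)
    fix k l k' l' assume k: "k < 2 ^ j" "k' < 2 ^ j" and e: "h (k, l) = h (k', l')"
    have "int k mod 2 ^ j = int k' mod 2 ^ j"
      using arg_cong[OF e, of "\<lambda>i. i mod 2 ^ j"] by (simp add: h_def mod_diff_eq[symmetric, of "int _"] del: mod_diff_eq)
    then have "k = k'" using k by (simp flip: of_nat_power of_nat_mod)
    with e show "k = k' \<and> l = l'" by (simp add: h_def)
  qed
  moreover have "h ` Sigma {..<2 ^ j} I \<subseteq> {\<lceil>?y - A\<rceil>..\<lfloor>?y + A\<rfloor>}"
    by (auto simp: h_def I_def ceiling_le_iff le_floor_iff abs_le_iff)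
  ultimately have "card (Sigma {..<2 ^ j} I) \<le> card {\<lceil>?y - A\<rceil>..\<lfloor>?y + A\<rfloor>}"
    by (intro card_inj_on_le) auto
  then have "(\<Sum>k<2 ^ j. card (I k)) \<le> nat (\<lfloor>?y + A\<rfloor> - \<lceil>?y - A\<rceil> + 1)"
    using fin by (simp add: card_SigmaI)
  then have "real (\<Sum>k<2 ^ j. card (I k)) \<le> real (nat (\<lfloor>?y + A\<rfloor> - \<lceil>?y - A\<rceil> + 1))" by (rule of_nat_mono)
  also have "\<dots> \<le> 2 * A + 1" using A(2) by linarith
  finally have card: "(\<Sum>k<2 ^ j. real (card (I k))) \<le> 2 * A + 1" by simp
  have "(\<Sum>k<2 ^ j. \<bar>s k\<bar>) \<le> (\<Sum>k<2 ^ j. real (card (I k)) * N)"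
    unfolding s_def by (intro sum_mono sum_norm_bound[where 'a=real, simplified] order_trans[OF sum_abs] sum_bounded_above N)
  also have "\<dots> = N * (\<Sum>k<2 ^ j. real (card (I k)))" by (simp add: sum_distrib_left mult.commute)
  also have "\<dots> \<le> N * (2 * A + 1)" using card N0 by (rule mult_left_mono)
  finally have s1: "(\<Sum>k<2 ^ j. \<bar>s k\<bar>) \<le> N * (2 * A + 1)" .
  have "(\<Sum>k<2 ^ j. (s k)\<^sup>2) \<le> (\<Sum>k<2 ^ j. \<bar>s k\<bar>)\<^sup>2"
  proof -
    have "L2_set s {..<2 ^ j} \<le> (\<Sum>k<2 ^ j. \<bar>s k\<bar>)" by (rule L2_set_le_sum_abs)
    then have "(L2_set s {..<2 ^ j})\<^sup>2 \<le> (\<Sum>k<2 ^ j. \<bar>s k\<bar>)\<^sup>2" by (rule power_mono) simp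
    then show ?thesis by (simp add: L2_set_def sum_nonneg)
  qed
  also have "\<dots> \<le> (N * (2 * A + 1))\<^sup>2" using s1 by (intro power_mono sum_nonneg) auto
  finally have s2: "(\<Sum>k<2 ^ j. (s k)\<^sup>2) \<le> (N * (2 * A + 1))\<^sup>2" .
  have "(periodized_wavelet \<Psi> j k x)\<^sup>2 = 2 ^ j * (s k)\<^sup>2" for k
  proof -
    have "(2 powr (real j / 2))\<^sup>2 = (2::real) ^ j"
      by (simp add: power2_eq_square powr_add[symmetric] powr_realpow)
    then show ?thesis
      using periodized_wavelet_eq_sum[of A \<Psi> j k x, OF A(1)]
      unfolding s_def I_def by (simp add: power_mult_distrib)
  qed
  then show ?thesis using s2 by (simp add: sum_distrib_left[symmetric] mult.commute)
qed

lemma wavelet_index_cases: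
  assumes "(l::nat) \<ge> 1"
  obtains j k where "k < 2 ^ j" "l = 2 ^ j + k"
proof -
  obtain j where "2 ^ j \<le> l" "l < 2 ^ (j + 1)" using dyadic_bracket[OF assms] by blast
  then show ?thesis by (intro that[of "l - 2 ^ j" j]) auto
qed

lemma sum_dyadic_block_shift:
  fixes a :: "nat \<Rightarrow> 'a::comm_monoid_add"
  shows "(\<Sum>l\<in>dyadic_block j. a l) = (\<Sum>k<2 ^ j. a (2 ^ j + k))"
  by (rule sum.reindex_bij_witness[where i="\<lambda>k. 2 ^ j + k" and j="\<lambda>l. l - 2 ^ j"]) auto

lemma wavelet_basis_measurable:
  assumes "is_wavelet_basis r \<phi>" "l \<ge> 1"
  shows "\<phi> l \<in> borel_measurable borel"
  using wavelet_index_cases[OF assms(2)] assms(1) periodized_wavelet_measurable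
  unfolding is_wavelet_basis_def by metis

lemma wavelet_basis_block_bounded:
  assumes "is_wavelet_basis r \<phi>"
  obtains B where "block_bounded B \<phi>"
proof -
  obtain \<Psi> where \<Psi>: "mother_wavelet r \<Psi>"
    and eq: "\<And>j k. k < 2 ^ j \<Longrightarrow> \<phi> (2 ^ j + k) = periodized_wavelet \<Psi> j k"
    using assms unfolding is_wavelet_basis_def by blast
  obtain A N where "A > 0" "\<And>x. \<bar>x\<bar> > A \<Longrightarrow> \<Psi> x = 0" "\<And>x. \<bar>\<Psi> x\<bar> \<le> N"
    using mother_wavelet_bounded_support[OF \<Psi>] by metis
  then have "block_bounded ((N * (2 * A + 1))\<^sup>2) \<phi>"
    unfolding block_bounded_def sum_dyadic_block_shift
    using wavelet_level_bound[of A \<Psi> N] eq by (simp add: eq)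
  then show ?thesis by (rule that)
qed

section \<open>Smoothness as decay of the coefficients over dyadic blocks\<close>

lemma enn_powr_less_top_iff: "enn_powr x a < \<infinity> \<longleftrightarrow> x < \<infinity>"
  by (simp add: enn_powr_def less_top[symmetric])

lemma enn_powr_ennreal: "x \<ge> 0 \<Longrightarrow> enn_powr (ennreal x) a = ennreal (x powr a)"
  by (simp add: enn_powr_def)

lemma sum_le_infsum_ennreal:
  fixes a :: "'a \<Rightarrow> ennreal"
  assumes "finite F" "F \<subseteq> I"
  shows "sum a F \<le> (\<Sum>\<^sub>\<infinity>i\<in>I. a i)"
proof -
  have "infsum a F \<le> infsum a I"
    using assms by (intro infsum_mono_neutral nonneg_summable_on_complete) auto
  then show ?thesis using assms by simp
qed

text \<open>This is how the outer index of a Besov norm disappears: whatever its value, the weighted norms of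
  the levels are bounded by the whole norm.\<close>

lemma lp_enorm_term_le:
  assumes p: "1 \<le> p" and fin: "lp_enorm p I a < \<infinity>" and i: "i \<in> I"
  shows "a i \<le> lp_enorm p I a"
proof (cases "p = \<infinity>")
  case True
  then show ?thesis using i by (simp add: lp_enorm_def SUP_upper)
next
  case False
  define P where "P = real_of_ereal p"
  have P: "P \<ge> 1" using p False unfolding P_def by (cases p) auto
  define S where "S = (\<Sum>\<^sub>\<infinity>i\<in>I. enn_powr (a i) P)"
  have n: "lp_enorm p I a = enn_powr S (1 / P)" using False by (simp add: lp_enorm_def S_def P_def)
  have S: "S < \<infinity>" using fin n enn_powr_less_top_iff by simp
  have le: "enn_powr (a i) P \<le> S"
    using sum_le_infsum_ennreal[of "{i}" I "\<lambda>i. enn_powr (a i) P"] i by (simp add: S_def)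
  obtain s where s: "S = ennreal s" "s \<ge> 0" using S by (cases S) auto
  have "enn_powr (a i) P < \<infinity>" using le S by (rule le_less_trans)
  then have "a i < \<infinity>" by (rule enn_powr_less_top_iff[THEN iffD1])
  then obtain x where x: "a i = ennreal x" "x \<ge> 0" by (cases "a i") auto
  have "x powr P \<le> s" using le s x by (simp add: enn_powr_ennreal)
  then have "(x powr P) powr (1 / P) \<le> s powr (1 / P)" using P by (intro powr_mono2) auto
  then have "x \<le> s powr (1 / P)" using P x by (simp add: powr_powr)
  then show ?thesis using s x n by (simp add: enn_powr_ennreal ennreal_leI)
qed



text \<open>Hoelder's inequality up to the factor two. The terms are split at a threshold \<open>t\<close>: a term below it
contributes at most the square of \<open>t\<close>, and a term \<open>a\<close> above it has \<open>a\<^sup>2 \<le> a powr P * t powr (2 - P)\<close>.\<close>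

lemma sum_squares_le_of_sum_powr:
  fixes a :: "'a \<Rightarrow> real"
  assumes P: "P \<ge> 2" and a: "\<And>k. k \<in> K \<Longrightarrow> a k \<ge> 0" and D: "D > 0" and K: "card K > 0"
    and s: "(\<Sum>k\<in>K. a k powr P) \<le> D powr P"
  shows "(\<Sum>k\<in>K. (a k)\<^sup>2) \<le> 2 * (real (card K) powr (1 - 2 / P) * D\<^sup>2)"
proof -
  let ?n = "real (card K)"
  \<comment> \<open>This threshold balances the two contributions below.\<close>
  define t where "t = D * ?n powr (- 1 / P)"
  have t: "t > 0" using D K by (simp add: t_def)
  have "(a k)\<^sup>2 \<le> t\<^sup>2 + a k powr P * t powr (2 - P)" if "k \<in> K" for k
  proof (cases "a k \<le> t")
    case True
    then have "(a k)\<^sup>2 \<le> t\<^sup>2" using a[OF that] by (intro power_mono)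
    then show ?thesis by (simp add: add_increasing2)
  next
    case False
    then have ak: "a k > 0" using t by linarith
    have "(a k)\<^sup>2 = a k powr P * a k powr (2 - P)"
      using ak by (simp add: powr_add[symmetric] powr_numeral)
    also have "\<dots> \<le> a k powr P * t powr (2 - P)"
      using False t P by (intro mult_left_mono powr_mono2') auto
    finally show ?thesis by (simp add: add_increasing)
  qed
  then have "(\<Sum>k\<in>K. (a k)\<^sup>2) \<le> (\<Sum>k\<in>K. t\<^sup>2 + a k powr P * t powr (2 - P))" by (rule sum_mono)
  also have "\<dots> = ?n * t\<^sup>2 + (\<Sum>k\<in>K. a k powr P) * t powr (2 - P)"
    by (simp add: sum.distrib sum_distrib_right)
  also have "\<dots> \<le> ?n * t\<^sup>2 + D powr P * t powr (2 - P)"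
    using s by (intro add_left_mono mult_right_mono) auto
  also have "?n * t\<^sup>2 = ?n powr (1 - 2 / P) * D\<^sup>2"
  proof -
    have "?n * t\<^sup>2 = ?n powr 1 * (?n powr (- 1 / P) * ?n powr (- 1 / P)) * D\<^sup>2"
      using K by (simp add: t_def power2_eq_square)
    also have "?n powr 1 * (?n powr (- 1 / P) * ?n powr (- 1 / P)) = ?n powr (1 + (- 1 / P + - 1 / P))"
      unfolding powr_add ..
    also have "1 + (- 1 / P + - 1 / P) = 1 - 2 / P" by simp
    finally show ?thesis .
  qed
  also have "D powr P * t powr (2 - P) = ?n powr (1 - 2 / P) * D\<^sup>2"
  proof -
    have "D powr P * t powr (2 - P) = (D powr P * D powr (2 - P)) * ?n powr (- 1 / P * (2 - P))"
      using D K by (simp add: t_def powr_mult powr_powr)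
    also have "D powr P * D powr (2 - P) = D\<^sup>2"
      using D by (simp add: powr_add[symmetric] powr_numeral)
    also have "- 1 / P * (2 - P) = 1 - 2 / P" using P by (simp add: field_simps)
    finally show ?thesis by simp
  qed
  finally show ?thesis by linarith
qed

lemma lp_enorm_imp_sum_squares:
  fixes a :: "nat \<Rightarrow> real"
  assumes p: "2 \<le> p" and a: "\<And>k. k \<in> K \<Longrightarrow> a k \<ge> 0" and D: "D > 0" and K: "finite K" "K \<noteq> {}"
    and s: "lp_enorm p (K :: nat set) (\<lambda>k. ennreal (a k)) \<le> ennreal D"
  shows "(\<Sum>k\<in>K. (a k)\<^sup>2) \<le> 2 * (real (card K) powr (1 - 2 * real_of_ereal (1 / p)) * D\<^sup>2)"
proof (cases "p = \<infinity>")
  case True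
  have "a k \<le> D" if "k \<in> K" for k
  proof -
    have "ennreal (a k) \<le> (SUP k\<in>K. ennreal (a k))" using that by (rule SUP_upper)
    also have "\<dots> \<le> ennreal D" using s True by (simp add: lp_enorm_def)
    finally show ?thesis using D by simp
  qed
  then have "(\<Sum>k\<in>K. (a k)\<^sup>2) \<le> (\<Sum>k\<in>K. D\<^sup>2)" using a by (intro sum_mono power_mono) auto
  also have "\<dots> \<le> 2 * (real (card K) * D\<^sup>2)" by simp
  finally show ?thesis using True K by (simp add: card_gt_0_iff)
next
  case False
  define P where "P = real_of_ereal p"
  have P: "P \<ge> 2" and p': "p = ereal P"
    using p False unfolding P_def by (cases p; force)+
  have inv: "real_of_ereal (1 / p) = 1 / P" using P by (simp add: p' one_ereal_def)
  have "lp_enorm p K (\<lambda>k. ennreal (a k)) = enn_powr (\<Sum>k\<in>K. ennreal (a k powr P)) (1 / P)"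
    using False K a by (simp add: lp_enorm_def P_def[symmetric] enn_powr_ennreal cong: sum.cong)
  also have "(\<Sum>k\<in>K. ennreal (a k powr P)) = ennreal (\<Sum>k\<in>K. a k powr P)"
    by (rule sum_ennreal) simp
  finally have "(\<Sum>k\<in>K. a k powr P) powr (1 / P) \<le> D"
    using s D by (simp add: enn_powr_ennreal sum_nonneg)
  then have "((\<Sum>k\<in>K. a k powr P) powr (1 / P)) powr P \<le> D powr P" using P by (intro powr_mono2) auto
  then have "(\<Sum>k\<in>K. a k powr P) \<le> D powr P" using P by (simp add: powr_powr sum_nonneg)
  then show ?thesis
    using sum_squares_le_of_sum_powr[of P K a, OF P a D] K by (simp add: inv card_gt_0_iff)
qed

text \<open>Passing from the \<open>lp\<close> to the \<open>l2\<close> norm of the \<open>2 ^ j\<close> coefficients of a level costs the factor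
\<open>2 powr (j * (1/2 - 1/p))\<close>, and this is the factor by which the Besov weight exceeds \<open>2 powr (j * \<gamma>)\<close>.\<close>

lemma besov_block_decay:
  assumes f: "f \<in> besov \<phi> \<gamma> p q" and p: "2 \<le> p" and q: "1 \<le> q"
  shows "\<exists>C. block_decay \<gamma> C (\<lambda>l. int01 (\<lambda>x. f x * \<phi> l x))"
proof -
  define \<theta> where "\<theta> l = int01 (\<lambda>x. f x * \<phi> l x)" for l
  define s where "s = \<gamma> + 1/2 - real_of_ereal (1 / p)"
  define u where "u j = lp_enorm p {..<2 ^ j} (\<lambda>k. ennreal \<bar>\<theta> (2 ^ j + k)\<bar>)" for j
  define S where "S = lp_enorm q UNIV (\<lambda>j. ennreal (2 powr (real j * s)) * u j)"
  have S: "S < \<infinity>"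
    using f unfolding besov_def besov_norm_def S_def u_def s_def \<theta>_def by (simp add: ennreal_add_less_top)
  then obtain S' where S': "S = ennreal S'" "S' \<ge> 0" by (cases S) auto
  have u: "u j \<le> ennreal ((S' + 1) * 2 powr (- real j * s))" for j
  proof -
    have "ennreal (2 powr (real j * s)) * u j \<le> ennreal S'"
      using lp_enorm_term_le[OF q, of UNIV "\<lambda>j. ennreal (2 powr (real j * s)) * u j" j] S S' by (simp add: S_def)
    then have "ennreal (2 powr (- real j * s)) * (ennreal (2 powr (real j * s)) * u j)
      \<le> ennreal (2 powr (- real j * s)) * ennreal S'"
      by (rule mult_left_mono) simp
    also have "ennreal (2 powr (- real j * s)) * (ennreal (2 powr (real j * s)) * u j) = u j"
      by (simp add: mult.assoc[symmetric] ennreal_mult[symmetric] powr_add[symmetric])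
    also have "ennreal (2 powr (- real j * s)) * ennreal S' = ennreal (S' * 2 powr (- real j * s))"
      using S' by (simp add: ennreal_mult[symmetric] mult.commute)
    also have "\<dots> \<le> ennreal ((S' + 1) * 2 powr (- real j * s))"
      by (intro ennreal_leI mult_right_mono) auto
    finally show ?thesis .
  qed
  have "(\<Sum>l\<in>dyadic_block j. (\<theta> l)\<^sup>2) \<le> (2 * (S' + 1)\<^sup>2) * (2 powr (- 2 * \<gamma>)) ^ j" for j
  proof -
    let ?D = "(S' + 1) * 2 powr (- real j * s)"
    have "(\<Sum>l\<in>dyadic_block j. (\<theta> l)\<^sup>2) = (\<Sum>k<2 ^ j. \<bar>\<theta> (2 ^ j + k)\<bar>\<^sup>2)"
      unfolding sum_dyadic_block_shift by simp
    also have "\<dots> \<le> 2 * (real (card {..<(2::nat) ^ j}) powr (1 - 2 * real_of_ereal (1 / p)) * ?D\<^sup>2)"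
      using S' u[of j] unfolding u_def by (intro lp_enorm_imp_sum_squares[OF p]) (auto simp: lessThan_empty_iff)
    also have "real (card {..<(2::nat) ^ j}) powr (1 - 2 * real_of_ereal (1 / p)) * ?D\<^sup>2 =
       (S' + 1)\<^sup>2 * (2 powr (real j * (1 - 2 * real_of_ereal (1 / p))) * (2 powr (- real j * s) * 2 powr (- real j * s)))"
      by (simp add: power2_eq_square powr_powr powr_realpow[symmetric])
    also have "2 powr (real j * (1 - 2 * real_of_ereal (1 / p))) * (2 powr (- real j * s) * 2 powr (- real j * s)) = (2 powr (- 2 * \<gamma>)) ^ j"
      unfolding powr_add[symmetric] two_powr_nat[symmetric] by (simp add: s_def algebra_simps)
    finally show ?thesis by simp
  qed
  then show ?thesis unfolding block_decay_def \<theta>_def by blast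
qed

lemma sobolev_block_decay:
  assumes f: "f \<in> sobolev \<phi> \<gamma>" and \<phi>: "orthonormal_basis \<phi>" and \<gamma>: "\<gamma> > 0"
  shows "\<exists>C. block_decay \<gamma> C (\<lambda>l. int01 (\<lambda>x. f x * \<phi> l x))"
proof -
  obtain \<theta> where \<theta>: "in_L2 f" "L2_sums \<phi> UNIV \<theta> f" "sobolev_norm \<gamma> \<theta> < \<infinity>"
    using f unfolding sobolev_def by blast
  have eq: "\<theta> l = int01 (\<lambda>x. f x * \<phi> l x)" for l
    using L2_sums_coefficient[OF \<theta>(1) orthonormal_basis_imp_on[OF \<phi>] \<theta>(2)] by (simp add: int01_eq)
  define S where "S = (\<Sum>\<^sub>\<infinity>l\<in>{1..}. ennreal (real l powr (2 * \<gamma>) * (\<theta> l)\<^sup>2))"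
  have "S < \<infinity>" using \<theta>(3) unfolding sobolev_norm_def enn_powr_less_top_iff S_def by (simp add: ennreal_add_less_top)
  then obtain s where s: "S = ennreal s" "s \<ge> 0" by (cases S) auto
  have "(\<Sum>l\<in>dyadic_block j. (\<theta> l)\<^sup>2) \<le> s * (2 powr (- 2 * \<gamma>)) ^ j" for j
  proof -
    have "1 \<le> (2::nat) ^ j" by simp
    then have "dyadic_block j \<subseteq> {1..}" by (meson atLeastLessThan_iff atLeast_iff order_trans subsetI)
    then have "ennreal (\<Sum>l\<in>dyadic_block j. real l powr (2 * \<gamma>) * (\<theta> l)\<^sup>2) \<le> S"
      unfolding S_def
      using sum_le_infsum_ennreal[of "dyadic_block j" "{1..}" "\<lambda>l. ennreal (real l powr (2 * \<gamma>) * (\<theta> l)\<^sup>2)"]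
        sum_ennreal[of "dyadic_block j" "\<lambda>l. real l powr (2 * \<gamma>) * (\<theta> l)\<^sup>2"] by simp
    then have *: "(\<Sum>l\<in>dyadic_block j. real l powr (2 * \<gamma>) * (\<theta> l)\<^sup>2) \<le> s" using s by simp
    have "2 powr (2 * \<gamma> * real j) * (\<Sum>l\<in>dyadic_block j. (\<theta> l)\<^sup>2) \<le> (\<Sum>l\<in>dyadic_block j. real l powr (2 * \<gamma>) * (\<theta> l)\<^sup>2)"
      unfolding sum_distrib_left
    proof (intro sum_mono mult_right_mono)
      fix l assume "l \<in> dyadic_block j"
      then have "(2::real) ^ j \<le> real l" by simp
      then have "(2 ^ j) powr (2 * \<gamma>) \<le> real l powr (2 * \<gamma>)" using \<gamma> by (intro powr_mono2) auto
      then show "2 powr (2 * \<gamma> * real j) \<le> real l powr (2 * \<gamma>)"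
        by (simp add: powr_realpow[symmetric] powr_powr mult.commute)
    qed simp
    also note *
    finally have "2 powr (- 2 * \<gamma> * real j) * (2 powr (2 * \<gamma> * real j) * (\<Sum>l\<in>dyadic_block j. (\<theta> l)\<^sup>2)) \<le> 2 powr (- 2 * \<gamma> * real j) * s"
      by (rule mult_left_mono) simp
    moreover have "2 powr (- 2 * \<gamma> * real j) * (2 powr (2 * \<gamma> * real j) * t) = t" for t :: real
      unfolding mult.assoc[symmetric] powr_add[symmetric] by simp
    ultimately show ?thesis unfolding two_powr_nat by (simp only: mult.commute[of s])
  qed
  then show ?thesis unfolding block_decay_def eq by blast
qed

section \<open>Exponential families over a block-bounded basis\<close>

abbreviation lin_comb :: "(nat \<Rightarrow> real \<Rightarrow> real) \<Rightarrow> nat \<Rightarrow> (nat \<Rightarrow> real) \<Rightarrow> real \<Rightarrow> real" where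
  "lin_comb \<phi> k \<theta> x \<equiv> \<Sum>l=1..k. \<theta> l * \<phi> l x"

lemma U01_integral_pos:
  assumes "integrable U01 f" "AE x in U01. f x > 0"
  shows "(LINT x|U01. f x) > (0::real)"
proof -
  have nn: "AE x in U01. 0 \<le> f x" using assms(2) by eventually_elim simp
  have "(LINT x|U01. f x) \<noteq> 0"
  proof
    assume "(LINT x|U01. f x) = 0"
    then have "AE x in U01. f x = 0" using integral_nonneg_eq_0_iff_AE[OF assms(1) nn] by simp
    then have "AE x in U01. False" using assms(2) by eventually_elim simp
    then show False using U01.AE_False by simp
  qed
  moreover have "(LINT x|U01. f x) \<ge> 0" using nn by (rule integral_nonneg_AE)
  ultimately show ?thesis by linarith
qed

lemma ln_integral_mono:
  assumes f: "integrable U01 f" and g: "integrable U01 g"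
    and a: "AE x in U01. f x > 0 \<and> g x > 0 \<and> ln (f x) \<le> ln (g x) + d"
  shows "ln (LINT x|U01. f x) \<le> ln (LINT x|U01. g x) + (d::real)"
proof -
  have "(LINT x|U01. f x) \<le> (LINT x|U01. exp d * g x)"
  proof (rule integral_mono_AE)
    show "AE x in U01. f x \<le> exp d * g x"
      using a
    proof eventually_elim
      case (elim x)
      then have "exp (ln (f x)) \<le> exp (ln (g x) + d)" unfolding exp_le_cancel_iff by blast
      then show ?case using elim by (simp add: exp_add mult.commute)
    qed
  qed (use f g in auto)
  then have *: "(LINT x|U01. f x) \<le> exp d * (LINT x|U01. g x)" by simp
  have pos: "(LINT x|U01. f x) > 0" "(LINT x|U01. g x) > 0"
    using a by (intro U01_integral_pos f g; force elim: eventually_mono)+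
  then have "ln (LINT x|U01. f x) \<le> ln (exp d * (LINT x|U01. g x))" using * by simp
  then show ?thesis using pos by (simp add: ln_mult)
qed

locale bounded_basis =
  fixes \<phi> :: "nat \<Rightarrow> real \<Rightarrow> real" and B :: real
  assumes phi_measurable: "\<And>l. l \<ge> 1 \<Longrightarrow> \<phi> l \<in> borel_measurable borel"
    and phi_orthonormal: "orthonormal_on \<phi> UNIV"
    and phi_0: "\<phi> 0 = indicator {0..1}"
    and phi_block: "block_bounded B \<phi>"
begin

lemma phi_borel[measurable]: "\<phi> l \<in> borel_measurable borel"
  using phi_measurable[of l] by (cases "l \<ge> 1") (auto simp: not_le phi_0)

lemma phi_borel_U01[measurable]: "\<phi> l \<in> borel_measurable U01"
  by (rule borel_measurable_U01) measurable

lemma integral_phi: "l \<ge> 1 \<Longrightarrow> (LINT x|U01. \<phi> l x) = 0"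
proof -
  assume l: "l \<ge> 1"
  then have "(LINT x|U01. \<phi> l x * \<phi> 0 x) = 0"
    using phi_orthonormal by (auto simp: orthonormal_on_def)
  moreover have "(LINT x|U01. \<phi> l x * \<phi> 0 x) = (LINT x|U01. \<phi> l x)"
    by (intro Bochner_Integration.integral_cong) (auto simp: phi_0 space_restrict_space)
  ultimately show ?thesis by simp
qed

lemma phi_sq_sum_le: "x \<in> {0..1} \<Longrightarrow> (\<Sum>l=1..k. (\<phi> l x)\<^sup>2) \<le> 2 * B * real k"
  using phi_block unfolding block_bounded_def by (intro block_bound_partial_sum) blast

lemma B_nonneg: "B \<ge> 0"
proof -
  have "0 \<le> (\<Sum>l=1..1. (\<phi> l 0)\<^sup>2)" by (rule sum_nonneg) simp
  also have "\<dots> \<le> 2 * B * real 1" by (rule phi_sq_sum_le) simp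
  finally show ?thesis by simp
qed

lemma lin_comb_le:
  assumes "x \<in> {0..1}"
  shows "\<bar>lin_comb \<phi> k \<theta> x\<bar> \<le> sqrt (\<Sum>l=1..k. (\<theta> l)\<^sup>2) * sqrt (2 * B * real k)"
  by (rule order_trans[OF sum_abs sum_mult_le_sqrt[OF order_refl phi_sq_sum_le[OF assms]]])

lemma lin_comb_measurable[measurable]: "lin_comb \<phi> k \<theta> \<in> borel_measurable borel"
  by measurable

lemma lin_comb_measurable_U01[measurable]: "lin_comb \<phi> k \<theta> \<in> borel_measurable U01"
  by (rule borel_measurable_U01) measurable

lemma exp_lin_comb_integrable: "integrable U01 (\<lambda>x. exp (lin_comb \<phi> k \<theta> x))"
proof (rule U01.integrable_const_bound)
  show "AE x in U01. norm (exp (lin_comb \<phi> k \<theta> x)) \<le> exp (sqrt (\<Sum>l=1..k. (\<theta> l)\<^sup>2) * sqrt (2 * B * real k))"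
    using lin_comb_le by (intro AE_I2) (auto simp: space_restrict_space intro: order_trans[OF abs_ge_self])
qed measurable

lemma normalizer_pos: "(LINT x|U01. exp (lin_comb \<phi> k \<theta> x)) > 0"
  by (intro U01_integral_pos exp_lin_comb_integrable) simp

lemma model_density_eq:
  "model_density \<phi> k \<theta> x = exp (lin_comb \<phi> k \<theta> x) / (LINT x|U01. exp (lin_comb \<phi> k \<theta> x))"
  unfolding model_density_def log_normalizer_def int01_eq exp_diff using normalizer_pos by simp

lemma model_density_pos: "model_density \<phi> k \<theta> x > 0"
  by (simp add: model_density_def)

lemma model_density_measurable[measurable]: "model_density \<phi> k \<theta> \<in> borel_measurable borel"
  unfolding model_density_def by measurable

lemma model_density_integrable: "integrable U01 (model_density \<phi> k \<theta>)"
  unfolding model_density_eq using exp_lin_comb_integrable by simp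

lemma model_density_integral: "(LINT x|U01. model_density \<phi> k \<theta> x) = 1"
  unfolding model_density_eq using normalizer_pos[of \<theta> k] by simp

text \<open>The exponent grows only linearly in \<open>k\<close>. Moving all coefficients by a small multiple of \<open>1 / (n * k)\<close>
thus changes the likelihood of \<open>n\<close> observations by a bounded factor, and grids of polynomially small
width are fine enough both for the prior mass and for the sieve.\<close>

lemma model_density_perturbation:
  assumes \<eta>: "\<And>l. l \<in> {1..k} \<Longrightarrow> \<bar>\<theta> l - \<theta>' l\<bar> \<le> \<eta>" "\<eta> \<ge> 0" and x: "x \<in> {0..1}"
  shows "model_density \<phi> k \<theta> x \<le> exp (2 * (\<eta> * real k * sqrt (2 * B))) * model_density \<phi> k \<theta>' x"
proof -
  let ?d = "\<eta> * real k * sqrt (2 * B)"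
  have close: "\<bar>lin_comb \<phi> k \<theta> y - lin_comb \<phi> k \<theta>' y\<bar> \<le> ?d" if y: "y \<in> {0..1}" for y
  proof -
    have "(\<Sum>l=1..k. (\<theta> l - \<theta>' l)\<^sup>2) \<le> (\<Sum>l=1..k. \<eta>\<^sup>2)"
      using \<eta> by (intro sum_mono) (simp add: abs_le_square_iff[symmetric])
    then have "sqrt (\<Sum>l=1..k. (\<theta> l - \<theta>' l)\<^sup>2) \<le> sqrt (real k) * \<eta>"
      using \<eta>(2) by (simp add: real_le_lsqrt power_mult_distrib sum_nonneg)
    then have "sqrt (\<Sum>l=1..k. (\<theta> l - \<theta>' l)\<^sup>2) * sqrt (2 * B * real k) \<le> sqrt (real k) * \<eta> * sqrt (2 * B * real k)"
      using B_nonneg by (intro mult_right_mono) auto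
    also have "\<dots> = ?d"
    proof -
      have "sqrt (real k) * sqrt (real k) = real k" by simp
      then show ?thesis by (simp add: real_sqrt_mult algebra_simps)
    qed
    finally have "\<bar>lin_comb \<phi> k (\<lambda>l. \<theta> l - \<theta>' l) y\<bar> \<le> ?d" using lin_comb_le[OF y, of "\<lambda>l. \<theta> l - \<theta>' l" k] by linarith
    then show ?thesis by (simp add: left_diff_distrib sum_subtractf)
  qed
  have "log_normalizer \<phi> k \<theta>' \<le> log_normalizer \<phi> k \<theta> + ?d"
    unfolding log_normalizer_def int01_eq using close
    by (intro ln_integral_mono exp_lin_comb_integrable AE_I2)
       (auto simp: space_restrict_space abs_le_iff algebra_simps)
  moreover have "lin_comb \<phi> k \<theta> x \<le> lin_comb \<phi> k \<theta>' x + ?d" using close[OF x] by linarith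
  ultimately show ?thesis unfolding model_density_def exp_add[symmetric] by simp
qed

end

section \<open>Approximation of the true density\<close>

lemma exp_le_quadratic:
  fixes x :: real
  assumes "\<bar>x\<bar> \<le> T"
  shows "exp x \<le> 1 + x + exp T * x\<^sup>2"
proof -
  obtain t where t: "\<bar>t\<bar> \<le> \<bar>x\<bar>" "exp x = (\<Sum>m<2. x ^ m / fact m) + exp t / fact 2 * x ^ 2"
    using Maclaurin_exp_le[of x 2] by blast
  have "exp t / 2 \<le> exp T"
  proof -
    have "exp t \<le> exp T" using t(1) assms by simp
    then show ?thesis using exp_gt_zero[of T] by linarith
  qed
  then have "exp t / 2 * x\<^sup>2 \<le> exp T * x\<^sup>2" by (rule mult_right_mono) simp
  then show ?thesis using t(2) by (simp add: numeral_2_eq_2)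
qed

locale log_density_expansion = bounded_basis +
  fixes f0 :: "real \<Rightarrow> real" and \<theta>0 :: "nat \<Rightarrow> real" and \<gamma> C b :: real
  assumes f0_measurable[measurable]: "f0 \<in> borel_measurable borel"
    and f0_nonneg: "\<And>x. f0 x \<ge> 0"
    and f0_integrable: "integrable U01 f0"
    and f0_integral: "(LINT x|U01. f0 x) = 1"
    and f0_log_bounded: "AE x in U01. f0 x > 0 \<and> \<bar>ln (f0 x)\<bar> \<le> b"
    and theta0_sums: "L2_sums \<phi> {1..} \<theta>0 (\<lambda>x. ln (f0 x) - int01 (\<lambda>y. ln (f0 y)))"
    and theta0_decay: "block_decay \<gamma> C \<theta>0"
    and gamma_gt_half: "\<gamma> > 1/2"
begin

definition log_mean :: real where "log_mean = (LINT x|U01. ln (f0 x))"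
definition remainder :: "nat \<Rightarrow> real \<Rightarrow> real" where
  "remainder k x = ln (f0 x) - log_mean - lin_comb \<phi> k \<theta>0 x"
definition lin_bound :: real where "lin_bound = sqrt (C * B) / (1 - 2 powr (1/2 - \<gamma>))"
definition rem_bound :: real where "rem_bound = 2 * b + lin_bound"
definition tail_const :: real where "tail_const = C * 2 powr (2 * \<gamma>) / (1 - 2 powr (- 2 * \<gamma>))"

lemma f0_measurable_U01[measurable]: "f0 \<in> borel_measurable U01"
  by (rule borel_measurable_U01) measurable

lemma ln_f0_in_L2: "in_L2 (\<lambda>x. ln (f0 x))"
  using f0_log_bounded by (intro in_L2_AE_bounded[of _ b]) (auto elim: eventually_mono)

lemma log_mean_le: "\<bar>log_mean\<bar> \<le> b"
proof -
  have "norm (LINT x|U01. ln (f0 x)) \<le> (LINT x|U01. norm (ln (f0 x)))" by (rule integral_norm_bound)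
  also have "\<dots> \<le> (LINT x|U01. b)"
    using f0_log_bounded in_L2_integrable[OF ln_f0_in_L2]
    by (intro integral_mono_AE) (auto elim: eventually_mono)
  finally show ?thesis using U01.prob_space by (simp add: log_mean_def)
qed

lemma centred_in_L2: "in_L2 (\<lambda>x. ln (f0 x) - log_mean)"
  by (intro in_L2_diff ln_f0_in_L2 in_L2_const)

lemma theta0_coefficient: "l \<ge> 1 \<Longrightarrow> \<theta>0 l = (LINT x|U01. (ln (f0 x) - log_mean) * \<phi> l x)"
  using L2_sums_coefficient[OF centred_in_L2 orthonormal_on_subset[OF phi_orthonormal], of "{1..}" \<theta>0 l]
    theta0_sums by (simp add: log_mean_def int01_eq)

lemma lin_comb_theta0_le: "x \<in> {0..1} \<Longrightarrow> \<bar>lin_comb \<phi> k \<theta>0 x\<bar> \<le> lin_bound"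
  unfolding lin_bound_def
  by (rule order_trans[OF sum_abs block_decay_absolute_sum[OF theta0_decay gamma_gt_half]])
     (use phi_block in \<open>auto simp: block_bounded_def\<close>)

lemma remainder_measurable[measurable]: "remainder k \<in> borel_measurable borel"
  unfolding remainder_def by measurable

lemma remainder_bounded: "AE x in U01. \<bar>remainder k x\<bar> \<le> rem_bound"
  using f0_log_bounded AE_space
proof eventually_elim
  case (elim x)
  then show ?case
    using log_mean_le lin_comb_theta0_le[of x k]
    unfolding remainder_def rem_bound_def by (simp add: space_restrict_space abs_le_iff)
qed

lemma remainder_measurable_U01[measurable]: "remainder k \<in> borel_measurable U01"
  by (rule borel_measurable_U01) measurable

lemma rem_bound_nonneg: "rem_bound \<ge> 0"
proof (rule ccontr)
  assume "\<not> rem_bound \<ge> 0"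
  then have "AE x in U01. False"
    by (intro eventually_mono[OF remainder_bounded[of 0]]) linarith
  then show False using U01.AE_False by simp
qed

lemma remainder_in_L2: "in_L2 (remainder k)"
  using remainder_bounded by (intro in_L2_AE_bounded borel_measurable_U01) auto

lemma tail_const_nonneg: "tail_const \<ge> 0"
  using block_decay_nonneg[OF theta0_decay] gamma_gt_half unfolding tail_const_def
  by (intro divide_nonneg_nonneg mult_nonneg_nonneg) (auto simp: powr_less_one less_imp_le)

lemma remainder_norm_diff:
  assumes "k \<le> N"
  shows "(LINT x|U01. (remainder k x)\<^sup>2) = (LINT x|U01. (remainder N x)\<^sup>2) + (\<Sum>l\<in>{k<..N}. (\<theta>0 l)\<^sup>2)"
proof -
  have e: "(LINT x|U01. (remainder n x)\<^sup>2) = (LINT x|U01. (ln (f0 x) - log_mean)\<^sup>2) - (\<Sum>l=1..n. (\<theta>0 l)\<^sup>2)" for n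
    unfolding remainder_def
    using L2_norm_diff_expansion[OF centred_in_L2 _ orthonormal_on_subset[OF phi_orthonormal], of "{1..n}" \<theta>0]
    by (simp add: theta0_coefficient[symmetric] power2_eq_square)
  have "{1..N} = {1..k} \<union> {k<..N}" using assms by auto
  then have "(\<Sum>l=1..N. (\<theta>0 l)\<^sup>2) = (\<Sum>l=1..k. (\<theta>0 l)\<^sup>2) + (\<Sum>l\<in>{k<..N}. (\<theta>0 l)\<^sup>2)"
    by (simp only:) (rule sum.union_disjoint; auto)
  then show ?thesis by (simp add: e)
qed

lemma remainder_norm_le:
  assumes "k \<ge> 1"
  shows "(LINT x|U01. (remainder k x)\<^sup>2) \<le> tail_const * real k powr (- 2 * \<gamma>)"
proof -
  have "(\<lambda>N. LINT x|U01. (remainder N x)\<^sup>2) \<longlonglongrightarrow> 0"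
  proof -
    have "{1..} \<inter> {..N} = {1..N}" for N :: nat by auto
    then show ?thesis
      using theta0_sums unfolding L2_sums_def remainder_def by (simp add: int01_eq log_mean_def)
  qed
  then have "(\<lambda>N. (LINT x|U01. (remainder N x)\<^sup>2) + tail_const * real k powr (- 2 * \<gamma>))
     \<longlonglongrightarrow> 0 + tail_const * real k powr (- 2 * \<gamma>)"
    by (intro tendsto_intros)
  moreover have "(LINT x|U01. (remainder k x)\<^sup>2) \<le> (LINT x|U01. (remainder N x)\<^sup>2) + tail_const * real k powr (- 2 * \<gamma>)"
    if "N \<ge> k" for N
    using remainder_norm_diff[OF that] block_decay_tail[OF theta0_decay _ assms, of N] gamma_gt_half
    unfolding tail_const_def by simp
  ultimately show ?thesis
    by (intro tendsto_lowerbound[OF _ _ sequentially_bot]) (auto simp: eventually_sequentially)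
qed

lemma f0_le: "AE x in U01. f0 x \<le> exp b"
  using f0_log_bounded
proof eventually_elim
  case (elim x)
  then have "exp (ln (f0 x)) \<le> exp b" unfolding exp_le_cancel_iff by linarith
  then show ?case using elim by (metis exp_ln)
qed

lemma f0_exp_remainder_le:
  assumes s: "s = 1 \<or> s = -1"
  shows "integrable U01 (\<lambda>x. f0 x * exp (s * remainder k x))"
    "(LINT x|U01. f0 x * exp (s * remainder k x)) \<le>
      1 + s * (LINT x|U01. f0 x * remainder k x) + exp (rem_bound + b) * (LINT x|U01. (remainder k x)\<^sup>2)"
proof -
  have [measurable]: "remainder k \<in> borel_measurable U01" by (rule borel_measurable_U01) measurable
  have f0: "in_L2 f0"
    using f0_le f0_nonneg by (intro in_L2_AE_bounded[of _ "exp b"]) auto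
  have i1: "integrable U01 (\<lambda>x. f0 x * remainder k x)" by (rule in_L2_mult_integrable[OF f0 remainder_in_L2])
  have i2: "integrable U01 (\<lambda>x. (remainder k x)\<^sup>2)" using remainder_in_L2[of k] by (simp add: in_L2_iff)
  show i3: "integrable U01 (\<lambda>x. f0 x * exp (s * remainder k x))"
  proof (rule Bochner_Integration.integrable_bound[where f="\<lambda>x. exp rem_bound * f0 x"])
    show "AE x in U01. norm (f0 x * exp (s * remainder k x)) \<le> norm (exp rem_bound * f0 x)"
      using remainder_bounded[of k]
    proof eventually_elim
      case (elim x)
      then have "s * remainder k x \<le> rem_bound" using s by (auto simp: abs_le_iff)
      then have "exp (s * remainder k x) \<le> exp rem_bound" by simp
      then have "f0 x * exp (s * remainder k x) \<le> f0 x * exp rem_bound"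
        by (rule mult_left_mono) (rule f0_nonneg)
      then show ?case using f0_nonneg[of x] by (simp add: abs_mult mult.commute)
    qed
  qed (use f0_integrable in auto)
  have "(LINT x|U01. f0 x * exp (s * remainder k x)) \<le>
     (LINT x|U01. f0 x + s * (f0 x * remainder k x) + exp (rem_bound + b) * (remainder k x)\<^sup>2)"
  proof (rule integral_mono_AE[OF i3])
    show "AE x in U01. f0 x * exp (s * remainder k x) \<le>
       f0 x + s * (f0 x * remainder k x) + exp (rem_bound + b) * (remainder k x)\<^sup>2"
      using remainder_bounded[of k] f0_le
    proof eventually_elim
      case (elim x)
      have "\<bar>s * remainder k x\<bar> \<le> rem_bound" using elim s by auto
      then have "exp (s * remainder k x) \<le> 1 + s * remainder k x + exp rem_bound * (s * remainder k x)\<^sup>2"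
        by (rule exp_le_quadratic)
      also have "(s * remainder k x)\<^sup>2 = (remainder k x)\<^sup>2" using s by auto
      finally have "f0 x * exp (s * remainder k x) \<le> f0 x * (1 + s * remainder k x + exp rem_bound * (remainder k x)\<^sup>2)"
        by (rule mult_left_mono) (rule f0_nonneg)
      also have "\<dots> = f0 x + s * (f0 x * remainder k x) + f0 x * (exp rem_bound * (remainder k x)\<^sup>2)"
        by (simp add: algebra_simps)
      also have "f0 x * (exp rem_bound * (remainder k x)\<^sup>2) \<le> exp b * (exp rem_bound * (remainder k x)\<^sup>2)"
        using elim by (intro mult_right_mono) auto
      finally show ?case by (simp add: exp_add mult_ac)
    qed
  qed (use i1 i2 f0_integrable in auto)
  also have "\<dots> = 1 + s * (LINT x|U01. f0 x * remainder k x) + exp (rem_bound + b) * (LINT x|U01. (remainder k x)\<^sup>2)"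
    using i1 i2 f0_integrable f0_integral by simp
  finally show "(LINT x|U01. f0 x * exp (s * remainder k x)) \<le>
      1 + s * (LINT x|U01. f0 x * remainder k x) + exp (rem_bound + b) * (LINT x|U01. (remainder k x)\<^sup>2)" .
qed

definition chi_const :: real where "chi_const = 2 * exp (rem_bound + b) * tail_const"

lemma chi_const_nonneg: "chi_const \<ge> 0"
  by (simp add: chi_const_def tail_const_nonneg)

text \<open>Write \<open>w\<close> for the remainder of \<open>log f0\<close> after \<open>k\<close> coefficients. The integral equals the product of the
integrals of \<open>f0 * exp w\<close> and \<open>f0 * exp (- w)\<close>, because the second one is the normalising constant of
the projection up to a factor that cancels. A second order expansion bounds them by \<open>1 + a + q\<close> and
\<open>1 - a + q\<close>, where \<open>a\<close> is the mean of \<open>w\<close> under \<open>f0\<close> and \<open>q\<close> is of the order of its squared norm. The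
first order terms cancel in the product, so that the squared bias \<open>k powr (- 2 * \<gamma>)\<close> appears, not the bias. With a bound on this integral, which is
one plus a chi-square divergence, Markov's inequality alone controls the likelihood of the projection.\<close>

lemma chi_square_projection:
  assumes k: "k \<ge> 1"
  shows "(\<integral>\<^sup>+x. ennreal (f0 x) * ennreal (f0 x / model_density \<phi> k \<theta>0 x) \<partial>U01)
    \<le> ennreal (exp (chi_const * real k powr (- 2 * \<gamma>)))"
proof -
  let ?Z = "LINT x|U01. exp (lin_comb \<phi> k \<theta>0 x)"
  let ?P = "LINT x|U01. f0 x * exp (1 * remainder k x)"
  let ?M = "LINT x|U01. f0 x * exp ((-1) * remainder k x)"
  define a where "a = (LINT x|U01. f0 x * remainder k x)"
  define q where "q = exp (rem_bound + b) * (LINT x|U01. (remainder k x)\<^sup>2)"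
  have q0: "q \<ge> 0" by (simp add: q_def)
  have q: "2 * q \<le> chi_const * real k powr (- 2 * \<gamma>)"
    using remainder_norm_le[OF k] unfolding q_def chi_const_def by (simp add: mult.assoc)
  have P: "?P \<le> 1 + a + q" using f0_exp_remainder_le(2)[of 1 k] by (simp add: a_def q_def)
  have M: "?M \<le> 1 - a + q" using f0_exp_remainder_le(2)[of "-1" k] by (simp add: a_def q_def)
  have nn: "?P \<ge> 0" "?M \<ge> 0" using f0_nonneg by simp_all
  have Z: "?Z = exp (- log_mean) * ?M"
  proof -
    have "?Z = (LINT x|U01. exp (- log_mean) * (f0 x * exp ((-1) * remainder k x)))"
    proof (rule integral_cong_AE)
      show "AE x in U01. exp (lin_comb \<phi> k \<theta>0 x) = exp (- log_mean) * (f0 x * exp ((-1) * remainder k x))"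
        using f0_log_bounded
      proof eventually_elim
        case (elim x)
        then have "f0 x = exp (ln (f0 x))" by simp
        then have "exp (- log_mean) * (f0 x * exp ((-1) * remainder k x)) = exp (- log_mean + (ln (f0 x) + (-1) * remainder k x))"
          unfolding exp_add by (simp only:)
        then show ?case by (simp add: remainder_def)
      qed
    qed measurable
    then show ?thesis by simp
  qed
  have "(\<integral>\<^sup>+x. ennreal (f0 x) * ennreal (f0 x / model_density \<phi> k \<theta>0 x) \<partial>U01)
    = (\<integral>\<^sup>+x. ennreal (?M * (f0 x * exp (1 * remainder k x))) \<partial>U01)"
  proof (rule nn_integral_cong_AE)
    show "AE x in U01. ennreal (f0 x) * ennreal (f0 x / model_density \<phi> k \<theta>0 x)
       = ennreal (?M * (f0 x * exp (1 * remainder k x)))"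
      using f0_log_bounded
    proof eventually_elim
      case (elim x)
      then have "f0 x = exp (ln (f0 x))" by simp
      moreover have "ln (f0 x) = remainder k x + log_mean + lin_comb \<phi> k \<theta>0 x" by (simp add: remainder_def)
      ultimately have "f0 x = exp (remainder k x) * exp log_mean * exp (lin_comb \<phi> k \<theta>0 x)"
        by (metis exp_add)
      then have "f0 x / model_density \<phi> k \<theta>0 x = ?Z * exp log_mean * exp (remainder k x)"
        using normalizer_pos[of \<theta>0 k] by (simp add: model_density_eq field_simps)
      also have "\<dots> = ?M * exp (1 * remainder k x)" unfolding Z by (simp add: exp_minus field_simps)
      finally have "f0 x / model_density \<phi> k \<theta>0 x = ?M * exp (1 * remainder k x)" .
      then show ?case using f0_nonneg nn by (simp add: ennreal_mult[symmetric] mult_ac)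
    qed
  qed
  also have "\<dots> = ennreal (?M * ?P)"
    using f0_exp_remainder_le(1)[of 1 k] f0_nonneg nn by (subst nn_integral_eq_integral) auto
  also have "?M * ?P \<le> (1 - a + q) * (1 + a + q)"
    using P M nn by (intro mult_mono) auto
  also have "\<dots> = (1 + q)\<^sup>2 - a\<^sup>2" by (simp add: power2_eq_square algebra_simps)
  also have "\<dots> \<le> (exp q)\<^sup>2"
    using exp_ge_add_one_self[of q] q0 by (smt (verit) power_mono zero_le_power2)
  also have "\<dots> = exp (2 * q)" by (simp add: exp_double)
  also have "\<dots> \<le> exp (chi_const * real k powr (- 2 * \<gamma>))" using q by simp
  finally show ?thesis by (simp add: ennreal_leI)
qed

end

section \<open>Hellinger distance and coefficient distance\<close>

text \<open>For \<open>v = log f - log f0\<close> the right-hand absolute value is the integrand of the Hellinger distance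
relative to \<open>f0\<close>. It controls \<open>v\<close> linearly as long as \<open>v\<close> is bounded.\<close>

lemma abs_exp_half_minus_one_ge:
  fixes v :: real
  assumes "\<bar>v\<bar> \<le> 2 * T"
  shows "\<bar>v\<bar> \<le> 2 * (1 + T) * \<bar>exp (v / 2) - 1\<bar>"
proof (cases "v \<ge> 0")
  case True
  have T: "T \<ge> 0" using assms by linarith
  define w where "w = v / 2"
  have "w \<le> \<bar>exp w - 1\<bar>" using exp_ge_add_one_self[of w] by linarith
  then have "v \<le> 2 * \<bar>exp (v / 2) - 1\<bar>" by (simp add: w_def)
  also have "\<dots> \<le> 2 * (1 + T) * \<bar>exp (v / 2) - 1\<bar>" using T by (intro mult_right_mono) auto
  finally show ?thesis using True by simp
next
  case False
  define u where "u = - v / 2"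
  have u: "u > 0" "u \<le> T" using False assms by (auto simp: u_def)
  have "(1 + u) * exp (- u) \<le> exp u * exp (- u)"
    by (intro mult_right_mono exp_ge_add_one_self) auto
  then have "(1 + u) * exp (- u) \<le> 1" by (simp add: exp_minus)
  then have "u \<le> (1 + u) * (1 - exp (- u))" by (simp add: algebra_simps)
  also have "\<dots> \<le> (1 + T) * (1 - exp (- u))" using u by (intro mult_right_mono) auto
  finally have "2 * u \<le> 2 * (1 + T) * (1 - exp (- u))" by linarith
  moreover have "\<bar>exp (v / 2) - 1\<bar> = 1 - exp (- u)" using u by (simp add: u_def)
  moreover have "\<bar>v\<bar> = 2 * u" using False by (simp add: u_def)
  ultimately show ?thesis by simp
qed

context log_density_expansion
begin

lemma sqrt_prod_integrable:
  "integrable U01 (\<lambda>x. sqrt (f0 x * model_density \<phi> k \<theta> x))"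
proof (rule Bochner_Integration.integrable_bound)
  show "integrable U01 (\<lambda>x. f0 x + model_density \<phi> k \<theta> x)"
    using f0_integrable model_density_integrable by auto
  show "(\<lambda>x. sqrt (f0 x * model_density \<phi> k \<theta> x)) \<in> borel_measurable U01"
    by (rule borel_measurable_U01) measurable
  have "sqrt (s * t) \<le> s + t" if "s \<ge> 0" "t \<ge> 0" for s t :: real
    using that by (intro real_le_lsqrt) (auto simp: power2_eq_square algebra_simps)
  then show "AE x in U01. norm (sqrt (f0 x * model_density \<phi> k \<theta> x)) \<le> norm (f0 x + model_density \<phi> k \<theta> x)"
    using f0_nonneg model_density_pos by (intro AE_I2) (simp add: less_imp_le add_nonneg_nonneg)
qed

lemma hellinger_integrable:
  "integrable U01 (\<lambda>x. (sqrt (f0 x) - sqrt (model_density \<phi> k \<theta> x))\<^sup>2)"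
  "(LINT x|U01. (sqrt (f0 x) - sqrt (model_density \<phi> k \<theta> x))\<^sup>2) =
     2 - 2 * (LINT x|U01. sqrt (f0 x * model_density \<phi> k \<theta> x))"
proof -
  have e: "(\<lambda>x. (sqrt (f0 x) - sqrt (model_density \<phi> k \<theta> x))\<^sup>2) =
    (\<lambda>x. f0 x + model_density \<phi> k \<theta> x - 2 * sqrt (f0 x * model_density \<phi> k \<theta> x))"
    using f0_nonneg model_density_pos by (auto simp: power2_diff real_sqrt_mult less_imp_le)
  show "integrable U01 (\<lambda>x. (sqrt (f0 x) - sqrt (model_density \<phi> k \<theta> x))\<^sup>2)"
    unfolding e using sqrt_prod_integrable f0_integrable model_density_integrable by auto
  show "(LINT x|U01. (sqrt (f0 x) - sqrt (model_density \<phi> k \<theta> x))\<^sup>2) =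
     2 - 2 * (LINT x|U01. sqrt (f0 x * model_density \<phi> k \<theta> x))"
    unfolding e using sqrt_prod_integrable f0_integrable model_density_integrable
    by (simp add: f0_integral model_density_integral)
qed

lemma hellinger_sq:
  "(hellinger f0 (model_density \<phi> k \<theta>))\<^sup>2 = (LINT x|U01. (sqrt (f0 x) - sqrt (model_density \<phi> k \<theta> x))\<^sup>2)"
  unfolding hellinger_def int01_eq by simp

lemma hellinger_nonneg: "hellinger f0 f \<ge> 0"
  unfolding hellinger_def int01_eq by simp

text \<open>The mean of the square root of the likelihood ratio is the Hellinger affinity, that is one minus half
the squared distance.\<close>

lemma hellinger_affinity:
  assumes h: "r \<le> hellinger f0 (model_density \<phi> k \<theta>)" "r \<ge> 0"
  shows "(\<integral>\<^sup>+x. ennreal (f0 x) * ennreal (sqrt (model_density \<phi> k \<theta> x / f0 x)) \<partial>U01) \<le> ennreal (exp (- r\<^sup>2 / 2))"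
proof -
  have "(\<integral>\<^sup>+x. ennreal (f0 x) * ennreal (sqrt (model_density \<phi> k \<theta> x / f0 x)) \<partial>U01)
     = (\<integral>\<^sup>+x. ennreal (sqrt (f0 x * model_density \<phi> k \<theta> x)) \<partial>U01)"
  proof (rule nn_integral_cong)
    fix x
    have "f0 x * sqrt (model_density \<phi> k \<theta> x / f0 x) = sqrt (f0 x * model_density \<phi> k \<theta> x)"
    proof -
      have "f0 x * sqrt (model_density \<phi> k \<theta> x / f0 x) = sqrt ((f0 x)\<^sup>2 * (model_density \<phi> k \<theta> x / f0 x))"
        unfolding real_sqrt_mult using f0_nonneg[of x] by simp
      also have "(f0 x)\<^sup>2 * (model_density \<phi> k \<theta> x / f0 x) = f0 x * model_density \<phi> k \<theta> x"
        by (simp add: power2_eq_square)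
      finally show ?thesis .
    qed
    then show "ennreal (f0 x) * ennreal (sqrt (model_density \<phi> k \<theta> x / f0 x)) = ennreal (sqrt (f0 x * model_density \<phi> k \<theta> x))"
      using f0_nonneg[of x] model_density_pos[of k \<theta> x] by (simp add: ennreal_mult[symmetric] less_imp_le)
  qed
  also have "\<dots> = ennreal (LINT x|U01. sqrt (f0 x * model_density \<phi> k \<theta> x))"
    using f0_nonneg model_density_pos by (intro nn_integral_eq_integral sqrt_prod_integrable AE_I2) (simp add: less_imp_le)
  also have "(LINT x|U01. sqrt (f0 x * model_density \<phi> k \<theta> x)) = 1 - (hellinger f0 (model_density \<phi> k \<theta>))\<^sup>2 / 2"
    unfolding hellinger_sq hellinger_integrable(2) by (simp add: field_simps)
  also have "\<dots> \<le> 1 - r\<^sup>2 / 2" using power_mono[OF h] by simp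
  also have "\<dots> \<le> exp (- r\<^sup>2 / 2)" using exp_ge_add_one_self[of "- r\<^sup>2 / 2"] by simp
  finally show ?thesis by (simp add: ennreal_leI)
qed

definition l2_const :: real where "l2_const = 4 * exp (b / 2) * (1 + rem_bound)"

lemma l2_const_pos: "l2_const > 0"
  using rem_bound_nonneg by (simp add: l2_const_def)

text \<open>The coefficients of \<open>v = log f - log f0\<close> are the differences of the parameters, so by Bessel the
  \<open>l2\<close> distance is at most the \<open>L2\<close> norm of \<open>v\<close>. That norm is at most a multiple of \<open>(1 + T) * h\<close>, where
  \<open>2 * T\<close> bounds \<open>v\<close> uniformly, and \<open>T\<close> itself is at most a constant plus \<open>sqrt K\<close> times the \<open>l2\<close>
  distance. The resulting inequality can be solved for the \<open>l2\<close> distance once \<open>sqrt K * h\<close> is small,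
  and no logarithmic factor is lost.\<close>

lemma l2_dist_le_hellinger:
  fixes \<theta> :: "nat \<Rightarrow> real" and k :: nat
  defines "h \<equiv> hellinger f0 (model_density \<phi> k \<theta>)"
  assumes k: "k \<le> K" and supp: "\<And>l. l \<notin> {1..k} \<Longrightarrow> \<theta> l = 0"
    and small: "4 * exp (b / 2) * sqrt (2 * B * real K) * h \<le> 1"
  shows "l2_dist \<theta>0 \<theta> \<le> l2_const * h"
proof -
  define v where "v x = ln (model_density \<phi> k \<theta> x) - ln (f0 x)" for x
  define d where "d x = lin_comb \<phi> k \<theta> x - (ln (f0 x) - log_mean)" for x
  define D where "D = l2_dist \<theta>0 \<theta>"
  define s where "s = sqrt (2 * B * real K)"
  define T where "T = D * s + rem_bound"
  have h0: "h \<ge> 0" unfolding h_def by (rule hellinger_nonneg)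
  have v_eq: "v x = d x + (- log_mean - log_normalizer \<phi> k \<theta>)" for x
    unfolding v_def d_def model_density_def by simp
  have d_L2: "in_L2 d" unfolding d_def
  proof (intro in_L2_diff[OF _ centred_in_L2] in_L2_sum in_L2_scale)
    show "in_L2 (\<phi> l)" for l using phi_orthonormal by (simp add: orthonormal_on_def)
  qed
  have v_L2: "in_L2 v" unfolding v_eq by (intro in_L2_add d_L2 in_L2_const)
  have coef: "(LINT x|U01. v x * \<phi> l x) = \<theta> l - \<theta>0 l" if l: "l \<ge> 1" for l
  proof -
    have phi: "in_L2 (\<phi> m)" for m using phi_orthonormal by (simp add: orthonormal_on_def)
    note int[simp] = in_L2_integrable[OF phi] in_L2_mult_integrable[OF phi phi]
      in_L2_mult_integrable[OF centred_in_L2 phi]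
    have "(LINT x|U01. v x * \<phi> l x) = (LINT x|U01. (\<Sum>m=1..k. \<theta> m * (\<phi> m x * \<phi> l x)) -
        (ln (f0 x) - log_mean) * \<phi> l x + (- log_mean - log_normalizer \<phi> k \<theta>) * \<phi> l x)"
      unfolding v_eq d_def
      by (intro Bochner_Integration.integral_cong refl) (simp add: algebra_simps sum_distrib_left)
    also have "\<dots> = (\<Sum>m=1..k. \<theta> m * (LINT x|U01. \<phi> m x * \<phi> l x)) - \<theta>0 l"
      using integral_phi[OF l] theta0_coefficient[OF l] by simp
    also have "(\<Sum>m=1..k. \<theta> m * (LINT x|U01. \<phi> m x * \<phi> l x)) = (\<Sum>m=1..k. if m = l then \<theta> l else 0)"
      using phi_orthonormal by (intro sum.cong) (auto simp: orthonormal_on_def)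
    also have "\<dots> = \<theta> l" using supp[of l] by simp
    finally show ?thesis .
  qed
  have bessel: "(\<Sum>l\<in>J. (\<theta>0 l - \<theta> l)\<^sup>2) \<le> (LINT x|U01. (v x)\<^sup>2)" if "finite J" "J \<subseteq> {1..}" for J
  proof -
    have "(\<Sum>l\<in>J. (\<theta>0 l - \<theta> l)\<^sup>2) = (\<Sum>l\<in>J. (LINT x|U01. v x * \<phi> l x)\<^sup>2)"
      using that by (intro sum.cong) (auto simp: coef power2_commute)
    also have "\<dots> \<le> (LINT x|U01. (v x)\<^sup>2)"
      by (rule bessel_inequality[OF v_L2 that(1) orthonormal_on_subset[OF phi_orthonormal]]) simp
    finally show ?thesis .
  qed
  have summ: "(\<lambda>l. (\<theta>0 l - \<theta> l)\<^sup>2) summable_on {1..}"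
    using bessel by (intro nonneg_bdd_above_summable_on bdd_aboveI[of _ "LINT x|U01. (v x)\<^sup>2"]) auto
  have D_v: "D \<le> sqrt (LINT x|U01. (v x)\<^sup>2)"
    unfolding D_def l2_dist_def using bessel by (intro real_sqrt_le_mono infsum_le_finite_sums summ) auto
  have D0: "D \<ge> 0" unfolding D_def l2_dist_def by (simp add: infsum_nonneg)
  have partial: "sqrt (\<Sum>l=1..k. (\<theta> l - \<theta>0 l)\<^sup>2) \<le> D"
  proof -
    have "(\<Sum>l=1..k. (\<theta> l - \<theta>0 l)\<^sup>2) = (\<Sum>l=1..k. (\<theta>0 l - \<theta> l)\<^sup>2)" by (simp add: power2_commute)
    also have "\<dots> \<le> (\<Sum>\<^sub>\<infinity>l\<in>{1..}. (\<theta>0 l - \<theta> l)\<^sup>2)"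
      by (intro finite_sum_le_infsum summ) auto
    finally show ?thesis unfolding D_def l2_dist_def by (rule real_sqrt_le_mono)
  qed
  have d_le: "AE x in U01. \<bar>d x\<bar> \<le> T"
    using remainder_bounded[of k] AE_space
  proof eventually_elim
    case (elim x)
    then have x: "x \<in> {0..1}" by (simp add: space_restrict_space)
    have "\<bar>lin_comb \<phi> k (\<lambda>l. \<theta> l - \<theta>0 l) x\<bar> \<le> sqrt (\<Sum>l=1..k. (\<theta> l - \<theta>0 l)\<^sup>2) * sqrt (2 * B * real k)"
      by (rule lin_comb_le[OF x])
    also have "\<dots> \<le> D * s"
      unfolding s_def using partial D0 k B_nonneg
      by (intro mult_mono real_sqrt_le_mono mult_left_mono) (auto intro: sum_nonneg)
    finally have "\<bar>lin_comb \<phi> k (\<lambda>l. \<theta> l - \<theta>0 l) x\<bar> \<le> D * s" .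
    moreover have "d x = lin_comb \<phi> k (\<lambda>l. \<theta> l - \<theta>0 l) x - remainder k x"
      by (simp add: d_def remainder_def left_diff_distrib sum_subtractf)
    ultimately show ?case using elim unfolding T_def by linarith
  qed
  let ?g = "\<lambda>x. exp (- log_mean) * f0 x"
  have g: "integrable U01 ?g" "(LINT x|U01. ?g x) = exp (- log_mean)"
    using f0_integrable f0_integral by auto
  have ln_g: "AE x in U01. f0 x > 0 \<and> ln (?g x) = lin_comb \<phi> k \<theta> x - d x"
    using f0_log_bounded by eventually_elim (simp add: ln_mult d_def)
  have "ln (LINT x|U01. exp (lin_comb \<phi> k \<theta> x)) \<le> ln (LINT x|U01. ?g x) + T"
  proof (intro ln_integral_mono exp_lin_comb_integrable g)
    show "AE x in U01. exp (lin_comb \<phi> k \<theta> x) > 0 \<and> ?g x > 0 \<and> ln (exp (lin_comb \<phi> k \<theta> x)) \<le> ln (?g x) + T"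
      using d_le ln_g by eventually_elim (simp add: abs_le_iff)
  qed
  moreover have "ln (LINT x|U01. ?g x) \<le> ln (LINT x|U01. exp (lin_comb \<phi> k \<theta> x)) + T"
  proof (intro ln_integral_mono exp_lin_comb_integrable g)
    show "AE x in U01. ?g x > 0 \<and> exp (lin_comb \<phi> k \<theta> x) > 0 \<and> ln (?g x) \<le> ln (exp (lin_comb \<phi> k \<theta> x)) + T"
      using d_le ln_g by eventually_elim (simp add: abs_le_iff)
  qed
  ultimately have norm_le: "\<bar>- log_mean - log_normalizer \<phi> k \<theta>\<bar> \<le> T"
    unfolding log_normalizer_def int01_eq g(2) by (simp add: abs_le_iff)
  have v_le: "AE x in U01. \<bar>v x\<bar> \<le> 2 * T"
    using d_le
  proof eventually_elim
    case (elim x)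
    then show ?case using norm_le v_eq[of x] by linarith
  qed
  have T0: "T \<ge> 0" using D0 rem_bound_nonneg B_nonneg by (simp add: T_def s_def)
  have "(LINT x|U01. (v x)\<^sup>2) \<le> (LINT x|U01. (2 * (1 + T) * exp (b / 2))\<^sup>2 * (sqrt (f0 x) - sqrt (model_density \<phi> k \<theta> x))\<^sup>2)"
  proof (rule integral_mono_AE)
    show "AE x in U01. (v x)\<^sup>2 \<le> (2 * (1 + T) * exp (b / 2))\<^sup>2 * (sqrt (f0 x) - sqrt (model_density \<phi> k \<theta> x))\<^sup>2"
      using v_le f0_log_bounded
    proof eventually_elim
      case (elim x)
      define f where "f = model_density \<phi> k \<theta> x"
      have f: "f > 0" by (simp add: f_def model_density_pos)
      have sq: "sqrt t = exp (ln t / 2)" if "t > 0" for t :: real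
        using that by (simp add: ln_sqrt[symmetric])
      have "sqrt f = sqrt (f0 x) * exp (v x / 2)"
        using f elim by (simp add: sq exp_add[symmetric] v_def f_def[symmetric] field_simps)
      then have "sqrt (f0 x) - sqrt f = - (sqrt (f0 x) * (exp (v x / 2) - 1))"
        by (simp add: right_diff_distrib)
      then have e: "\<bar>sqrt (f0 x) - sqrt f\<bar> = sqrt (f0 x) * \<bar>exp (v x / 2) - 1\<bar>"
        using elim by (simp only: abs_minus_cancel abs_mult) simp
      have "- b / 2 \<le> ln (f0 x) / 2" using elim by (simp add: abs_le_iff)
      then have lo: "exp (- b / 2) \<le> sqrt (f0 x)" using elim by (subst sq) auto
      have "\<bar>v x\<bar> \<le> 2 * (1 + T) * \<bar>exp (v x / 2) - 1\<bar>" using elim by (intro abs_exp_half_minus_one_ge) auto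
      also have "\<dots> = 2 * (1 + T) * exp (b / 2) * (exp (- b / 2) * \<bar>exp (v x / 2) - 1\<bar>)"
        by (simp add: exp_minus field_simps)
      also have "\<dots> \<le> 2 * (1 + T) * exp (b / 2) * (sqrt (f0 x) * \<bar>exp (v x / 2) - 1\<bar>)"
        using lo T0 by (intro mult_left_mono mult_right_mono) auto
      finally have "\<bar>v x\<bar> \<le> 2 * (1 + T) * exp (b / 2) * \<bar>sqrt (f0 x) - sqrt f\<bar>" by (simp add: e)
      then have "\<bar>v x\<bar>\<^sup>2 \<le> (2 * (1 + T) * exp (b / 2) * \<bar>sqrt (f0 x) - sqrt f\<bar>)\<^sup>2"
        by (rule power_mono) simp
      then show ?case unfolding power_mult_distrib power2_abs f_def .
    qed
  qed (use v_L2 hellinger_integrable in \<open>auto simp: in_L2_iff\<close>)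
  also have "\<dots> = (2 * (1 + T) * exp (b / 2) * h)\<^sup>2"
    unfolding h_def power_mult_distrib hellinger_sq by simp
  finally have "sqrt (LINT x|U01. (v x)\<^sup>2) \<le> sqrt ((2 * (1 + T) * exp (b / 2) * h)\<^sup>2)" by (rule real_sqrt_le_mono)
  then have "D \<le> 2 * (1 + T) * exp (b / 2) * h"
    using D_v T0 h0 by simp
  also have "\<dots> = 2 * exp (b / 2) * (1 + rem_bound) * h + (2 * exp (b / 2) * s * h) * D"
    by (simp add: T_def algebra_simps)
  also have "(2 * exp (b / 2) * s * h) * D \<le> (1/2) * D"
    using small D0 unfolding s_def by (intro mult_right_mono) auto
  finally show ?thesis unfolding D_def[symmetric] l2_const_def by (simp add: algebra_simps)
qed

lemma model_density_measurable_joint[measurable]: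
  "(\<lambda>(x, \<theta>). model_density \<phi> k \<theta> x) \<in> borel_measurable (borel \<Otimes>\<^sub>M (\<Pi>\<^sub>M l\<in>UNIV. borel))"
proof -
  have [measurable]: "(\<lambda>\<theta>. log_normalizer \<phi> k \<theta>) \<in> borel_measurable (\<Pi>\<^sub>M l\<in>UNIV. borel)"
  proof -
    have [measurable]: "(\<lambda>z. lin_comb \<phi> k (fst z) (snd z)) \<in> borel_measurable ((\<Pi>\<^sub>M l\<in>UNIV. borel) \<Otimes>\<^sub>M lborel)"
      by measurable
    show ?thesis
      unfolding log_normalizer_def set_lebesgue_integral_def
      by (intro borel_measurable_ln sigma_finite_measure.borel_measurable_lebesgue_integral sigma_finite_lborel)
         (simp add: split_beta')
  qed
  show ?thesis
    unfolding model_density_def split_beta' by measurable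
qed

lemma hellinger_measurable[measurable]:
  "(\<lambda>\<theta>. hellinger f0 (model_density \<phi> k \<theta>)) \<in> borel_measurable (\<Pi>\<^sub>M l\<in>UNIV. borel)"
proof -
  have [measurable]: "(\<lambda>z. model_density \<phi> k (fst z) (snd z)) \<in> borel_measurable ((\<Pi>\<^sub>M l\<in>UNIV. borel) \<Otimes>\<^sub>M lborel)"
    using measurable_compose[OF _ model_density_measurable_joint, of "\<lambda>z. (snd z, fst z)"] by simp
  have [measurable]: "(\<lambda>\<theta>. LINT x|lborel. indicator {0..1} x *\<^sub>R (sqrt (f0 x) - sqrt (model_density \<phi> k \<theta> x))\<^sup>2)
      \<in> borel_measurable (\<Pi>\<^sub>M l\<in>UNIV. borel)"
    by (intro sigma_finite_measure.borel_measurable_lebesgue_integral sigma_finite_lborel)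
       (simp add: split_beta')
  show ?thesis
    unfolding hellinger_def set_lebesgue_integral_def by measurable
qed

end

section \<open>The prior\<close>

lemma block_decay_weighted:
  assumes d: "block_decay \<gamma> C \<theta>" and \<beta>: "\<gamma> < \<beta>" "\<beta> > 0" and k: "k \<ge> 1"
  shows "(\<Sum>l=1..k. (real l powr \<beta> * \<theta> l)\<^sup>2) \<le>
    C * 2 powr (2 * \<beta>) * (2 powr (2 * (\<beta> - \<gamma>)) / (2 powr (2 * (\<beta> - \<gamma>)) - 1)) * real k powr (2 * (\<beta> - \<gamma>))"
proof -
  let ?s = "2 powr (2 * (\<beta> - \<gamma>)) :: real"
  have C: "C \<ge> 0" by (rule block_decay_nonneg[OF d])
  have s: "?s > 1" using \<beta> by (simp add: gr_one_powr)
  obtain J where J: "2 ^ J \<le> k" "k < 2 ^ (J + 1)" using dyadic_bracket[OF k] by blast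
  have "(\<Sum>l=1..k. (real l powr \<beta> * \<theta> l)\<^sup>2) \<le> (\<Sum>l\<in>{2 ^ 0..<2 ^ (J + 1)}. (real l powr \<beta> * \<theta> l)\<^sup>2)"
    using J by (intro sum_mono2) auto
  also have "\<dots> = (\<Sum>i\<in>{0..<J + 1}. \<Sum>l\<in>dyadic_block i. (real l powr \<beta> * \<theta> l)\<^sup>2)"
    by (rule sum_dyadic_blocks) simp
  also have "\<dots> \<le> (\<Sum>i\<in>{0..<J + 1}. C * 2 powr (2 * \<beta>) * ?s ^ i)"
  proof (rule sum_mono)
    fix i
    have "(\<Sum>l\<in>dyadic_block i. (real l powr \<beta> * \<theta> l)\<^sup>2) \<le> (\<Sum>l\<in>dyadic_block i. 2 powr (2 * \<beta> * real (i + 1)) * (\<theta> l)\<^sup>2)"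
    proof (rule sum_mono)
      fix l assume l: "l \<in> dyadic_block i"
      have "real l \<le> real (2 ^ (i + 1))" using l by (intro of_nat_mono) auto
      also have "real (2 ^ (i + 1)) = 2 powr real (i + 1)" by (subst powr_realpow) auto
      finally have "real l powr \<beta> \<le> (2 powr real (i + 1)) powr \<beta>" using \<beta> by (intro powr_mono2) auto
      then have "(real l powr \<beta>)\<^sup>2 \<le> ((2 powr real (i + 1)) powr \<beta>)\<^sup>2" by (rule power_mono) simp
      also have "\<dots> = 2 powr (2 * \<beta> * real (i + 1))"
        by (simp add: power2_eq_square powr_powr powr_add[symmetric] algebra_simps)
      finally show "(real l powr \<beta> * \<theta> l)\<^sup>2 \<le> 2 powr (2 * \<beta> * real (i + 1)) * (\<theta> l)\<^sup>2"
        unfolding power_mult_distrib by (rule mult_right_mono) simp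
    qed
    also have "\<dots> = 2 powr (2 * \<beta> * real (i + 1)) * (\<Sum>l\<in>dyadic_block i. (\<theta> l)\<^sup>2)"
      by (simp only: sum_distrib_left)
    also have "\<dots> \<le> 2 powr (2 * \<beta> * real (i + 1)) * (C * (2 powr (- 2 * \<gamma>)) ^ i)"
      using d unfolding block_decay_def by (intro mult_left_mono) (blast, simp)
    also have "\<dots> = C * 2 powr (2 * \<beta>) * (2 powr (2 * \<beta> * real i) * 2 powr (- 2 * \<gamma> * real i))"
      unfolding two_powr_nat[of "- 2 * \<gamma>"] by (simp add: powr_add[symmetric] algebra_simps)
    also have "2 powr (2 * \<beta> * real i) * 2 powr (- 2 * \<gamma> * real i) = ?s ^ i"
      unfolding powr_add[symmetric] two_powr_nat[symmetric] by (simp add: algebra_simps)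
    finally show "(\<Sum>l\<in>dyadic_block i. (real l powr \<beta> * \<theta> l)\<^sup>2) \<le> C * 2 powr (2 * \<beta>) * ?s ^ i" .
  qed
  also have "\<dots> = C * 2 powr (2 * \<beta>) * (\<Sum>i<J + 1. ?s ^ i)"
    by (simp only: sum_distrib_left lessThan_atLeast0)
  finally have *: "(\<Sum>l=1..k. (real l powr \<beta> * \<theta> l)\<^sup>2) \<le> C * 2 powr (2 * \<beta>) * (\<Sum>i<J + 1. ?s ^ i)" .
  have "(\<Sum>i<J + 1. ?s ^ i) = (?s ^ (J + 1) - 1) / (?s - 1)"
    using s by (intro geometric_sum) auto
  also have "\<dots> \<le> ?s ^ (J + 1) / (?s - 1)" using s by (intro divide_right_mono) auto
  also have "\<dots> = ?s / (?s - 1) * ?s ^ J" by simp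
  also have "\<dots> \<le> ?s / (?s - 1) * real k powr (2 * (\<beta> - \<gamma>))"
  proof (rule mult_left_mono)
    have "?s ^ J = (2 ^ J) powr (2 * (\<beta> - \<gamma>))"
      by (simp add: powr_realpow[symmetric] powr_powr mult.commute)
    also have "\<dots> \<le> real k powr (2 * (\<beta> - \<gamma>))" using J(1) \<beta> by (intro powr_mono2) auto
    finally show "?s ^ J \<le> real k powr (2 * (\<beta> - \<gamma>))" .
  qed (use s in simp)
  finally have "C * 2 powr (2 * \<beta>) * (\<Sum>i<J + 1. ?s ^ i) \<le>
      C * 2 powr (2 * \<beta>) * (?s / (?s - 1) * real k powr (2 * (\<beta> - \<gamma>)))"
    using C by (intro mult_left_mono) auto
  with * show ?thesis by (simp only: mult.assoc)
qed

text \<open>The prior penalises the normalised coefficient \<open>l powr \<beta> * \<theta> l\<close> by its \<open>p\<close>-th power. The total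
  penalty of a target of smoothness above \<open>1/2\<close> is of the order of the number of coefficients.
  For \<open>p \<le> 2\<close> the power is at most one plus the square; for larger \<open>p\<close> it is at most the power \<open>p / 2\<close> of the
  sum of squares, and this remains linear for \<open>\<beta>\<close> below \<open>1/2 + 1/p\<close>.\<close>

lemma weighted_coefficients_powr_sum:
  assumes d: "block_decay \<gamma> C \<theta>" and \<gamma>: "\<gamma> > 1/2" and \<beta>: "1/2 < \<beta>" "\<beta> < 1" and p: "p > 0"
    and \<beta>p: "p > 2 \<Longrightarrow> \<beta> < 1/2 + 1 / p"
  shows "\<exists>D\<ge>0. \<forall>k\<ge>1. (\<Sum>l=1..k. \<bar>real l powr \<beta> * \<theta> l\<bar> powr p) \<le> D * real k"
proof -
  \<comment> \<open>with the smoothness lowered to a value below \<open>\<beta>\<close>, the weighted sums of squares are bounded by a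
     positive power of \<open>k\<close> in all cases\<close>
  define \<gamma>' where "\<gamma>' = min \<gamma> ((1/2 + \<beta>) / 2)"
  define \<delta> where "\<delta> = \<beta> - \<gamma>'"
  have \<delta>: "\<delta> > 0" "\<delta> < 1/2" "p > 2 \<Longrightarrow> \<delta> * p \<le> 1"
  proof -
    show "\<delta> > 0" "\<delta> < 1/2" using \<gamma> \<beta> by (auto simp: \<delta>_def \<gamma>'_def min_def field_simps)
    assume p2: "p > 2"
    define q where "q = 1 / p"
    have "\<beta> - 1/2 < q" using \<beta>p[OF p2] by (simp add: q_def)
    moreover have "\<gamma>' = \<gamma> \<or> \<gamma>' = (1/2 + \<beta>) / 2" by (auto simp: \<gamma>'_def min_def)
    ultimately have "\<delta> < q" using \<gamma> \<beta> unfolding \<delta>_def by (elim disjE) (simp_all add: field_simps)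
    then have "\<delta> < 1 / p" by (simp add: q_def)
    then show "\<delta> * p \<le> 1" using p by (simp add: field_simps)
  qed
  have "block_decay \<gamma>' C \<theta>" by (rule block_decay_mono[OF d]) (simp add: \<gamma>'_def)
  note W = block_decay_weighted[OF this, of \<beta>]
  define A where "A = C * 2 powr (2 * \<beta>) * (2 powr (2 * \<delta>) / (2 powr (2 * \<delta>) - 1))"
  have sq: "(\<Sum>l=1..k. (real l powr \<beta> * \<theta> l)\<^sup>2) \<le> A * real k powr (2 * \<delta>)" if "k \<ge> 1" for k
    using W[of k] that \<beta> \<delta>(1) unfolding A_def \<delta>_def by simp
  have A: "A \<ge> 0" using order_trans[OF sum_nonneg sq[of 1]] by simp
  show ?thesis
  proof (cases "p \<le> 2")
    case True
    have "(\<Sum>l=1..k. \<bar>real l powr \<beta> * \<theta> l\<bar> powr p) \<le> (1 + A) * real k" if k: "k \<ge> 1" for k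
    proof -
      have "\<bar>x\<bar> powr p \<le> 1 + x\<^sup>2" for x :: real
      proof (cases "\<bar>x\<bar> \<le> 1")
        case True
        then have "\<bar>x\<bar> powr p \<le> 1 powr p" using p by (intro powr_mono2) auto
        then show ?thesis by (simp add: add_increasing2)
      next
        case False
        then have "\<bar>x\<bar> powr p \<le> \<bar>x\<bar> powr 2" using True by (intro powr_mono) auto
        also have "\<dots> = x\<^sup>2" by (simp add: powr_numeral[of "\<bar>x\<bar>" "num.Bit0 num.One"])
        finally show ?thesis by simp
      qed
      then have "(\<Sum>l=1..k. \<bar>real l powr \<beta> * \<theta> l\<bar> powr p) \<le> (\<Sum>l=1..k. 1 + (real l powr \<beta> * \<theta> l)\<^sup>2)"
        by (intro sum_mono)
      also have "\<dots> \<le> real k + A * real k powr (2 * \<delta>)" using sq[OF k] by (simp add: sum.distrib)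
      also have "\<dots> \<le> real k + A * real k powr 1"
        using k \<delta> A by (intro add_left_mono mult_left_mono powr_mono) auto
      finally show ?thesis using k by (simp add: algebra_simps)
    qed
    then show ?thesis using A by (intro exI[of _ "1 + A"]) auto
  next
    case False
    have "(\<Sum>l=1..k. \<bar>real l powr \<beta> * \<theta> l\<bar> powr p) \<le> A powr (p / 2) * real k" if k: "k \<ge> 1" for k
    proof -
      define T where "T = A * real k powr (2 * \<delta>)"
      define S where "S = (\<Sum>l=1..k. (real l powr \<beta> * \<theta> l)\<^sup>2)"
      have S: "S \<le> T" "S \<ge> 0" using sq[OF k] by (auto simp: S_def T_def intro: sum_nonneg)
      have "\<bar>real l powr \<beta> * \<theta> l\<bar> powr p \<le> (real l powr \<beta> * \<theta> l)\<^sup>2 * S powr (p / 2 - 1)" if l: "l \<in> {1..k}" for l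
      proof -
        define x where "x = \<bar>real l powr \<beta> * \<theta> l\<bar>"
        have x: "x\<^sup>2 \<le> S" unfolding x_def S_def power2_abs
          using l by (intro member_le_sum[of l _ "\<lambda>l. (real l powr \<beta> * \<theta> l)\<^sup>2"]) auto
        have "x powr p = x\<^sup>2 * (x\<^sup>2) powr (p / 2 - 1)"
        proof (cases "x = 0")
          case False
          then have "x > 0" by (simp add: x_def)
          then have "x\<^sup>2 = x powr 2" by (simp add: powr_numeral)
          then show ?thesis by (simp add: powr_powr powr_add[symmetric])
        qed (use p in simp)
        also have "\<dots> \<le> x\<^sup>2 * S powr (p / 2 - 1)"
          using x False by (intro mult_left_mono powr_mono2) auto
        finally show ?thesis by (simp add: x_def)
      qed
      then have "(\<Sum>l=1..k. \<bar>real l powr \<beta> * \<theta> l\<bar> powr p) \<le> (\<Sum>l=1..k. (real l powr \<beta> * \<theta> l)\<^sup>2 * S powr (p / 2 - 1))"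
        by (rule sum_mono)
      also have "\<dots> = S * S powr (p / 2 - 1)" by (simp add: S_def sum_distrib_right)
      also have "\<dots> = S powr (p / 2)"
      proof (cases "S = 0")
        case False
        have "S * S powr (p / 2 - 1) = S powr 1 * S powr (p / 2 - 1)" using S by simp
        also have "\<dots> = S powr (p / 2)" unfolding powr_add[symmetric] by simp
        finally show ?thesis .
      qed (use p in simp)
      also have "\<dots> \<le> T powr (p / 2)" using S p by (intro powr_mono2) auto
      also have "\<dots> = A powr (p / 2) * real k powr (\<delta> * p)"
        using A by (simp add: T_def powr_mult powr_powr)
      also have "\<dots> \<le> A powr (p / 2) * real k powr 1"
        using k \<delta> False by (intro mult_left_mono powr_mono) auto
      finally show ?thesis using k by simp
    qed
    then show ?thesis by (intro exI[of _ "A powr (p / 2)"]) auto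
  qed
qed

text \<open>An exponential beats every power, so the integrand is dominated by a multiple of \<open>1 / (1 + x\<^sup>2)\<close>.\<close>

lemma exp_neg_powr_integral_finite:
  assumes c: "c > 0" and p: "p > 0"
  shows "(\<integral>\<^sup>+x. ennreal (exp (- c * \<bar>x\<bar> powr p)) \<partial>lborel) < \<infinity>"
proof -
  obtain N :: nat where N: "2 / p \<le> real N" using real_arch_simple by blast
  define D where "D = max 1 (fact N / c ^ N)"
  have D: "D \<ge> 1" "fact N / c ^ N \<le> D" by (auto simp: D_def)
  have "exp (- c * \<bar>x\<bar> powr p) \<le> 2 * D * inverse (1 + x\<^sup>2)" for x :: real
  proof (cases "\<bar>x\<bar> \<le> 1")
    case True
    then have "x\<^sup>2 \<le> 1" by (simp add: abs_square_le_1)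
    have "exp (- c * \<bar>x\<bar> powr p) \<le> 1" using c by simp
    also have "1 \<le> 2 * inverse (1 + x\<^sup>2)" using \<open>x\<^sup>2 \<le> 1\<close> by (simp add: field_simps add_pos_nonneg)
    also have "\<dots> \<le> 2 * D * inverse (1 + x\<^sup>2)" using D by (intro mult_right_mono) auto
    finally show ?thesis .
  next
    case False
    define t where "t = c * \<bar>x\<bar> powr p"
    have t: "t > 0" using c False by (simp add: t_def)
    have "t ^ N / fact N \<le> exp t"
    proof -
      obtain s where "exp t = (\<Sum>m<Suc N. t ^ m / fact m) + exp s / fact (Suc N) * t ^ Suc N"
        using Maclaurin_exp_le[of t "Suc N"] by blast
      moreover have "(\<Sum>m<N. t ^ m / fact m) \<ge> 0" using t by (intro sum_nonneg) auto
      moreover have "exp s / fact (Suc N) * t ^ Suc N \<ge> 0" using t by (intro mult_nonneg_nonneg divide_nonneg_nonneg) auto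
      ultimately show ?thesis by simp
    qed
    then have "exp (- t) \<le> fact N / t ^ N" using t by (simp add: exp_minus field_simps)
    also have "\<dots> = fact N / c ^ N / \<bar>x\<bar> powr (p * real N)"
      using False by (simp add: t_def power_mult_distrib powr_realpow[symmetric] powr_powr)
    also have "\<dots> \<le> D / \<bar>x\<bar> powr (p * real N)" using D by (intro divide_right_mono) auto
    also have "\<dots> \<le> D / \<bar>x\<bar> powr 2"
    proof (intro divide_left_mono powr_mono)
      show "2 \<le> p * real N" using N p by (simp add: field_simps)
    qed (use D False in auto)
    also have "\<bar>x\<bar> powr 2 = x\<^sup>2" by (simp add: powr_numeral[of "\<bar>x\<bar>" "num.Bit0 num.One"])
    also have "D / x\<^sup>2 \<le> 2 * D * inverse (1 + x\<^sup>2)"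
    proof -
      have "1 < \<bar>x\<bar>\<^sup>2" using False by (intro one_less_power) auto
      then have x2: "x\<^sup>2 > 1" by simp
      then have "D * 1 \<le> D * x\<^sup>2" using D by (intro mult_left_mono) auto
      moreover have "x\<^sup>2 > 0" "1 + x\<^sup>2 > 0" using x2 by linarith+
      ultimately show ?thesis by (simp add: divide_simps) (simp add: algebra_simps)
    qed
    finally show ?thesis by (simp add: t_def)
  qed
  then have "(\<integral>\<^sup>+x. ennreal (exp (- c * \<bar>x\<bar> powr p)) \<partial>lborel) \<le> (\<integral>\<^sup>+x. ennreal (2 * D * inverse (1 + x\<^sup>2)) \<partial>lborel)"
    by (intro nn_integral_mono ennreal_leI)
  also have "\<dots> < \<infinity>"
  proof -
    have "integrable lborel (\<lambda>x::real. 2 * D * inverse (1 + x\<^sup>2))"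
      using integrable_inverse_1_plus_square by (simp add: set_integrable_def einterval_def)
    then show ?thesis using D by (subst nn_integral_eq_integral) auto
  qed
  finally show ?thesis .
qed

abbreviation coord_law :: "(real \<Rightarrow> real) \<Rightarrow> real measure" where
  "coord_law g \<equiv> density lborel (\<lambda>x. ennreal (g x))"

lemma coordinate_density_measurable: "coordinate_density p g \<Longrightarrow> g \<in> borel_measurable borel"
  unfolding coordinate_density_def by (intro borel_measurable_continuous_onI) auto

lemma prob_space_coord_law:
  assumes "coordinate_density p g"
  shows "prob_space (coord_law g)"
proof -
  have g: "integrable lborel g" "(LINT x|lborel. g x) = 1" "\<And>x. g x \<ge> 0" "g \<in> borel_measurable borel"
    using assms coordinate_density_measurable[OF assms] unfolding coordinate_density_def by (auto simp: less_imp_le)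
  show ?thesis
    by (rule prob_spaceI) (use g in \<open>simp add: emeasure_density nn_integral_eq_integral\<close>)
qed

lemma coord_law_tail:
  assumes g: "coordinate_density p g" and p: "p > 0"
  obtains D c where "D > 0" "c > 0"
    "\<And>R. R \<ge> 0 \<Longrightarrow> emeasure (coord_law g) {y. \<bar>y\<bar> > R} \<le> ennreal (D * exp (- c * R powr p))"
proof -
  obtain C c where C: "C > 0" "c > 0" "\<And>x. g x \<le> C * exp (- c * \<bar>x\<bar> powr p)"
    using g unfolding coordinate_density_def by blast
  note [measurable] = coordinate_density_measurable[OF g]
  define I where "I = (\<integral>\<^sup>+x. ennreal (exp (- (c / 2) * \<bar>x\<bar> powr p)) \<partial>lborel)"
  have "I < \<infinity>" unfolding I_def using C p by (intro exp_neg_powr_integral_finite) auto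
  then obtain i where i: "I = ennreal i" "i \<ge> 0" by (cases I) auto
  have "emeasure (coord_law g) {y. \<bar>y\<bar> > R} \<le> ennreal ((C * i + 1) * exp (- (c / 2) * R powr p))" if R: "R \<ge> 0" for R
  proof -
    have "emeasure (coord_law g) {y. \<bar>y\<bar> > R} = (\<integral>\<^sup>+x. ennreal (g x) * indicator {y. \<bar>y\<bar> > R} x \<partial>lborel)"
      by (rule emeasure_density) auto
    also have "\<dots> \<le> (\<integral>\<^sup>+x. ennreal (C * exp (- (c / 2) * R powr p)) * ennreal (exp (- (c / 2) * \<bar>x\<bar> powr p)) \<partial>lborel)"
    proof (rule nn_integral_mono)
      fix x :: real
      have "g x \<le> C * exp (- (c / 2) * R powr p) * exp (- (c / 2) * \<bar>x\<bar> powr p)" if x: "\<bar>x\<bar> > R"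
      proof -
        have "R powr p \<le> \<bar>x\<bar> powr p" using x R p by (intro powr_mono2) auto
        then have "c / 2 * R powr p \<le> c / 2 * \<bar>x\<bar> powr p" using C by (intro mult_left_mono) auto
        then have "- c * \<bar>x\<bar> powr p \<le> - (c / 2) * R powr p + - (c / 2) * \<bar>x\<bar> powr p" by linarith
        then have "exp (- c * \<bar>x\<bar> powr p) \<le> exp (- (c / 2) * R powr p) * exp (- (c / 2) * \<bar>x\<bar> powr p)"
          unfolding exp_add[symmetric] by simp
        then have "C * exp (- c * \<bar>x\<bar> powr p) \<le> C * (exp (- (c / 2) * R powr p) * exp (- (c / 2) * \<bar>x\<bar> powr p))"
          using C by (intro mult_left_mono) auto
        then show ?thesis using C(3)[of x] by (simp add: mult.assoc)
      qed
      then show "ennreal (g x) * indicator {y. \<bar>y\<bar> > R} x \<le>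
          ennreal (C * exp (- (c / 2) * R powr p)) * ennreal (exp (- (c / 2) * \<bar>x\<bar> powr p))"
        using C by (auto simp: indicator_def ennreal_mult[symmetric] intro!: ennreal_leI)
    qed
    also have "\<dots> = ennreal (C * exp (- (c / 2) * R powr p)) * I"
      unfolding I_def by (rule nn_integral_cmult) simp
    also have "\<dots> = ennreal (C * i * exp (- (c / 2) * R powr p))"
      using C i by (simp add: ennreal_mult[symmetric] mult_ac)
    also have "\<dots> \<le> ennreal ((C * i + 1) * exp (- (c / 2) * R powr p))"
      by (intro ennreal_leI mult_right_mono) auto
    finally show ?thesis .
  qed
  then show ?thesis using C i by (intro that[of "C * i + 1" "c / 2"]) (auto intro: add_nonneg_pos)
qed

lemma coord_law_interval:
  assumes g: "coordinate_density p g" and p: "p > 0"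
  obtains a d where "a > 0" "d > 0"
    "\<And>u \<delta>. 0 < \<delta> \<Longrightarrow> \<delta> \<le> 1 \<Longrightarrow> ennreal (a * \<delta> * exp (- d * \<bar>u\<bar> powr p)) \<le> emeasure (coord_law g) {u - \<delta>..u + \<delta>}"
proof -
  obtain a d where a: "a > 0" "d > 0" "\<And>y u. \<bar>y\<bar> \<le> 1 \<Longrightarrow> g (y + u) \<ge> a * exp (- d * (\<bar>y\<bar> powr p + \<bar>u\<bar> powr p))"
    using g unfolding coordinate_density_def by (metis zero_less_one)
  note [measurable] = coordinate_density_measurable[OF g]
  have "ennreal ((2 * a * exp (- d)) * \<delta> * exp (- d * \<bar>u\<bar> powr p)) \<le> emeasure (coord_law g) {u - \<delta>..u + \<delta>}"
    if \<delta>: "0 < \<delta>" "\<delta> \<le> 1" for u \<delta>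
  proof -
    have "ennreal (a * exp (- d) * exp (- d * \<bar>u\<bar> powr p)) * emeasure lborel {u - \<delta>..u + \<delta>}
       = (\<integral>\<^sup>+x. ennreal (a * exp (- d) * exp (- d * \<bar>u\<bar> powr p)) * indicator {u - \<delta>..u + \<delta>} x \<partial>lborel)"
      by (subst nn_integral_cmult_indicator) auto
    also have "\<dots> \<le> (\<integral>\<^sup>+x. ennreal (g x) * indicator {u - \<delta>..u + \<delta>} x \<partial>lborel)"
    proof (rule nn_integral_mono)
      fix x
      have "a * exp (- d) * exp (- d * \<bar>u\<bar> powr p) \<le> g x" if x: "x \<in> {u - \<delta>..u + \<delta>}"
      proof -
        have y: "\<bar>x - u\<bar> \<le> 1" using x \<delta> by auto
        then have "\<bar>x - u\<bar> powr p \<le> 1 powr p" using p by (intro powr_mono2) auto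
        then have "d * \<bar>x - u\<bar> powr p \<le> d * 1" using a by (intro mult_left_mono) auto
        then have "- d + - d * \<bar>u\<bar> powr p \<le> - d * (\<bar>x - u\<bar> powr p + \<bar>u\<bar> powr p)"
          by (simp add: algebra_simps)
        then have "exp (- d) * exp (- d * \<bar>u\<bar> powr p) \<le> exp (- d * (\<bar>x - u\<bar> powr p + \<bar>u\<bar> powr p))"
          unfolding exp_add[symmetric] by simp
        then have "a * (exp (- d) * exp (- d * \<bar>u\<bar> powr p)) \<le> a * exp (- d * (\<bar>x - u\<bar> powr p + \<bar>u\<bar> powr p))"
          using a by (intro mult_left_mono) auto
        then show ?thesis using a(3)[OF y, of u] by (simp add: mult.assoc)
      qed
      then show "ennreal (a * exp (- d) * exp (- d * \<bar>u\<bar> powr p)) * indicator {u - \<delta>..u + \<delta>} x \<le> ennreal (g x) * indicator {u - \<delta>..u + \<delta>} x"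
        by (auto simp: indicator_def intro: ennreal_leI)
    qed
    also have "\<dots> = emeasure (coord_law g) {u - \<delta>..u + \<delta>}" by (rule emeasure_density[symmetric]) auto
    finally show ?thesis using \<delta> a by (simp add: ennreal_mult[symmetric] mult_ac)
  qed
  then show ?thesis using a by (intro that[of "2 * a * exp (- d)" d]) auto
qed

abbreviation seq_space :: "(nat \<Rightarrow> real) measure" where
  "seq_space \<equiv> \<Pi>\<^sub>M l\<in>UNIV. borel"

lemma space_param_space[simp]: "space param_space = UNIV"
  by (auto simp: param_space_def space_pair_measure space_PiM)

lemma measurable_param_spaceI:
  "(\<And>k. (\<lambda>\<theta>. f (k, \<theta>)) \<in> measurable seq_space N) \<Longrightarrow> f \<in> measurable param_space N"
  unfolding param_space_def by (rule measurable_pair_measure_countable1) auto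

lemma sets_param_spaceI:
  assumes "\<And>k. {\<theta>. (k, \<theta>) \<in> A} \<in> sets seq_space"
  shows "A \<in> sets param_space"
proof -
  have "(\<lambda>t. t \<in> A) \<in> measurable param_space (count_space UNIV)"
  proof (rule measurable_param_spaceI)
    fix k
    show "(\<lambda>\<theta>. (k, \<theta>) \<in> A) \<in> measurable seq_space (count_space UNIV)"
      using assms[of k] by (simp add: pred_def space_PiM)
  qed
  then show ?thesis by (simp add: pred_def)
qed

lemma measurable_Pair_param[measurable]: "Pair k \<in> measurable seq_space param_space"
  unfolding param_space_def by (intro measurable_Pair1') simp

locale coefficient_prior =
  fixes g :: "real \<Rightarrow> real" and pstar \<tau>0 \<beta> :: real
  assumes g: "coordinate_density pstar g" and pstar: "pstar > 0"
    and tau0: "\<tau>0 > 0" and beta: "1/2 < \<beta>" "\<beta> < 1"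
begin

abbreviation scale :: "nat \<Rightarrow> real" where
  "scale l \<equiv> sqrt (\<tau>0 * real l powr (- 2 * \<beta>))"

lemma scale_eq: "scale l = sqrt \<tau>0 * real l powr (- \<beta>)"
proof -
  have "real l powr (- 2 * \<beta>) = (real l powr (- \<beta>))\<^sup>2"
    by (simp add: power2_eq_square powr_add[symmetric])
  then show ?thesis by (simp add: real_sqrt_mult)
qed

lemma scale_pos: "l \<ge> 1 \<Longrightarrow> scale l > 0"
  using tau0 by (simp add: scale_eq)

lemma scale_le: "scale l \<le> sqrt \<tau>0"
proof (cases "l = 0")
  case False
  then have "real l powr (- \<beta>) \<le> 1 powr (- \<beta>)" using beta by (intro powr_mono2') auto
  then show ?thesis using tau0 unfolding scale_eq by simp
qed (use tau0 in simp)

interpretation coord: prob_space "coord_law g" by (rule prob_space_coord_law[OF g])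

interpretation coords: product_prob_space "\<lambda>_::nat. coord_law g" ..

definition scaled_seq :: "nat \<Rightarrow> (nat \<Rightarrow> real) \<Rightarrow> nat \<Rightarrow> real" where
  "scaled_seq k y l = (if l \<in> {1..k} then scale l * y l else 0)"

lemma prior_given_k_eq:
  "prior_given_k g \<tau>0 \<beta> k = distr (\<Pi>\<^sub>M l\<in>{1..k}. coord_law g) seq_space (scaled_seq k)"
  unfolding prior_given_k_def scaled_seq_def by simp

lemma scaled_seq_measurable[measurable]:
  "scaled_seq k \<in> measurable (\<Pi>\<^sub>M l\<in>{1..k}. coord_law g) seq_space"
proof (rule measurable_PiM_single')
  show "(\<lambda>y. scaled_seq k y l) \<in> borel_measurable (\<Pi>\<^sub>M l\<in>{1..k}. coord_law g)" for l
  proof (cases "l \<in> {1..k}")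
    case True
    then have "(\<lambda>y. y l) \<in> borel_measurable (\<Pi>\<^sub>M l\<in>{1..k}. coord_law g)"
      using measurable_component_singleton[OF True, of "\<lambda>_. coord_law g"] by simp
    then show ?thesis using True unfolding scaled_seq_def by (simp only: if_True) (rule borel_measurable_times; simp)
  next
    case False
    then have "(\<lambda>y. scaled_seq k y l) = (\<lambda>y. 0)" unfolding scaled_seq_def by (simp only: if_False)
    then show ?thesis by simp
  qed
qed (simp add: space_PiM)

lemma prob_space_prior_given_k: "prob_space (prior_given_k g \<tau>0 \<beta> k)"
  unfolding prior_given_k_eq
  by (intro prob_space.prob_space_distr scaled_seq_measurable) (rule prob_space_PiM, rule prob_space_coord_law[OF g])

lemma sets_prior_given_k[simp, measurable_cong]: "sets (prior_given_k g \<tau>0 \<beta> k) = sets seq_space"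
  by (simp add: prior_given_k_def)

lemma prior_kernel:
  "(\<lambda>k. distr (prior_given_k g \<tau>0 \<beta> k) param_space (Pair k)) \<in> measurable (measure_pmf pk) (subprob_algebra param_space)"
proof -
  have "prob_space (distr (prior_given_k g \<tau>0 \<beta> k) param_space (Pair k))" for k
    by (intro prob_space.prob_space_distr prob_space_prior_given_k) measurable
  then show ?thesis
    by (simp add: space_subprob_algebra prob_space_imp_subprob_space)
qed

lemma sets_prior[simp, measurable_cong]: "sets (prior pk g \<tau>0 \<beta>) = sets param_space"
  unfolding prior_def by (intro sets_bind) auto

lemma space_prior[simp]: "space (prior pk g \<tau>0 \<beta>) = UNIV"
  using sets_eq_imp_space_eq[OF sets_prior] by simp

lemma prob_space_prior: "prob_space (prior pk g \<tau>0 \<beta>)"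
  unfolding prior_def
proof (rule measure_pmf.prob_space_bind[OF _ prior_kernel])
  show "AE k in measure_pmf pk. prob_space (distr (prior_given_k g \<tau>0 \<beta> k) param_space (Pair k))"
    by (intro AE_I2 prob_space.prob_space_distr prob_space_prior_given_k) measurable
qed

lemma emeasure_prior:
  assumes "A \<in> sets param_space"
  shows "emeasure (prior pk g \<tau>0 \<beta>) A = (\<integral>\<^sup>+k. emeasure (prior_given_k g \<tau>0 \<beta> k) {\<theta>. (k, \<theta>) \<in> A} \<partial>measure_pmf pk)"
proof -
  have "emeasure (prior pk g \<tau>0 \<beta>) A = (\<integral>\<^sup>+k. emeasure (distr (prior_given_k g \<tau>0 \<beta> k) param_space (Pair k)) A \<partial>measure_pmf pk)"
    unfolding prior_def by (rule emeasure_bind[OF _ prior_kernel assms]) simp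
  also have "\<dots> = (\<integral>\<^sup>+k. emeasure (prior_given_k g \<tau>0 \<beta> k) {\<theta>. (k, \<theta>) \<in> A} \<partial>measure_pmf pk)"
  proof (rule nn_integral_cong)
    fix k
    have "Pair k \<in> measurable (prior_given_k g \<tau>0 \<beta> k) param_space" by measurable
    then show "emeasure (distr (prior_given_k g \<tau>0 \<beta> k) param_space (Pair k)) A = emeasure (prior_given_k g \<tau>0 \<beta> k) {\<theta>. (k, \<theta>) \<in> A}"
      using assms sets_eq_imp_space_eq[OF sets_prior_given_k, of k]
      by (subst emeasure_distr) (auto simp: vimage_def space_PiM)
  qed
  finally show ?thesis .
qed

lemma emeasure_prior_box:
  assumes "\<And>l. A l \<in> sets borel"
  shows "emeasure (prior_given_k g \<tau>0 \<beta> k) {\<theta>. \<forall>l\<in>{1..k}. \<theta> l \<in> A l} =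
    (\<Prod>l=1..k. emeasure (coord_law g) {y. scale l * y \<in> A l})"
proof -
  have [measurable]: "A l \<in> sets borel" for l by (rule assms)
  have m: "{y. scale l * y \<in> A l} \<in> sets borel" for l
    using measurable_sets[of "\<lambda>y. scale l * y" borel borel "A l"] by (simp add: vimage_def)
  have "{\<theta>. \<forall>l\<in>{1..k}. \<theta> l \<in> A l} \<in> sets seq_space"
  proof -
    have "{\<theta> \<in> space seq_space. \<forall>l\<in>{1..k}. \<theta> l \<in> A l} \<in> sets seq_space" by measurable
    then show ?thesis by (simp add: space_PiM)
  qed
  then have "emeasure (prior_given_k g \<tau>0 \<beta> k) {\<theta>. \<forall>l\<in>{1..k}. \<theta> l \<in> A l} =
    emeasure (\<Pi>\<^sub>M l\<in>{1..k}. coord_law g) (scaled_seq k -` {\<theta>. \<forall>l\<in>{1..k}. \<theta> l \<in> A l} \<inter> space (\<Pi>\<^sub>M l\<in>{1..k}. coord_law g))"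
    unfolding prior_given_k_eq by (rule emeasure_distr[OF scaled_seq_measurable])
  also have "scaled_seq k -` {\<theta>. \<forall>l\<in>{1..k}. \<theta> l \<in> A l} \<inter> space (\<Pi>\<^sub>M l\<in>{1..k}. coord_law g) =
     (\<Pi>\<^sub>E l\<in>{1..k}. {y. scale l * y \<in> A l})"
    by (auto simp: space_PiM scaled_seq_def PiE_def)
  also have "emeasure (\<Pi>\<^sub>M l\<in>{1..k}. coord_law g) \<dots> = (\<Prod>l=1..k. emeasure (coord_law g) {y. scale l * y \<in> A l})"
    using m by (intro coords.emeasure_PiM) auto
  finally show ?thesis .
qed

lemma emeasure_prior_coordinate:
  assumes l: "l \<in> {1..k}" and A: "A \<in> sets borel"
  shows "emeasure (prior_given_k g \<tau>0 \<beta> k) {\<theta>. \<theta> l \<in> A} = emeasure (coord_law g) {y. scale l * y \<in> A}"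
proof -
  have "{\<theta>. \<forall>m\<in>{1..k}. \<theta> m \<in> (if m = l then A else UNIV)} = {\<theta>. \<theta> l \<in> A}" using l by auto
  then have "emeasure (prior_given_k g \<tau>0 \<beta> k) {\<theta>. \<theta> l \<in> A} =
     (\<Prod>m=1..k. emeasure (coord_law g) {y. scale m * y \<in> (if m = l then A else UNIV)})"
    using emeasure_prior_box[of "\<lambda>m. if m = l then A else UNIV" k] A by simp
  also have "\<dots> = (\<Prod>m=1..k. if m = l then emeasure (coord_law g) {y. scale l * y \<in> A} else 1)"
    using coord.emeasure_space_1 by (intro prod.cong) auto
  finally show ?thesis using l by simp
qed

lemma AE_prior_given_k_support: "emeasure (prior_given_k g \<tau>0 \<beta> k) {\<theta>. \<exists>l. l \<notin> {1..k} \<and> \<theta> l \<noteq> 0} = 0"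
proof -
  have "{\<theta>. \<exists>l. l \<notin> {1..k} \<and> \<theta> l \<noteq> 0} \<in> sets seq_space"
  proof -
    have "{\<theta> \<in> space seq_space. \<exists>l. l \<notin> {1..k} \<and> \<theta> l \<noteq> 0} \<in> sets seq_space" by measurable
    then show ?thesis by (simp add: space_PiM)
  qed
  then have "emeasure (prior_given_k g \<tau>0 \<beta> k) {\<theta>. \<exists>l. l \<notin> {1..k} \<and> \<theta> l \<noteq> 0} =
    emeasure (\<Pi>\<^sub>M l\<in>{1..k}. coord_law g) (scaled_seq k -` {\<theta>. \<exists>l. l \<notin> {1..k} \<and> \<theta> l \<noteq> 0} \<inter> space (\<Pi>\<^sub>M l\<in>{1..k}. coord_law g))"
    unfolding prior_given_k_eq by (rule emeasure_distr[OF scaled_seq_measurable])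
  also have "scaled_seq k -` {\<theta>. \<exists>l. l \<notin> {1..k} \<and> \<theta> l \<noteq> 0} \<inter> space (\<Pi>\<^sub>M l\<in>{1..k}. coord_law g) = {}"
    by (auto simp: scaled_seq_def)
  finally show ?thesis by simp
qed

text \<open>Parameters are arbitrary sequences, of which a density of dimension \<open>k\<close> depends on the first \<open>k\<close>
  entries only, whereas the \<open>l2\<close> distance depends on all of them. Sequences with further nonzero entries,
  which are a null set of the prior, are therefore excluded from the sieve explicitly.\<close>

definition outside_sieve :: "nat \<Rightarrow> real \<Rightarrow> (nat \<times> (nat \<Rightarrow> real)) set" where
  "outside_sieve K R = {(k, \<theta>). k > K \<or> (\<exists>l\<in>{1..k}. \<bar>\<theta> l\<bar> > R) \<or> (\<exists>l. l \<notin> {1..k} \<and> \<theta> l \<noteq> 0)}"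

lemma outside_sieve_sets[measurable]: "outside_sieve K R \<in> sets param_space"
proof (rule sets_param_spaceI)
  fix k
  have "{\<theta> \<in> space seq_space. k > K \<or> (\<exists>l\<in>{1..k}. \<bar>\<theta> l\<bar> > R) \<or> (\<exists>l. l \<notin> {1..k} \<and> \<theta> l \<noteq> 0)} \<in> sets seq_space"
    by measurable
  then show "{\<theta>. (k, \<theta>) \<in> outside_sieve K R} \<in> sets seq_space"
    by (simp add: space_PiM outside_sieve_def)
qed

text \<open>A union bound over at most \<open>K\<close> coordinates. All prior scales are at most \<open>sqrt \<tau>0\<close>, so one tail bound
serves every coordinate.\<close>

lemma outside_sieve_prior:
  obtains D c where "D > 0" "c > 0"
    "\<And>pk K R. R \<ge> 0 \<Longrightarrow> emeasure (prior pk g \<tau>0 \<beta>) (outside_sieve K R) \<le>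
      ennreal (measure_pmf.prob pk {k. k > K} + real K * D * exp (- c * R powr pstar))"
proof -
  obtain D c where Dc: "D > 0" "c > 0"
    and tail: "\<And>R. R \<ge> 0 \<Longrightarrow> emeasure (coord_law g) {y. \<bar>y\<bar> > R} \<le> ennreal (D * exp (- c * R powr pstar))"
    using coord_law_tail[OF g pstar] by metis
  define c' where "c' = c / sqrt \<tau>0 powr pstar"
  have le: "emeasure (prior pk g \<tau>0 \<beta>) (outside_sieve K R) \<le>
      ennreal (measure_pmf.prob pk {k. k > K} + real K * D * exp (- c' * R powr pstar))" if R: "R \<ge> 0" for pk K R
  proof -
    let ?e = "exp (- c' * R powr pstar)"
    have big: "emeasure (prior_given_k g \<tau>0 \<beta> k) {\<theta>. \<bar>\<theta> l\<bar> > R} \<le> ennreal (D * ?e)" if l: "l \<in> {1..k}" for k l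
    proof -
      have "emeasure (prior_given_k g \<tau>0 \<beta> k) {\<theta>. \<theta> l \<in> {x. \<bar>x\<bar> > R}} = emeasure (coord_law g) {y. scale l * y \<in> {x. \<bar>x\<bar> > R}}"
        by (rule emeasure_prior_coordinate[OF l]) measurable
      also have "\<dots> \<le> emeasure (coord_law g) {y. \<bar>y\<bar> > R / sqrt \<tau>0}"
      proof (rule emeasure_mono)
        show "{y. scale l * y \<in> {x. \<bar>x\<bar> > R}} \<subseteq> {y. \<bar>y\<bar> > R / sqrt \<tau>0}"
        proof clarify
          fix y assume "R < \<bar>scale l * y\<bar>"
          also have "\<dots> = scale l * \<bar>y\<bar>" using scale_pos[of l] l by (simp add: abs_mult)
          also have "\<dots> \<le> sqrt \<tau>0 * \<bar>y\<bar>" by (intro mult_right_mono scale_le) simp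
          finally show "R / sqrt \<tau>0 < \<bar>y\<bar>" using tau0 by (simp add: field_simps)
        qed
      qed simp
      also have "\<dots> \<le> ennreal (D * exp (- c * (R / sqrt \<tau>0) powr pstar))"
        using R tau0 by (intro tail) simp
      also have "- c * (R / sqrt \<tau>0) powr pstar = - c' * R powr pstar"
        using R tau0 by (simp add: c'_def powr_divide)
      finally show ?thesis by simp
    qed
    have "emeasure (prior_given_k g \<tau>0 \<beta> k) {\<theta>. (k, \<theta>) \<in> outside_sieve K R} \<le> indicator {k. k > K} k + ennreal (real K * D * ?e)" for k
    proof (cases "k > K")
      case True
      have "emeasure (prior_given_k g \<tau>0 \<beta> k) {\<theta>. (k, \<theta>) \<in> outside_sieve K R} \<le> 1"
        by (rule prob_space.emeasure_le_1[OF prob_space_prior_given_k])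
      then show ?thesis using True by (simp add: add_increasing2)
    next
      case False
      have m1: "{\<theta>. \<bar>\<theta> l\<bar> > R} \<in> sets seq_space" for l
      proof -
        have "{\<theta> \<in> space seq_space. \<bar>\<theta> l\<bar> > R} \<in> sets seq_space" by measurable
        then show ?thesis by (simp add: space_PiM)
      qed
      have m2: "{\<theta>. \<exists>l. l \<notin> {1..k} \<and> \<theta> l \<noteq> 0} \<in> sets seq_space"
      proof -
        have "{\<theta> \<in> space seq_space. \<exists>l. l \<notin> {1..k} \<and> \<theta> l \<noteq> 0} \<in> sets seq_space" by measurable
        then show ?thesis by (simp add: space_PiM)
      qed
      have "emeasure (prior_given_k g \<tau>0 \<beta> k) {\<theta>. (k, \<theta>) \<in> outside_sieve K R} \<le>
          emeasure (prior_given_k g \<tau>0 \<beta> k) ((\<Union>l\<in>{1..k}. {\<theta>. \<bar>\<theta> l\<bar> > R}) \<union> {\<theta>. \<exists>l. l \<notin> {1..k} \<and> \<theta> l \<noteq> 0})"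
        using False m1 m2 by (intro emeasure_mono) (auto simp: outside_sieve_def)
      also have "\<dots> \<le> emeasure (prior_given_k g \<tau>0 \<beta> k) (\<Union>l\<in>{1..k}. {\<theta>. \<bar>\<theta> l\<bar> > R}) + emeasure (prior_given_k g \<tau>0 \<beta> k) {\<theta>. \<exists>l. l \<notin> {1..k} \<and> \<theta> l \<noteq> 0}"
        using m1 m2 by (intro emeasure_subadditive) auto
      also have "\<dots> = emeasure (prior_given_k g \<tau>0 \<beta> k) (\<Union>l\<in>{1..k}. {\<theta>. \<bar>\<theta> l\<bar> > R})"
        unfolding AE_prior_given_k_support by simp
      also have "\<dots> \<le> (\<Sum>l\<in>{1..k}. emeasure (prior_given_k g \<tau>0 \<beta> k) {\<theta>. \<bar>\<theta> l\<bar> > R})"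
        using m1 by (intro emeasure_subadditive_finite) auto
      also have "\<dots> \<le> (\<Sum>l\<in>{1..k}. ennreal (D * ?e))" by (intro sum_mono big)
      also have "\<dots> = ennreal (real k * (D * ?e))"
        using Dc by (simp add: ennreal_mult ennreal_of_nat_eq_real_of_nat)
      also have "\<dots> \<le> ennreal (real K * D * ?e)"
        using False Dc unfolding mult.assoc by (intro ennreal_leI mult_right_mono) auto
      finally show ?thesis using False by simp
    qed
    then have "emeasure (prior pk g \<tau>0 \<beta>) (outside_sieve K R) \<le> (\<integral>\<^sup>+k. indicator {k. k > K} k + ennreal (real K * D * ?e) \<partial>measure_pmf pk)"
      unfolding emeasure_prior[OF outside_sieve_sets] by (intro nn_integral_mono)
    also have "\<dots> = emeasure (measure_pmf pk) {k. k > K} + ennreal (real K * D * ?e)"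
      using measure_pmf.emeasure_space_1[of pk] by (subst nn_integral_add) auto
    also have "\<dots> = ennreal (measure_pmf.prob pk {k. k > K} + real K * D * ?e)"
      using Dc by (simp add: measure_pmf.emeasure_eq_measure ennreal_plus)
    finally show ?thesis .
  qed
  show ?thesis using Dc tau0 le by (intro that[of D c']) (auto simp: c'_def)
qed

text \<open>Each coordinate costs the width of its interval and the penalty of its centre. The penalties add up to
a multiple of \<open>k\<close>, and widths that are a power of \<open>1 / n\<close> cost \<open>exp (- C * k * ln n)\<close>, so the box may be
as small as convenience suggests.\<close>

lemma emeasure_prior_near:
  fixes \<theta>0 :: "nat \<Rightarrow> real"
  defines "N \<equiv> \<lambda>k \<eta>. {(k', \<theta>). k' = k \<and> (\<forall>l\<in>{1..k}. \<bar>\<theta> l - \<theta>0 l\<bar> \<le> \<eta>)}"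
  assumes D: "\<And>k. k \<ge> 1 \<Longrightarrow> (\<Sum>l=1..k. \<bar>real l powr \<beta> * \<theta>0 l\<bar> powr pstar) \<le> D * real k"
  obtains a d where "a > 0" "d > 0" "\<And>k \<eta>. N k \<eta> \<in> sets param_space"
    "\<And>pk k \<eta>. k \<ge> 1 \<Longrightarrow> 0 < \<eta> \<Longrightarrow> \<eta> \<le> sqrt \<tau>0 \<Longrightarrow>
      ennreal (pmf pk k * ((a * \<eta>) ^ k * exp (- d * real k))) \<le> emeasure (prior pk g \<tau>0 \<beta>) (N k \<eta>)"
proof -
  obtain a d where ad: "a > 0" "d > 0"
    and near: "\<And>u \<delta>. 0 < \<delta> \<Longrightarrow> \<delta> \<le> 1 \<Longrightarrow> ennreal (a * \<delta> * exp (- d * \<bar>u\<bar> powr pstar)) \<le> emeasure (coord_law g) {u - \<delta>..u + \<delta>}"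
    using coord_law_interval[OF g pstar] by metis
  define a' where "a' = a / sqrt \<tau>0"
  define d1 where "d1 = d / sqrt \<tau>0 powr pstar"
  have a': "a' > 0" and d1: "d1 > 0" using ad tau0 by (auto simp: a'_def d1_def)
  have D0: "D \<ge> 0" using order_trans[OF sum_nonneg D[of 1]] by simp
  have sets_box: "{\<theta>. \<forall>l\<in>{1..k}. \<bar>\<theta> l - \<theta>0 l\<bar> \<le> \<eta>} \<in> sets seq_space" for k \<eta>
  proof -
    have "{\<theta> \<in> space seq_space. \<forall>l\<in>{1..k}. \<bar>\<theta> l - \<theta>0 l\<bar> \<le> \<eta>} \<in> sets seq_space" by measurable
    then show ?thesis by (simp add: space_PiM)
  qed
  have sets_N: "N k \<eta> \<in> sets param_space" for k \<eta>
  proof (rule sets_param_spaceI)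
    fix k'
    show "{\<theta>. (k', \<theta>) \<in> N k \<eta>} \<in> sets seq_space"
      using sets_box[of k \<eta>] by (cases "k' = k") (simp_all add: N_def)
  qed
  have "ennreal (pmf pk k * ((a' * \<eta>) ^ k * exp (- (d1 * D + 1) * real k))) \<le> emeasure (prior pk g \<tau>0 \<beta>) (N k \<eta>)"
    if k: "k \<ge> 1" and \<eta>: "0 < \<eta>" "\<eta> \<le> sqrt \<tau>0" for pk k \<eta>
  proof -
    let ?P = "prior_given_k g \<tau>0 \<beta> k"
    have coord: "ennreal (a' * \<eta> * exp (- d1 * \<bar>real l powr \<beta> * \<theta>0 l\<bar> powr pstar)) \<le>
        emeasure (coord_law g) {y. scale l * y \<in> {x. \<bar>x - \<theta>0 l\<bar> \<le> \<eta>}}" if l: "l \<in> {1..k}" for l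
    proof -
      define u where "u = \<theta>0 l / scale l"
      have t: "scale l > 0" using l by (intro scale_pos) simp
      have "u = real l powr \<beta> * \<theta>0 l / sqrt \<tau>0"
        unfolding u_def scale_eq by (simp add: powr_minus field_simps)
      then have "\<bar>u\<bar> powr pstar = \<bar>real l powr \<beta> * \<theta>0 l\<bar> powr pstar / sqrt \<tau>0 powr pstar"
        using tau0 by (simp add: abs_divide powr_divide)
      then have "a' * \<eta> * exp (- d1 * \<bar>real l powr \<beta> * \<theta>0 l\<bar> powr pstar) = a * (\<eta> / sqrt \<tau>0) * exp (- d * \<bar>u\<bar> powr pstar)"
        by (simp add: a'_def d1_def)
      also have "ennreal \<dots> \<le> emeasure (coord_law g) {u - \<eta> / sqrt \<tau>0..u + \<eta> / sqrt \<tau>0}"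
        using \<eta> tau0 by (intro near) (auto simp: field_simps)
      also have "\<dots> \<le> emeasure (coord_law g) {y. scale l * y \<in> {x. \<bar>x - \<theta>0 l\<bar> \<le> \<eta>}}"
      proof (rule emeasure_mono)
        show "{u - \<eta> / sqrt \<tau>0..u + \<eta> / sqrt \<tau>0} \<subseteq> {y. scale l * y \<in> {x. \<bar>x - \<theta>0 l\<bar> \<le> \<eta>}}"
        proof clarify
          fix y assume "y \<in> {u - \<eta> / sqrt \<tau>0..u + \<eta> / sqrt \<tau>0}"
          then have y: "\<bar>y - u\<bar> \<le> \<eta> / sqrt \<tau>0" by auto
          have "scale l * y - \<theta>0 l = scale l * (y - u)" using t l tau0 by (simp add: u_def right_diff_distrib)
          then have "\<bar>scale l * y - \<theta>0 l\<bar> = scale l * \<bar>y - u\<bar>" using t by (simp only: abs_mult abs_of_pos)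
          also have "\<dots> \<le> sqrt \<tau>0 * (\<eta> / sqrt \<tau>0)" using y scale_le[of l] t by (intro mult_mono) auto
          finally show "\<bar>scale l * y - \<theta>0 l\<bar> \<le> \<eta>" using tau0 by simp
        qed
        show "{y. scale l * y \<in> {x. \<bar>x - \<theta>0 l\<bar> \<le> \<eta>}} \<in> sets (coord_law g)" by simp
      qed
      finally show ?thesis .
    qed
    have "(a' * \<eta>) ^ k * exp (- (d1 * D + 1) * real k) \<le> (a' * \<eta>) ^ k * exp (\<Sum>l=1..k. - d1 * \<bar>real l powr \<beta> * \<theta>0 l\<bar> powr pstar)"
    proof -
      have "d1 * (\<Sum>l=1..k. \<bar>real l powr \<beta> * \<theta>0 l\<bar> powr pstar) \<le> d1 * (D * real k)"
        using D[OF k] d1 by (intro mult_left_mono) auto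
      also have "\<dots> \<le> (d1 * D + 1) * real k" by (simp add: algebra_simps)
      finally have "- (d1 * D + 1) * real k \<le> (\<Sum>l=1..k. - d1 * \<bar>real l powr \<beta> * \<theta>0 l\<bar> powr pstar)"
        by (simp add: sum_distrib_left sum_negf algebra_simps)
      then show ?thesis using a' \<eta> by (intro mult_left_mono) auto
    qed
    also have "\<dots> = (\<Prod>l=1..k. a' * \<eta> * exp (- d1 * \<bar>real l powr \<beta> * \<theta>0 l\<bar> powr pstar))"
      by (simp add: prod.distrib exp_sum)
    finally have "ennreal ((a' * \<eta>) ^ k * exp (- (d1 * D + 1) * real k)) \<le> ennreal \<dots>" by (rule ennreal_leI)
    also have "\<dots> = (\<Prod>l=1..k. ennreal (a' * \<eta> * exp (- d1 * \<bar>real l powr \<beta> * \<theta>0 l\<bar> powr pstar)))"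
      using a' \<eta> by (intro prod_ennreal[symmetric]) auto
    also have "\<dots> \<le> (\<Prod>l=1..k. emeasure (coord_law g) {y. scale l * y \<in> {x. \<bar>x - \<theta>0 l\<bar> \<le> \<eta>}})"
      using coord by (intro prod_mono_ennreal)
    also have "\<dots> = emeasure ?P {\<theta>. \<forall>l\<in>{1..k}. \<theta> l \<in> {x. \<bar>x - \<theta>0 l\<bar> \<le> \<eta>}}"
      by (intro emeasure_prior_box[symmetric]) measurable
    finally have box: "ennreal ((a' * \<eta>) ^ k * exp (- (d1 * D + 1) * real k)) \<le> emeasure ?P {\<theta>. \<forall>l\<in>{1..k}. \<bar>\<theta> l - \<theta>0 l\<bar> \<le> \<eta>}"
      by simp
    have "ennreal (pmf pk k * ((a' * \<eta>) ^ k * exp (- (d1 * D + 1) * real k))) =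
        ennreal (pmf pk k) * ennreal ((a' * \<eta>) ^ k * exp (- (d1 * D + 1) * real k))"
      using a' \<eta> by (intro ennreal_mult) auto
    also have "\<dots> \<le> ennreal (pmf pk k) * emeasure ?P {\<theta>. (k, \<theta>) \<in> N k \<eta>}"
      using box unfolding N_def by (intro mult_left_mono) auto
    also have "\<dots> = (\<integral>\<^sup>+k'. emeasure ?P {\<theta>. (k, \<theta>) \<in> N k \<eta>} * indicator {k} k' \<partial>measure_pmf pk)"
      by (subst nn_integral_cmult_indicator) (auto simp: emeasure_pmf_single mult.commute)
    also have "\<dots> \<le> (\<integral>\<^sup>+k'. emeasure (prior_given_k g \<tau>0 \<beta> k') {\<theta>. (k', \<theta>) \<in> N k \<eta>} \<partial>measure_pmf pk)"
      by (intro nn_integral_mono) (auto simp: indicator_def)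
    also have "\<dots> = emeasure (prior pk g \<tau>0 \<beta>) (N k \<eta>)"
      by (rule emeasure_prior[symmetric]) (rule sets_N)
    finally show ?thesis .
  qed
  then show ?thesis using a' d1 D0 sets_N by (intro that[of a' "d1 * D + 1"]) (auto intro: add_nonneg_pos)
qed

end

section \<open>A nonasymptotic bound for the posterior\<close>

text \<open>The cells are those of the grid of width \<open>\<eta>\<close>, recorded by rounding and padded with zeros to the common
length \<open>K\<close> for counting. One representative is chosen in \<open>A\<close> for every cell that meets \<open>A\<close>; it shares
whatever property defines \<open>A\<close>, such as a large distance from \<open>f0\<close>.\<close>

lemma finite_net:
  fixes A :: "(nat \<times> (nat \<Rightarrow> real)) set"
  assumes A: "\<And>k \<theta>. (k, \<theta>) \<in> A \<Longrightarrow> k \<le> K \<and> (\<forall>l\<in>{1..k}. \<bar>\<theta> l\<bar> \<le> R)" and \<eta>: "\<eta> > 0" and R: "R \<ge> 0"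
  obtains F where "finite F" "F \<subseteq> A" "real (card F) \<le> (real K + 1) * (2 * R / \<eta> + 2) ^ K"
    "\<And>k \<theta>. (k, \<theta>) \<in> A \<Longrightarrow> \<exists>\<theta>'. (k, \<theta>') \<in> F \<and> (\<forall>l\<in>{1..k}. \<bar>\<theta> l - \<theta>' l\<bar> \<le> \<eta>)"
proof -
  define m :: "nat \<times> (nat \<Rightarrow> real) \<Rightarrow> nat \<times> (nat \<Rightarrow> int)" where
    "m = (\<lambda>(k, \<theta>). (k, \<lambda>l\<in>{1..K}. if l \<le> k then \<lfloor>\<theta> l / \<eta>\<rfloor> else 0))"
  define J where "J = {\<lfloor>- R / \<eta>\<rfloor>..\<lfloor>R / \<eta>\<rfloor>}"
  have sub: "m ` A \<subseteq> {..K} \<times> (\<Pi>\<^sub>E l\<in>{1..K}. J)"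
  proof (rule image_subsetI)
    fix s assume "s \<in> A"
    moreover obtain k \<theta> where s: "s = (k, \<theta>)" by (cases s)
    ultimately have t: "(k, \<theta>) \<in> A" by simp
    have "\<lfloor>\<theta> l / \<eta>\<rfloor> \<in> J" if "l \<in> {1..k}" for l
    proof -
      have "- R \<le> \<theta> l" "\<theta> l \<le> R" using A[OF t] that by (force simp: abs_le_iff)+
      then have "- R / \<eta> \<le> \<theta> l / \<eta>" "\<theta> l / \<eta> \<le> R / \<eta>" using \<eta> by (intro divide_right_mono; simp)+
      then show ?thesis unfolding J_def atLeastAtMost_iff by (intro conjI floor_mono)
    qed
    moreover have "0 \<in> J"
    proof -
      have "0 \<le> R / \<eta>" using R \<eta> by simp
      then have "0 \<le> \<lfloor>R / \<eta>\<rfloor>" "\<lfloor>- R / \<eta>\<rfloor> \<le> 0" by (simp_all add: floor_le_iff)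
      then show "0 \<in> J" by (simp add: J_def)
    qed
    ultimately show "m s \<in> {..K} \<times> (\<Pi>\<^sub>E l\<in>{1..K}. J)"
      using A[OF t] unfolding s by (auto simp: m_def)
  qed
  have fin: "finite ({..K} \<times> (\<Pi>\<^sub>E l\<in>{1..K}. J))" by (intro finite_cartesian_product finite_PiE) (auto simp: J_def)
  define F where "F = (\<lambda>z. SOME p. p \<in> A \<and> m p = z) ` (m ` A)"
  have some: "(SOME p. p \<in> A \<and> m p = m q) \<in> A \<and> m (SOME p. p \<in> A \<and> m p = m q) = m q" if "q \<in> A" for q
    using that by (intro someI[of "\<lambda>p. p \<in> A \<and> m p = m q" q]) auto
  show ?thesis
  proof (rule that[of F])
    show "finite F" using finite_subset[OF sub fin] by (simp add: F_def)
    show "F \<subseteq> A" using some by (auto simp: F_def)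
    have "card F \<le> card (m ` A)" unfolding F_def by (intro card_image_le finite_subset[OF sub fin])
    also have "\<dots> \<le> card ({..K} \<times> (\<Pi>\<^sub>E l\<in>{1..K}. J))" by (rule card_mono[OF fin sub])
    also have "\<dots> = (K + 1) * card J ^ K" by (simp add: card_cartesian_product card_PiE)
    finally have "real (card F) \<le> real ((K + 1) * card J ^ K)" by (rule of_nat_mono)
    also have "\<dots> = (real K + 1) * real (card J) ^ K" by (simp add: algebra_simps)
    also have "\<dots> \<le> (real K + 1) * (2 * R / \<eta> + 2) ^ K"
    proof (intro mult_left_mono power_mono)
      have "- R / \<eta> \<le> R / \<eta>" using R \<eta> by (simp add: divide_right_mono)
      then have "\<lfloor>- R / \<eta>\<rfloor> \<le> \<lfloor>R / \<eta>\<rfloor>" by (rule floor_mono)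
      then have "real (card J) = of_int \<lfloor>R / \<eta>\<rfloor> - of_int \<lfloor>- R / \<eta>\<rfloor> + 1" by (simp add: J_def)
      moreover have "of_int \<lfloor>R / \<eta>\<rfloor> \<le> R / \<eta>" "of_int \<lfloor>- R / \<eta>\<rfloor> > - R / \<eta> - 1" by linarith+
      moreover have "2 * R / \<eta> = R / \<eta> + R / \<eta>" "- R / \<eta> = - (R / \<eta>)" by simp_all
      ultimately show "real (card J) \<le> 2 * R / \<eta> + 2" by linarith
    qed simp_all
    finally show "real (card F) \<le> (real K + 1) * (2 * R / \<eta> + 2) ^ K" .
    fix k \<theta> assume t: "(k, \<theta>) \<in> A"
    define p where "p = (SOME p. p \<in> A \<and> m p = m (k, \<theta>))"
    have p: "p \<in> F" "m p = m (k, \<theta>)" using some[OF t] t by (auto simp: F_def p_def)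
    obtain k' \<theta>' where p': "p = (k', \<theta>')" by (cases p)
    have "k' = k" using p(2) by (simp add: p' m_def)
    have "\<bar>\<theta> l - \<theta>' l\<bar> \<le> \<eta>" if l: "l \<in> {1..k}" for l
    proof -
      have lK: "l \<in> {1..K}" "l \<le> k" using A[OF t] l by auto
      have "snd (m p) l = snd (m (k, \<theta>)) l" using p(2) by simp
      then have "\<lfloor>\<theta>' l / \<eta>\<rfloor> = \<lfloor>\<theta> l / \<eta>\<rfloor>" using lK \<open>k' = k\<close> by (simp add: p' m_def)
      then have "\<bar>\<theta> l / \<eta> - \<theta>' l / \<eta>\<bar> \<le> 1" by linarith
      then have "\<bar>\<theta> l - \<theta>' l\<bar> / \<eta> \<le> 1" using \<eta> by (simp flip: diff_divide_distrib)
      then show ?thesis using \<eta> by (simp add: divide_le_eq)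
    qed
    then show "\<exists>\<theta>'. (k, \<theta>') \<in> F \<and> (\<forall>l\<in>{1..k}. \<bar>\<theta> l - \<theta>' l\<bar> \<le> \<eta>)"
      using p(1) p' \<open>k' = k\<close> by auto
  qed
qed

locale iid_sample = log_density_expansion \<phi> B f0 \<theta>0 \<gamma> C b + coefficient_prior g pstar \<tau>0 \<beta> + M: prob_space M
  for \<phi> B f0 \<theta>0 \<gamma> C b g pstar \<tau>0 \<beta> and M :: "'w measure" +
  fixes X :: "nat \<Rightarrow> 'w \<Rightarrow> real"
  assumes X_indep: "M.indep_vars (\<lambda>_. borel) X {1..}"
    and X_density: "\<And>i. i \<ge> 1 \<Longrightarrow> distributed M lborel (X i) (\<lambda>x. ennreal (f0 x) * indicator {0..1} x)"
begin

abbreviation post :: "nat pmf \<Rightarrow> nat \<Rightarrow> 'w \<Rightarrow> (nat \<times> (nat \<Rightarrow> real)) measure" where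
  "post p n \<omega> \<equiv> posterior \<phi> (prior p g \<tau>0 \<beta>) n (\<lambda>i. X i \<omega>)"

lemma X_measurable: "i \<ge> 1 \<Longrightarrow> X i \<in> borel_measurable M"
  using X_density[of i] by (auto simp: distributed_def)

lemma X_expectation:
  assumes "i \<ge> 1" and [measurable]: "F \<in> borel_measurable borel"
  shows "(\<integral>\<^sup>+\<omega>. F (X i \<omega>) \<partial>M) = (\<integral>\<^sup>+x. ennreal (f0 x) * F x \<partial>U01)"
  using distributed_nn_integral[OF X_density[OF assms(1)], of F]
  by (simp add: nn_integral_restrict_space mult_ac)

lemma X_AE: "AE \<omega> in M. \<forall>i\<in>{1..n}. X i \<omega> \<in> {0..1} \<and> f0 (X i \<omega>) > 0"
proof (intro AE_finite_allI)
  fix i assume i: "i \<in> {1..n}"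
  then have Xm: "X i \<in> measurable M lborel" using X_measurable[of i] by simp
  have eq: "distr M lborel (X i) = density lborel (\<lambda>x. ennreal (f0 x) * indicator {0..1} x)"
    using X_density[of i] i unfolding distributed_def by auto
  have "AE x in distr M lborel (X i). x \<in> {0..1} \<and> f0 x > 0"
    unfolding eq by (subst AE_density) (auto simp: indicator_def split: if_splits)
  then show "AE \<omega> in M. X i \<omega> \<in> {0..1} \<and> f0 (X i \<omega>) > 0"
    by (rule AE_distrD[OF Xm])
qed simp

lemma prod_expectation:
  assumes F[measurable]: "F \<in> borel_measurable borel"
  shows "(\<integral>\<^sup>+\<omega>. (\<Prod>i=1..n. F (X i \<omega>)) \<partial>M) = (\<integral>\<^sup>+x. ennreal (f0 x) * F x \<partial>U01) ^ n"
proof -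
  have "M.indep_vars (\<lambda>_. borel) (\<lambda>i \<omega>. F (X i \<omega>)) {1..n}"
    by (rule M.indep_vars_compose2[OF M.indep_vars_subset[OF X_indep]]) auto
  then have "(\<integral>\<^sup>+\<omega>. (\<Prod>i=1..n. F (X i \<omega>)) \<partial>M) = (\<Prod>i=1..n. \<integral>\<^sup>+\<omega>. F (X i \<omega>) \<partial>M)"
    by (intro M.indep_vars_nn_integral) auto
  also have "\<dots> = (\<Prod>i=1..n. \<integral>\<^sup>+x. ennreal (f0 x) * F x \<partial>U01)"
    by (intro prod.cong refl X_expectation F) auto
  finally show ?thesis by simp
qed

lemma prod_measurable:
  assumes [measurable]: "F \<in> borel_measurable borel"
  shows "(\<lambda>\<omega>. \<Prod>i=1..n. F (X i \<omega>) :: real) \<in> borel_measurable M"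
  using X_measurable by (intro borel_measurable_prod measurable_compose[OF _ assms]) auto

lemma markov_exp:
  assumes [measurable]: "h \<in> borel_measurable M" and I: "(\<integral>\<^sup>+\<omega>. h \<omega> \<partial>M) \<le> ennreal I" "I \<ge> 0"
  shows "measure M {\<omega> \<in> space M. ennreal (exp c) \<le> h \<omega>} \<le> exp (- c) * I"
proof -
  have "emeasure M {\<omega> \<in> space M. ennreal (exp c) \<le> h \<omega>} \<le> emeasure M {\<omega> \<in> space M. 1 \<le> ennreal (exp (- c)) * h \<omega>}"
  proof (rule emeasure_mono)
    show "{\<omega> \<in> space M. ennreal (exp c) \<le> h \<omega>} \<subseteq> {\<omega> \<in> space M. 1 \<le> ennreal (exp (- c)) * h \<omega>}"
    proof clarify
      fix \<omega> assume "ennreal (exp c) \<le> h \<omega>"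
      then have "ennreal (exp (- c)) * ennreal (exp c) \<le> ennreal (exp (- c)) * h \<omega>" by (rule mult_left_mono) simp
      then show "1 \<le> ennreal (exp (- c)) * h \<omega>" by (simp add: ennreal_mult[symmetric] exp_minus)
    qed
  qed measurable
  also have "\<dots> \<le> ennreal (exp (- c)) * (\<integral>\<^sup>+\<omega>. h \<omega> * indicator (space M) \<omega> \<partial>M)"
    by (rule nn_integral_Markov_inequality) auto
  also have "(\<integral>\<^sup>+\<omega>. h \<omega> * indicator (space M) \<omega> \<partial>M) = (\<integral>\<^sup>+\<omega>. h \<omega> \<partial>M)" by (intro nn_integral_cong) simp
  also have "ennreal (exp (- c)) * \<dots> \<le> ennreal (exp (- c)) * ennreal I" by (rule mult_left_mono[OF I(1)]) simp
  also have "\<dots> = ennreal (exp (- c) * I)" using I by (simp add: ennreal_mult)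
  finally show ?thesis using I by (simp add: M.emeasure_eq_measure)
qed

lemma markov_prod:
  assumes [measurable]: "F \<in> borel_measurable borel" and F0: "\<And>x. F x \<ge> 0"
    and I: "(\<integral>\<^sup>+x. ennreal (f0 x) * ennreal (F x) \<partial>U01) \<le> ennreal (exp y)"
  shows "measure M {\<omega> \<in> space M. exp c \<le> (\<Prod>i=1..n. F (X i \<omega>))} \<le> exp (real n * y - c)"
proof -
  have "(\<integral>\<^sup>+\<omega>. ennreal (\<Prod>i=1..n. F (X i \<omega>)) \<partial>M) = (\<integral>\<^sup>+\<omega>. (\<Prod>i=1..n. ennreal (F (X i \<omega>))) \<partial>M)"
    using F0 by (simp add: prod_ennreal)
  also have "\<dots> = (\<integral>\<^sup>+x. ennreal (f0 x) * ennreal (F x) \<partial>U01) ^ n"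
    by (rule prod_expectation) measurable
  also have "\<dots> \<le> ennreal (exp y) ^ n" by (rule power_mono[OF I]) simp
  also have "\<dots> = ennreal (exp (real n * y))" by (simp add: ennreal_power exp_of_nat_mult)
  finally have *: "(\<integral>\<^sup>+\<omega>. ennreal (\<Prod>i=1..n. F (X i \<omega>)) \<partial>M) \<le> ennreal (exp (real n * y))" .
  have m: "(\<lambda>\<omega>. ennreal (\<Prod>i=1..n. F (X i \<omega>))) \<in> borel_measurable M"
    using prod_measurable[of F n] by measurable
  have "{\<omega> \<in> space M. exp c \<le> (\<Prod>i=1..n. F (X i \<omega>))} = {\<omega> \<in> space M. ennreal (exp c) \<le> ennreal (\<Prod>i=1..n. F (X i \<omega>))}"
    using F0 by (simp add: prod_nonneg)
  then show ?thesis using markov_exp[OF m *, of c] by (simp add: exp_add[symmetric])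
qed

lemma model_measurable_joint:
  assumes "i \<ge> 1"
  shows "(\<lambda>z. model_density \<phi> (fst (snd z)) (snd (snd z)) (X i (fst z))) \<in> borel_measurable (M \<Otimes>\<^sub>M param_space)"
proof -
  note [measurable] = X_measurable[OF assms]
  have "(\<lambda>z. model_density \<phi> k (snd (snd z)) (X i (fst z))) \<in> borel_measurable (M \<Otimes>\<^sub>M param_space)" for k
  proof -
    have "(\<lambda>z. (X i (fst z), snd (snd z))) \<in> measurable (M \<Otimes>\<^sub>M param_space) (borel \<Otimes>\<^sub>M seq_space)"
      unfolding param_space_def by measurable
    from measurable_compose[OF this model_density_measurable_joint[of k]] show ?thesis by simp
  qed
  moreover have "(\<lambda>z. fst (snd z)) \<in> measurable (M \<Otimes>\<^sub>M param_space) (count_space UNIV)"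
    unfolding param_space_def by measurable
  ultimately show ?thesis
    by (rule measurable_compose_countable[where f="\<lambda>k z. model_density \<phi> k (snd (snd z)) (X i (fst z))"])
qed

definition lik :: "nat \<Rightarrow> 'w \<Rightarrow> nat \<times> (nat \<Rightarrow> real) \<Rightarrow> real" where
  "lik n \<omega> t = likelihood \<phi> n (\<lambda>i. X i \<omega>) t"

definition true_lik :: "nat \<Rightarrow> 'w \<Rightarrow> real" where
  "true_lik n \<omega> = (\<Prod>i=1..n. f0 (X i \<omega>))"

lemma lik_eq: "lik n \<omega> (k, \<theta>) = (\<Prod>i=1..n. model_density \<phi> k \<theta> (X i \<omega>))"
  by (simp add: lik_def likelihood_def)

lemma lik_pos: "lik n \<omega> t > 0"
  by (cases t) (simp add: lik_eq prod_pos model_density_pos)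

lemma lik_measurable_joint[measurable]: "(\<lambda>z. lik n (fst z) (snd z)) \<in> borel_measurable (M \<Otimes>\<^sub>M param_space)"
proof -
  have "(\<lambda>z. lik n (fst z) (snd z)) = (\<lambda>z. \<Prod>i=1..n. model_density \<phi> (fst (snd z)) (snd (snd z)) (X i (fst z)))"
    by (auto simp: lik_def likelihood_def split: prod.split)
  then show ?thesis using model_measurable_joint by (auto intro!: borel_measurable_prod)
qed

lemma lik_measurable:
  assumes "\<omega> \<in> space M"
  shows "lik n \<omega> \<in> borel_measurable param_space"
  using measurable_compose[OF measurable_Pair1'[OF assms] lik_measurable_joint, of n] by simp

lemma true_lik_measurable[measurable]: "true_lik n \<in> borel_measurable M"
  unfolding true_lik_def by (rule prod_measurable) measurable

text \<open>The unnormalised posterior mass of a set. On the whole space it is the denominator of the posterior.\<close>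

definition evidence :: "nat pmf \<Rightarrow> nat \<Rightarrow> (nat \<times> (nat \<Rightarrow> real)) set \<Rightarrow> 'w \<Rightarrow> ennreal" where
  "evidence p n A \<omega> = (\<integral>\<^sup>+t. ennreal (lik n \<omega> t) * indicator A t \<partial>prior p g \<tau>0 \<beta>)"

lemma measurable_prior_iff: "f \<in> measurable (prior p g \<tau>0 \<beta>) N \<longleftrightarrow> f \<in> measurable param_space N"
  by (intro arg_cong2[where f="(\<in>)"] refl measurable_cong_sets) auto

lemma measurable_pair_prior_iff: "f \<in> measurable (M \<Otimes>\<^sub>M prior p g \<tau>0 \<beta>) N \<longleftrightarrow> f \<in> measurable (M \<Otimes>\<^sub>M param_space) N"
  by (intro arg_cong2[where f="(\<in>)"] refl measurable_cong_sets sets_pair_measure_cong) auto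

lemma evidence_measurable:
  assumes [measurable]: "A \<in> sets param_space"
  shows "evidence p n A \<in> borel_measurable M"
proof -
  interpret P: prob_space "prior p g \<tau>0 \<beta>" by (rule prob_space_prior)
  have "(\<lambda>z. ennreal (lik n (fst z) (snd z)) * indicator A (snd z)) \<in> borel_measurable (M \<Otimes>\<^sub>M prior p g \<tau>0 \<beta>)"
    unfolding measurable_pair_prior_iff by measurable
  then show ?thesis
    unfolding evidence_def by (intro P.borel_measurable_nn_integral) (simp add: split_beta')
qed

text \<open>The likelihood is positive everywhere, hence so is its average over the prior.\<close>

lemma evidence_UNIV_pos:
  assumes "\<omega> \<in> space M"
  shows "evidence p n UNIV \<omega> > 0"
proof -
  interpret P: prob_space "prior p g \<tau>0 \<beta>" by (rule prob_space_prior)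
  have [measurable]: "lik n \<omega> \<in> borel_measurable (prior p g \<tau>0 \<beta>)"
    unfolding measurable_prior_iff by (rule lik_measurable[OF assms])
  have "evidence p n UNIV \<omega> \<noteq> 0"
  proof
    assume "evidence p n UNIV \<omega> = 0"
    then have "AE t in prior p g \<tau>0 \<beta>. ennreal (lik n \<omega> t) * indicator UNIV t = 0"
      unfolding evidence_def by (subst (asm) nn_integral_0_iff_AE) auto
    then have "AE t in prior p g \<tau>0 \<beta>. False"
    proof eventually_elim
      case (elim t)
      then show ?case using lik_pos[of n \<omega> t] by (simp add: ennreal_eq_0_iff)
    qed
    then show False by (simp add: P.AE_False)
  qed
  then show ?thesis by (simp add: zero_less_iff_neq_zero)
qed

lemma emeasure_posterior:
  assumes \<omega>: "\<omega> \<in> space M" and A: "A \<in> sets param_space"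
  shows "emeasure (post p n \<omega>) A = evidence p n A \<omega> / evidence p n UNIV \<omega>"
proof -
  have [measurable]: "lik n \<omega> \<in> borel_measurable (prior p g \<tau>0 \<beta>)"
    unfolding measurable_prior_iff by (rule lik_measurable[OF \<omega>])
  have [measurable]: "A \<in> sets (prior p g \<tau>0 \<beta>)" using A by simp
  have post: "post p n \<omega> =
      density (prior p g \<tau>0 \<beta>) (\<lambda>t. ennreal (lik n \<omega> t) / evidence p n UNIV \<omega>)"
    by (simp add: posterior_def evidence_def lik_def)
  have "emeasure (post p n \<omega>) A =
      (\<integral>\<^sup>+t. ennreal (lik n \<omega> t) / evidence p n UNIV \<omega> * indicator A t \<partial>prior p g \<tau>0 \<beta>)"
    unfolding post by (rule emeasure_density) measurable
  also have "\<dots> = (\<integral>\<^sup>+t. (ennreal (lik n \<omega> t) * indicator A t) / evidence p n UNIV \<omega> \<partial>prior p g \<tau>0 \<beta>)"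
    by (intro nn_integral_cong) (auto simp: indicator_def)
  also have "\<dots> = evidence p n A \<omega> / evidence p n UNIV \<omega>"
    unfolding evidence_def[of p n A] by (rule nn_integral_divide) measurable
  finally show ?thesis .
qed

lemma posterior_measurable:
  assumes A: "A \<in> sets param_space"
  shows "(\<lambda>\<omega>. measure (post p n \<omega>) A) \<in> borel_measurable M"
proof -
  have "UNIV \<in> sets param_space" using sets.top[of param_space] by simp
  note [measurable] = evidence_measurable[OF A] evidence_measurable[OF this]
  have "(\<lambda>\<omega>. enn2real (evidence p n A \<omega> / evidence p n UNIV \<omega>)) \<in> borel_measurable M" by measurable
  then show ?thesis
    by (rule measurable_cong[THEN iffD1, rotated]) (simp add: measure_def emeasure_posterior[OF _ A])
qed

text \<open>Under the true law the likelihood ratio of every parameter has expectation at most one; by Fubini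
  so has its prior average over any set, up to the prior mass of the set.\<close>

lemma evidence_expectation:
  assumes A: "A \<in> sets param_space"
  shows "(\<integral>\<^sup>+\<omega>. evidence p n A \<omega> / ennreal (true_lik n \<omega>) \<partial>M) \<le> emeasure (prior p g \<tau>0 \<beta>) A"
proof -
  interpret P: prob_space "prior p g \<tau>0 \<beta>" by (rule prob_space_prior)
  interpret MP: pair_sigma_finite M "prior p g \<tau>0 \<beta>" ..
  note [measurable] = A
  have A': "A \<in> sets (prior p g \<tau>0 \<beta>)" using A by simp
  have m: "(\<lambda>z. ennreal (lik n (fst z) (snd z)) * indicator A (snd z) / ennreal (true_lik n (fst z))) \<in> borel_measurable (M \<Otimes>\<^sub>M prior p g \<tau>0 \<beta>)"
    unfolding measurable_pair_prior_iff by measurable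
  have "(\<integral>\<^sup>+\<omega>. evidence p n A \<omega> / ennreal (true_lik n \<omega>) \<partial>M) =
     (\<integral>\<^sup>+\<omega>. (\<integral>\<^sup>+t. ennreal (lik n \<omega> t) * indicator A t / ennreal (true_lik n \<omega>) \<partial>prior p g \<tau>0 \<beta>) \<partial>M)"
  proof (rule nn_integral_cong)
    fix \<omega> assume "\<omega> \<in> space M"
    then have [measurable]: "lik n \<omega> \<in> borel_measurable (prior p g \<tau>0 \<beta>)"
      unfolding measurable_prior_iff by (rule lik_measurable)
    show "evidence p n A \<omega> / ennreal (true_lik n \<omega>) = (\<integral>\<^sup>+t. ennreal (lik n \<omega> t) * indicator A t / ennreal (true_lik n \<omega>) \<partial>prior p g \<tau>0 \<beta>)"
      unfolding evidence_def using A' by (intro nn_integral_divide[symmetric]) measurable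
  qed
  also have "\<dots> = (\<integral>\<^sup>+t. (\<integral>\<^sup>+\<omega>. ennreal (lik n \<omega> t) * indicator A t / ennreal (true_lik n \<omega>) \<partial>M) \<partial>prior p g \<tau>0 \<beta>)"
    using m by (intro MP.Fubini'[symmetric]) (simp add: split_beta')
  also have "\<dots> \<le> (\<integral>\<^sup>+t. indicator A t \<partial>prior p g \<tau>0 \<beta>)"
  proof (rule nn_integral_mono)
    fix t :: "nat \<times> (nat \<Rightarrow> real)"
    obtain k \<theta> where t: "t = (k, \<theta>)" by (cases t)
    define F where "F x = model_density \<phi> k \<theta> x / f0 x" for x
    have [measurable]: "F \<in> borel_measurable borel" unfolding F_def by measurable
    have F0: "F x \<ge> 0" for x using f0_nonneg[of x] model_density_pos[of k \<theta> x] by (simp add: F_def)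
    have "(\<integral>\<^sup>+\<omega>. ennreal (lik n \<omega> t) / ennreal (true_lik n \<omega>) \<partial>M) = (\<integral>\<^sup>+\<omega>. (\<Prod>i=1..n. ennreal (F (X i \<omega>))) \<partial>M)"
    proof (rule nn_integral_cong_AE)
      show "AE \<omega> in M. ennreal (lik n \<omega> t) / ennreal (true_lik n \<omega>) = (\<Prod>i=1..n. ennreal (F (X i \<omega>)))"
        using X_AE[of n]
      proof eventually_elim
        case (elim \<omega>)
        then have pos: "true_lik n \<omega> > 0" unfolding true_lik_def by (intro prod_pos) auto
        have "(\<Prod>i=1..n. ennreal (F (X i \<omega>))) = ennreal (\<Prod>i=1..n. F (X i \<omega>))"
          by (rule prod_ennreal) (rule F0)
        also have "(\<Prod>i=1..n. F (X i \<omega>)) = lik n \<omega> t / true_lik n \<omega>"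
          by (simp add: F_def t lik_eq true_lik_def prod_dividef)
        finally show ?case using pos lik_pos[of n \<omega> t] by (simp add: divide_ennreal less_imp_le)
      qed
    qed
    also have "\<dots> = (\<integral>\<^sup>+x. ennreal (f0 x) * ennreal (F x) \<partial>U01) ^ n" by (rule prod_expectation) measurable
    finally have *: "(\<integral>\<^sup>+\<omega>. ennreal (lik n \<omega> t) / ennreal (true_lik n \<omega>) \<partial>M) = (\<integral>\<^sup>+x. ennreal (f0 x) * ennreal (F x) \<partial>U01) ^ n" .
    have "(\<integral>\<^sup>+x. ennreal (f0 x) * ennreal (F x) \<partial>U01) \<le> (\<integral>\<^sup>+x. ennreal (model_density \<phi> k \<theta> x) \<partial>U01)"
    proof (intro nn_integral_mono)
      fix x
      have "f0 x * F x \<le> model_density \<phi> k \<theta> x" using model_density_pos[of k \<theta> x] by (simp add: F_def)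
      then show "ennreal (f0 x) * ennreal (F x) \<le> ennreal (model_density \<phi> k \<theta> x)"
        using f0_nonneg F0 by (simp add: ennreal_mult[symmetric] ennreal_leI)
    qed
    also have "\<dots> = 1"
      using model_density_pos by (subst nn_integral_eq_integral) (auto simp: model_density_integral model_density_integrable less_imp_le)
    finally have "(\<integral>\<^sup>+\<omega>. ennreal (lik n \<omega> t) / ennreal (true_lik n \<omega>) \<partial>M) \<le> 1"
      unfolding * by (intro power_le_one) auto
    then show "(\<integral>\<^sup>+\<omega>. ennreal (lik n \<omega> t) * indicator A t / ennreal (true_lik n \<omega>) \<partial>M) \<le> indicator A t"
      by (auto simp: indicator_def)
  qed
  also have "\<dots> = emeasure (prior p g \<tau>0 \<beta>) A" using A' by simp
  finally show ?thesis .
qed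

definition far :: "real \<Rightarrow> (nat \<times> (nat \<Rightarrow> real)) set" where
  "far r = {(k, \<theta>). hellinger f0 (model_density \<phi> k \<theta>) > r}"

lemma far_sets[measurable]: "far r \<in> sets param_space"
proof (rule sets_param_spaceI)
  fix k
  have "{\<theta> \<in> space seq_space. hellinger f0 (model_density \<phi> k \<theta>) > r} \<in> sets seq_space" by measurable
  then show "{\<theta>. (k, \<theta>) \<in> far r} \<in> sets seq_space" by (simp add: space_PiM far_def)
qed

definition near :: "nat \<Rightarrow> real \<Rightarrow> (nat \<times> (nat \<Rightarrow> real)) set" where
  "near k \<eta> = {(k', \<theta>). k' = k \<and> (\<forall>l\<in>{1..k}. \<bar>\<theta> l - \<theta>0 l\<bar> \<le> \<eta>)}"

lemma lik_perturbation:
  assumes x: "\<And>i. i \<in> {1..n} \<Longrightarrow> X i \<omega> \<in> {0..1}"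
    and \<eta>: "\<And>l. l \<in> {1..k} \<Longrightarrow> \<bar>\<theta> l - \<theta>' l\<bar> \<le> \<eta>" "\<eta> \<ge> 0"
    and K: "k \<le> K" and small: "2 * real n * \<eta> * real K * sqrt (2 * B) \<le> 1"
  shows "lik n \<omega> (k, \<theta>) \<le> exp 1 * lik n \<omega> (k, \<theta>')"
proof -
  let ?d = "2 * (\<eta> * real k * sqrt (2 * B))"
  have "lik n \<omega> (k, \<theta>) \<le> (\<Prod>i=1..n. exp ?d * model_density \<phi> k \<theta>' (X i \<omega>))"
    unfolding lik_eq using model_density_pos model_density_perturbation[OF \<eta> x] 
    by (intro prod_mono) (auto simp: less_imp_le)
  also have "\<dots> = exp (real n * ?d) * lik n \<omega> (k, \<theta>')"
    by (simp add: prod.distrib lik_eq exp_of_nat_mult)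
  also have "real n * ?d \<le> 1"
  proof -
    have "real n * ?d = 2 * real n * \<eta> * sqrt (2 * B) * real k" by simp
    also have "\<dots> \<le> 2 * real n * \<eta> * sqrt (2 * B) * real K"
      using K \<eta>(2) B_nonneg by (intro mult_left_mono) auto
    also have "\<dots> = 2 * real n * \<eta> * real K * sqrt (2 * B)" by simp
    finally show ?thesis using small by linarith
  qed
  then have "exp (real n * ?d) * lik n \<omega> (k, \<theta>') \<le> exp 1 * lik n \<omega> (k, \<theta>')"
    using lik_pos[of n \<omega> "(k, \<theta>')"] by (intro mult_right_mono) auto
  finally show ?thesis .
qed

lemma evidence_le:
  assumes \<omega>: "\<omega> \<in> space M" and c: "c \<ge> 0" and A: "A \<in> sets param_space" "\<And>t. t \<in> A \<Longrightarrow> lik n \<omega> t \<le> c"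
  shows "evidence p n A \<omega> \<le> ennreal c"
proof -
  interpret P: prob_space "prior p g \<tau>0 \<beta>" by (rule prob_space_prior)
  have "evidence p n A \<omega> \<le> (\<integral>\<^sup>+t. ennreal c \<partial>prior p g \<tau>0 \<beta>)"
    unfolding evidence_def using A(2) by (intro nn_integral_mono) (auto simp: indicator_def ennreal_leI)
  then show ?thesis using P.emeasure_space_1 by simp
qed

lemma evidence_ge:
  assumes \<omega>: "\<omega> \<in> space M" and c: "c \<ge> 0" and A: "A \<in> sets param_space" "\<And>t. t \<in> A \<Longrightarrow> c \<le> lik n \<omega> t"
  shows "ennreal c * emeasure (prior p g \<tau>0 \<beta>) A \<le> evidence p n A \<omega>"
proof -
  have "ennreal c * emeasure (prior p g \<tau>0 \<beta>) A = (\<integral>\<^sup>+t. ennreal c * indicator A t \<partial>prior p g \<tau>0 \<beta>)"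
    using A(1) by (subst nn_integral_cmult_indicator) auto
  also have "\<dots> \<le> evidence p n A \<omega>"
    unfolding evidence_def using A(2) by (intro nn_integral_mono) (auto simp: indicator_def ennreal_leI)
  finally show ?thesis .
qed

lemma evidence_mono: "A \<subseteq> A' \<Longrightarrow> evidence p n A \<omega> \<le> evidence p n A' \<omega>"
  unfolding evidence_def by (intro nn_integral_mono) (auto simp: indicator_def)

lemma evidence_Un:
  assumes "\<omega> \<in> space M" "A \<in> sets param_space" "A' \<in> sets param_space"
  shows "evidence p n (A \<union> A') \<omega> \<le> evidence p n A \<omega> + evidence p n A' \<omega>"
proof -
  have [measurable]: "lik n \<omega> \<in> borel_measurable (prior p g \<tau>0 \<beta>)"
    unfolding measurable_prior_iff by (rule lik_measurable[OF assms(1)])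
  have [measurable]: "A \<in> sets (prior p g \<tau>0 \<beta>)" "A' \<in> sets (prior p g \<tau>0 \<beta>)" using assms by auto
  have "evidence p n (A \<union> A') \<omega> \<le> (\<integral>\<^sup>+t. ennreal (lik n \<omega> t) * indicator A t + ennreal (lik n \<omega> t) * indicator A' t \<partial>prior p g \<tau>0 \<beta>)"
    unfolding evidence_def by (intro nn_integral_mono) (auto simp: indicator_def)
  also have "\<dots> = evidence p n A \<omega> + evidence p n A' \<omega>"
    unfolding evidence_def by (rule nn_integral_add) measurable
  finally show ?thesis .
qed

text \<open>Where the denominator is infinite the posterior vanishes identically; this happens with probability
zero only, since the denominator divided by the true likelihood has finite mean.\<close>

lemma evidence_UNIV_finite: "AE \<omega> in M. evidence p n UNIV \<omega> < \<infinity>"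
proof -
  interpret P: prob_space "prior p g \<tau>0 \<beta>" by (rule prob_space_prior)
  have U: "UNIV \<in> sets param_space" using sets.top[of param_space] by simp
  note [measurable] = evidence_measurable[OF U]
  have "(\<integral>\<^sup>+\<omega>. evidence p n UNIV \<omega> / ennreal (true_lik n \<omega>) \<partial>M) \<le> 1"
    using evidence_expectation[OF U, of p n] P.emeasure_le_1 order_trans by blast
  then have "(\<integral>\<^sup>+\<omega>. evidence p n UNIV \<omega> / ennreal (true_lik n \<omega>) \<partial>M) \<noteq> \<infinity>" by (auto simp: top_unique)
  then have "AE \<omega> in M. evidence p n UNIV \<omega> / ennreal (true_lik n \<omega>) \<noteq> \<infinity>"
    by (intro nn_integral_PInf_AE) measurable
  then show ?thesis
    by eventually_elim (auto simp: ennreal_top_divide less_top[symmetric])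
qed

text \<open>The three summands bound the probabilities of three bad events. Off the first one, the likelihood of the
projection is at least \<open>exp (- a)\<close> times the true one; together with the prior mass \<open>exp (- q)\<close> of a box on
which the likelihood is constant up to a factor, this bounds the denominator from below. Off the second
one, no representative of a grid on the part of the sieve at distance more than \<open>r\<close> has a likelihood
ratio above \<open>exp (- t)\<close>; on the cell of a representative the likelihood is again constant up to a factor,
so this bounds the contribution of the whole part to the numerator. Off the third one, the average of
the likelihood ratio over the complement of the sieve is at most \<open>exp (- t)\<close> as well.

For \<open>t \<ge> a + q + 3 + u\<close> the quotient is at most \<open>exp (- u)\<close>, where \<open>3\<close> absorbs the bounded factors.\<close>

theorem posterior_concentration_bound:
  assumes k: "k \<ge> 1" "k \<le> K" and R: "R \<ge> 0" and r: "r \<ge> 0" and \<eta>: "\<eta> > 0"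
    and small: "2 * real n * \<eta> * real K * sqrt (2 * B) \<le> 1"
    and mass: "ennreal (exp (- q)) \<le> emeasure (prior p g \<tau>0 \<beta>) (near k \<eta>)"
    and near: "near k \<eta> \<in> sets param_space"
    and t: "t \<ge> a + q + 3 + u"
    and G: "G \<in> sets param_space" "\<And>s. s \<notin> G \<Longrightarrow> s \<in> outside_sieve K R \<or> s \<in> far r"
    and out: "emeasure (prior p g \<tau>0 \<beta>) (outside_sieve K R) \<le> ennreal e" "e \<ge> 0"
  shows "measure M {\<omega> \<in> space M. \<bar>measure (post p n \<omega>) G - 1\<bar> > exp (- u)} \<le>
    exp (real n * (chi_const * real k powr (- 2 * \<gamma>)) - a) +
    (real K + 1) * (2 * R / \<eta> + 2) ^ K * exp (t / 2 - real n * r\<^sup>2 / 2) + exp t * e"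
proof -
  let ?Out = "outside_sieve K R"
  define A where "A = far r - ?Out"
  have A_sets: "A \<in> sets param_space" unfolding A_def by measurable
  have A_sieve: "k' \<le> K \<and> (\<forall>l\<in>{1..k'}. \<bar>\<theta> l\<bar> \<le> R)" if "(k', \<theta>) \<in> A" for k' \<theta>
    using that by (auto simp: A_def outside_sieve_def not_less)
  obtain F where F: "finite F" "F \<subseteq> A" "real (card F) \<le> (real K + 1) * (2 * R / \<eta> + 2) ^ K"
    and net: "\<And>k \<theta>. (k, \<theta>) \<in> A \<Longrightarrow> \<exists>\<theta>'. (k, \<theta>') \<in> F \<and> (\<forall>l\<in>{1..k}. \<bar>\<theta> l - \<theta>' l\<bar> \<le> \<eta>)"
    using finite_net[of A K R \<eta>] A_sieve \<eta> R by metis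
  define E1 where "E1 = {\<omega> \<in> space M. exp a \<le> (\<Prod>i=1..n. f0 (X i \<omega>) / model_density \<phi> k \<theta>0 (X i \<omega>))}"
  define E2 where "E2 j = {\<omega> \<in> space M. exp (- t / 2) \<le> (\<Prod>i=1..n. sqrt (model_density \<phi> (fst j) (snd j) (X i \<omega>) / f0 (X i \<omega>)))}" for j
  define E3 where "E3 = {\<omega> \<in> space M. ennreal (exp (- t)) \<le> evidence p n ?Out \<omega> / ennreal (true_lik n \<omega>)}"
  note [measurable] = evidence_measurable[OF outside_sieve_sets]
  have E1: "measure M E1 \<le> exp (real n * (chi_const * real k powr (- 2 * \<gamma>)) - a)"
    unfolding E1_def using chi_square_projection[OF k(1)] f0_nonneg model_density_pos
    by (intro markov_prod) (auto simp: less_imp_le)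
  have E1_sets: "E1 \<in> sets M" unfolding E1_def
  proof -
    have [measurable]: "(\<lambda>\<omega>. \<Prod>i=1..n. f0 (X i \<omega>) / model_density \<phi> k \<theta>0 (X i \<omega>)) \<in> borel_measurable M"
      by (rule prod_measurable) measurable
    show "{\<omega> \<in> space M. exp a \<le> (\<Prod>i=1..n. f0 (X i \<omega>) / model_density \<phi> k \<theta>0 (X i \<omega>))} \<in> sets M" by measurable
  qed
  have E2: "measure M (E2 j) \<le> exp (t / 2 - real n * r\<^sup>2 / 2)" if "j \<in> F" for j
  proof -
    obtain k' \<theta>' where j: "j = (k', \<theta>')" by (cases j)
    have "r \<le> hellinger f0 (model_density \<phi> k' \<theta>')" using that F(2) by (auto simp: j A_def far_def)
    from markov_prod[OF _ _ hellinger_affinity[OF this r], of "- t / 2" n]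
    have "measure M (E2 j) \<le> exp (real n * (- r\<^sup>2 / 2) - (- t / 2))"
      unfolding E2_def j using f0_nonneg model_density_pos by (auto simp: less_imp_le)
    then show ?thesis by (simp add: algebra_simps)
  qed
  have E2_sets: "E2 j \<in> sets M" for j unfolding E2_def
  proof -
    have [measurable]: "(\<lambda>\<omega>. \<Prod>i=1..n. sqrt (model_density \<phi> (fst j) (snd j) (X i \<omega>) / f0 (X i \<omega>))) \<in> borel_measurable M"
      by (rule prod_measurable) measurable
    show "{\<omega> \<in> space M. exp (- t / 2) \<le> (\<Prod>i=1..n. sqrt (model_density \<phi> (fst j) (snd j) (X i \<omega>) / f0 (X i \<omega>)))} \<in> sets M" by measurable
  qed
  have E3_sets: "E3 \<in> sets M" unfolding E3_def by measurable
  have E3: "measure M E3 \<le> exp t * e"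
  proof -
    have "(\<integral>\<^sup>+\<omega>. evidence p n ?Out \<omega> / ennreal (true_lik n \<omega>) \<partial>M) \<le> ennreal e"
      using evidence_expectation[OF outside_sieve_sets, of p n] out(1) by (rule order_trans)
    from markov_exp[OF _ this out(2), of "- t"] show ?thesis unfolding E3_def by simp
  qed
  define Bad where "Bad = E1 \<union> (\<Union>j\<in>F. E2 j) \<union> E3"
  have Bad_sets: "Bad \<in> sets M" unfolding Bad_def by (intro sets.Un sets.finite_UN E1_sets E2_sets E3_sets F(1))
  have E2_Un: "(\<Union>j\<in>F. E2 j) \<in> sets M" by (intro sets.finite_UN E2_sets F(1))
  have "measure M Bad \<le> measure M (E1 \<union> (\<Union>j\<in>F. E2 j)) + measure M E3"
    unfolding Bad_def by (intro measure_Un_le sets.Un E1_sets E2_Un E3_sets)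
  moreover have "measure M (E1 \<union> (\<Union>j\<in>F. E2 j)) \<le> measure M E1 + measure M (\<Union>j\<in>F. E2 j)"
    by (intro measure_Un_le E1_sets E2_Un)
  moreover have "measure M (\<Union>j\<in>F. E2 j) \<le> (\<Sum>j\<in>F. measure M (E2 j))"
    by (intro measure_UNION_le F(1) E2_sets)
  moreover have "(\<Sum>j\<in>F. measure M (E2 j)) \<le> (\<Sum>j\<in>F. exp (t / 2 - real n * r\<^sup>2 / 2))" by (intro sum_mono E2)
  moreover have "(\<Sum>j\<in>F. exp (t / 2 - real n * r\<^sup>2 / 2)) \<le> (real K + 1) * (2 * R / \<eta> + 2) ^ K * exp (t / 2 - real n * r\<^sup>2 / 2)"
    using F(3) by (simp add: mult_right_mono)
  ultimately have Bad: "measure M Bad \<le> exp (real n * (chi_const * real k powr (- 2 * \<gamma>)) - a) +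
    (real K + 1) * (2 * R / \<eta> + 2) ^ K * exp (t / 2 - real n * r\<^sup>2 / 2) + exp t * e"
    using E1 E3 by linarith
  have "AE \<omega> in M. \<omega> \<in> {\<omega> \<in> space M. \<bar>measure (post p n \<omega>) G - 1\<bar> > exp (- u)} \<longrightarrow> \<omega> \<in> Bad"
    using X_AE[of n] evidence_UNIV_finite[of p n] AE_space
  proof eventually_elim
    case (elim \<omega>)
    then have x: "X i \<omega> \<in> {0..1}" "f0 (X i \<omega>) > 0" if "i \<in> {1..n}" for i using that by blast+
    have \<omega>: "\<omega> \<in> space M" using elim by simp
    have P0: "true_lik n \<omega> > 0" unfolding true_lik_def by (intro prod_pos x) auto
    show ?case
    proof (rule impI, rule ccontr)
      assume large: "\<omega> \<in> {\<omega> \<in> space M. \<bar>measure (post p n \<omega>) G - 1\<bar> > exp (- u)}"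
        and "\<omega> \<notin> Bad"
      then have n1: "(\<Prod>i=1..n. f0 (X i \<omega>) / model_density \<phi> k \<theta>0 (X i \<omega>)) < exp a"
        and n2: "\<And>k' \<theta>'. (k', \<theta>') \<in> F \<Longrightarrow> (\<Prod>i=1..n. sqrt (model_density \<phi> k' \<theta>' (X i \<omega>) / f0 (X i \<omega>))) < exp (- t / 2)"
        and n3: "evidence p n ?Out \<omega> / ennreal (true_lik n \<omega>) < ennreal (exp (- t))"
        using \<omega> by (auto simp: Bad_def E1_def E2_def E3_def not_le)
      have lik0: "exp (- a) * true_lik n \<omega> \<le> lik n \<omega> (k, \<theta>0)"
      proof -
        have "true_lik n \<omega> / lik n \<omega> (k, \<theta>0) < exp a"
          using n1 by (simp add: true_lik_def lik_eq prod_dividef)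
        then show ?thesis using lik_pos[of n \<omega> "(k, \<theta>0)"] by (simp add: divide_less_eq exp_minus field_simps)
      qed
      have "ennreal (exp (- 1 - a) * true_lik n \<omega>) * emeasure (prior p g \<tau>0 \<beta>) (near k \<eta>) \<le> evidence p n (near k \<eta>) \<omega>"
      proof (rule evidence_ge[OF \<omega> _ near])
        fix s assume "s \<in> near k \<eta>"
        then obtain \<theta> where s: "s = (k, \<theta>)" "\<And>l. l \<in> {1..k} \<Longrightarrow> \<bar>\<theta>0 l - \<theta> l\<bar> \<le> \<eta>"
          by (auto simp: near_def abs_minus_commute)
        have "exp (- a) * true_lik n \<omega> \<le> exp 1 * lik n \<omega> s"
          using lik_perturbation[OF x(1) s(2) _ k(2) small] \<eta> lik0 s(1) by force
        then have "exp (- 1) * (exp (- a) * true_lik n \<omega>) \<le> exp (- 1) * (exp 1 * lik n \<omega> s)" by (intro mult_left_mono) auto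
        then show "exp (- 1 - a) * true_lik n \<omega> \<le> lik n \<omega> s"
          by (simp add: exp_diff exp_minus field_simps)
      qed (use P0 in simp)
      also have "\<dots> \<le> evidence p n UNIV \<omega>" by (rule evidence_mono) simp
      finally have "ennreal (exp (- 1 - a) * true_lik n \<omega>) * ennreal (exp (- q)) \<le> evidence p n UNIV \<omega>"
        using mult_left_mono[OF mass] by (meson order_trans zero_le)
      then have den: "ennreal (exp (- 1 - a - q) * true_lik n \<omega>) \<le> evidence p n UNIV \<omega>"
      proof -
        have "exp (- 1 - a - q) = exp (- 1 - a) * exp (- q)" by (simp add: exp_add[symmetric])
        then show "ennreal (exp (- 1 - a) * true_lik n \<omega>) * ennreal (exp (- q)) \<le> evidence p n UNIV \<omega> \<Longrightarrow> ?thesis"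
          using P0 by (simp add: ennreal_mult[symmetric] mult_ac)
      qed
      have num1: "evidence p n A \<omega> \<le> ennreal (exp (1 - t) * true_lik n \<omega>)"
      proof (rule evidence_le[OF \<omega> _ A_sets])
        fix s assume sA: "s \<in> A"
        obtain k' \<theta> where s: "s = (k', \<theta>)" by (cases s)
        obtain \<theta>' where \<theta>': "(k', \<theta>') \<in> F" "\<And>l. l \<in> {1..k'} \<Longrightarrow> \<bar>\<theta> l - \<theta>' l\<bar> \<le> \<eta>"
          using net[of k' \<theta>] sA s by blast
        have k': "k' \<le> K" using A_sieve[of k' \<theta>] sA s by simp
        \<comment> \<open>the event on the grid is about the square root of the ratio, hence the square\<close>
        have "lik n \<omega> (k', \<theta>') / true_lik n \<omega> = (\<Prod>i=1..n. sqrt (model_density \<phi> k' \<theta>' (X i \<omega>) / f0 (X i \<omega>)))\<^sup>2"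
          using f0_nonneg model_density_pos
          by (simp add: prod_power_distrib lik_eq true_lik_def prod_dividef less_imp_le)
        also have "\<dots> \<le> (exp (- t / 2))\<^sup>2"
          using n2[OF \<theta>'(1)] f0_nonneg model_density_pos by (intro power_mono prod_nonneg) (auto simp: less_imp_le)
        also have "\<dots> = exp (- t)" by (simp add: exp_double[symmetric])
        finally have "lik n \<omega> (k', \<theta>') \<le> exp (- t) * true_lik n \<omega>" using P0 by (simp add: divide_le_eq)
        then have "exp 1 * lik n \<omega> (k', \<theta>') \<le> exp 1 * (exp (- t) * true_lik n \<omega>)" by (intro mult_left_mono) auto
        moreover have "lik n \<omega> (k', \<theta>) \<le> exp 1 * lik n \<omega> (k', \<theta>')"
          using lik_perturbation[OF x(1) \<theta>'(2) _ k' small] \<eta> by force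
        moreover have "exp (1 - t) = exp 1 * exp (- t)" by (simp add: exp_add[symmetric])
        ultimately show "lik n \<omega> s \<le> exp (1 - t) * true_lik n \<omega>"
          unfolding s by (simp only: mult.assoc)
      qed (use P0 in simp)
      have num2: "evidence p n ?Out \<omega> \<le> ennreal (exp (- t) * true_lik n \<omega>)"
      proof -
        have "evidence p n ?Out \<omega> = evidence p n ?Out \<omega> / ennreal (true_lik n \<omega>) * ennreal (true_lik n \<omega>)"
          using P0 by (subst mult.commute) (simp add: ennreal_times_divide mult.commute[of "ennreal _" "evidence _ _ _ _"] mult_divide_eq_ennreal)
        also have "\<dots> \<le> ennreal (exp (- t)) * ennreal (true_lik n \<omega>)" using n3 by (intro mult_right_mono) auto
        finally show ?thesis using P0 by (simp add: ennreal_mult)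
      qed
      have "evidence p n (- G) \<omega> \<le> evidence p n (A \<union> ?Out) \<omega>"
        using G(2) by (intro evidence_mono) (auto simp: A_def)
      also have "\<dots> \<le> evidence p n A \<omega> + evidence p n ?Out \<omega>" by (rule evidence_Un[OF \<omega> A_sets outside_sieve_sets])
      also have "\<dots> \<le> ennreal (exp (1 - t) * true_lik n \<omega>) + ennreal (exp (- t) * true_lik n \<omega>)" by (rule add_mono[OF num1 num2])
      also have "\<dots> = ennreal ((exp 1 + 1) * exp (- t) * true_lik n \<omega>)"
        using P0 by (simp add: ennreal_plus[symmetric] exp_diff exp_minus field_simps del: ennreal_plus)
      also have "\<dots> \<le> ennreal (exp (- u) * (exp (- 1 - a - q) * true_lik n \<omega>))"
      proof (rule ennreal_leI)
        have "exp 1 + 1 \<le> exp 1 + exp (1::real)" by simp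
        also have "\<dots> \<le> exp 1 * exp (1::real)" using exp_ge_add_one_self[of "1::real"] by simp
        also have "\<dots> = exp 2" by (simp add: exp_add[symmetric])
        finally have "(exp 1 + 1) * exp (- t) \<le> exp 2 * exp (- t)" by (intro mult_right_mono) auto
        also have "\<dots> = exp (2 - t)" by (simp add: exp_diff exp_minus field_simps)
        also have "\<dots> \<le> exp (- u + (- 1 - a - q))" using t by simp
        also have "\<dots> = exp (- u) * exp (- 1 - a - q)" by (rule exp_add)
        finally show "(exp 1 + 1) * exp (- t) * true_lik n \<omega> \<le> exp (- u) * (exp (- 1 - a - q) * true_lik n \<omega>)"
          using P0 by (simp add: mult_right_mono mult.assoc[symmetric])
      qed
      also have "\<dots> = ennreal (exp (- u)) * ennreal (exp (- 1 - a - q) * true_lik n \<omega>)" using P0 by (simp add: ennreal_mult)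
      also have "\<dots> \<le> ennreal (exp (- u)) * evidence p n UNIV \<omega>" using den by (rule mult_left_mono) simp
      finally have num: "evidence p n (- G) \<omega> \<le> ennreal (exp (- u)) * evidence p n UNIV \<omega>" .
      \<comment> \<open>the posterior is a probability measure, so that the mass of the complement decides\<close>
      let ?post = "post p n \<omega>"
      have U: "UNIV \<in> sets param_space" using sets.top[of param_space] by simp
      have E: "evidence p n UNIV \<omega> \<noteq> 0" "evidence p n UNIV \<omega> \<noteq> \<top>"
        using evidence_UNIV_pos[OF \<omega>, of p n] elim by auto
      have space: "space ?post = UNIV" and sets: "sets ?post = sets param_space" by (simp_all add: posterior_def)
      have "emeasure ?post UNIV = 1" unfolding emeasure_posterior[OF \<omega> U] using E mult_divide_eq_ennreal[of "evidence p n UNIV \<omega>" 1] by simp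
      then interpret post: prob_space ?post by (intro prob_spaceI) (simp add: space)
      have mG: "- G \<in> sets param_space" using sets.compl_sets[OF G(1)] by (simp add: Compl_eq_Diff_UNIV)
      have "emeasure ?post (- G) \<le> ennreal (exp (- u)) * evidence p n UNIV \<omega> / evidence p n UNIV \<omega>"
        unfolding emeasure_posterior[OF \<omega> mG] by (rule divide_right_mono_ennreal[OF num])
      also have "\<dots> = ennreal (exp (- u))" using E by (intro mult_divide_eq_ennreal) auto
      finally have "measure ?post (- G) \<le> exp (- u)" by (simp add: post.emeasure_eq_measure)
      moreover have "measure ?post (- G) = 1 - measure ?post G"
        using post.prob_compl[of G] G(1) by (simp add: space sets Compl_eq_Diff_UNIV)
      ultimately have "\<bar>measure ?post G - 1\<bar> \<le> exp (- u)" using post.prob_le_1[of G] by linarith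
      then show False using large by simp
    qed
  qed
  then show ?thesis using M.finite_measure_mono_AE[OF _ Bad_sets] Bad order_trans by blast
qed

end

section \<open>Rates\<close>

text \<open>What a dimension \<open>k\<close> used for the approximation, a dimension \<open>K\<close> of the sieve, an exponent \<open>\<Lambda>\<close> (the
  order of \<open>n\<close> times the squared rate) and a radius \<open>r\<close> have to satisfy at sample size \<open>n\<close>.\<close>

definition rate_conditions ::
  "real \<Rightarrow> real \<Rightarrow> real \<Rightarrow> real \<Rightarrow> nat pmf \<Rightarrow> nat \<Rightarrow> nat \<Rightarrow> real \<Rightarrow> real \<Rightarrow> nat \<Rightarrow> bool" where
  "rate_conditions \<gamma> A T c p k K \<Lambda> r n \<longleftrightarrow>
     1 \<le> k \<and> k \<le> K \<and> real K \<le> real n ^ 2 \<and> \<Lambda> \<le> real n powr (3/2) \<and>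
     real k * ln (real n) \<le> \<Lambda> \<and> real n * real k powr (- 2 * \<gamma>) \<le> A * \<Lambda> \<and>
     exp (- A * \<Lambda>) \<le> pmf p k \<and> measure_pmf.prob p {j. j > K} \<le> exp (- T * \<Lambda>) \<and>
     0 \<le> r \<and> T * \<Lambda> + c * real K * ln (real n) \<le> real n * r\<^sup>2"

text \<open>Both sides are zero for a divergent series. The right-hand side is visibly measurable when the
  terms depend on a parameter.\<close>

lemma infsum_eq_enn2real_suminf:
  fixes f :: "nat \<Rightarrow> real"
  assumes "\<And>l. f l \<ge> 0"
  shows "(\<Sum>\<^sub>\<infinity>l\<in>{1..}. f l) = enn2real (\<Sum>l. ennreal (f (Suc l)))"
proof -
  have re: "(\<Sum>\<^sub>\<infinity>l\<in>{1..}. f l) = (\<Sum>\<^sub>\<infinity>l\<in>UNIV. f (Suc l))"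
  proof -
    have "range Suc = {1..}" using greaterThan_0 by auto
    then show ?thesis using infsum_reindex[of Suc UNIV f] by (simp add: comp_def)
  qed
  show ?thesis
  proof (cases "summable (\<lambda>l. f (Suc l))")
    case True
    then have "(\<lambda>l. f (Suc l)) summable_on UNIV" using assms by (intro norm_summable_imp_summable_on) simp
    then have "((\<lambda>l. f (Suc l)) has_sum (\<Sum>\<^sub>\<infinity>l\<in>UNIV. f (Suc l))) UNIV" by (rule has_sum_infsum)
    then have "(\<lambda>l. f (Suc l)) sums (\<Sum>\<^sub>\<infinity>l\<in>UNIV. f (Suc l))" by (rule has_sum_imp_sums)
    then have "(\<Sum>l. f (Suc l)) = (\<Sum>\<^sub>\<infinity>l\<in>UNIV. f (Suc l))" by (simp add: sums_iff)
    then show ?thesis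
      using suminf_ennreal2[OF assms True] re suminf_nonneg[OF True assms] by simp
  next
    case False
    then have "\<not> (\<lambda>l. f (Suc l)) summable_on UNIV" using summable_on_imp_summable by blast
    then have "(\<Sum>\<^sub>\<infinity>l\<in>{1..}. f l) = 0" unfolding re by (rule infsum_not_exists)
    moreover have "(\<Sum>l. ennreal (f (Suc l))) = \<top>"
      using False summable_suminf_not_top[of "\<lambda>l. f (Suc l)"] assms by blast
    ultimately show ?thesis by simp
  qed
qed

lemma l2_dist_measurable: "(\<lambda>\<theta>. l2_dist \<theta>0 \<theta>) \<in> borel_measurable seq_space"
proof -
  have "(\<lambda>\<theta>. sqrt (enn2real (\<Sum>l. ennreal ((\<theta>0 (Suc l) - \<theta> (Suc l))\<^sup>2)))) \<in> borel_measurable seq_space"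
    by measurable
  moreover have "l2_dist \<theta>0 \<theta> = sqrt (enn2real (\<Sum>l. ennreal ((\<theta>0 (Suc l) - \<theta> (Suc l))\<^sup>2)))" for \<theta>
    unfolding l2_dist_def by (intro arg_cong[where f=sqrt] infsum_eq_enn2real_suminf) simp
  ultimately show ?thesis by (simp only:)
qed

context iid_sample
begin

lemma near_mass:
  assumes \<beta>_pstar: "pstar > 2 \<Longrightarrow> \<beta> < 1/2 + 1 / pstar"
  obtains a d where "a > 0" "d > 0" "\<And>k \<eta>. near k \<eta> \<in> sets param_space"
    "\<And>p k \<eta>. k \<ge> 1 \<Longrightarrow> 0 < \<eta> \<Longrightarrow> \<eta> \<le> sqrt \<tau>0 \<Longrightarrow>
      ennreal (pmf p k * ((a * \<eta>) ^ k * exp (- d * real k))) \<le> emeasure (prior p g \<tau>0 \<beta>) (near k \<eta>)"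
proof -
  obtain D where "\<And>k. k \<ge> 1 \<Longrightarrow> (\<Sum>l=1..k. \<bar>real l powr \<beta> * \<theta>0 l\<bar> powr pstar) \<le> D * real k"
    using weighted_coefficients_powr_sum[OF theta0_decay gamma_gt_half beta pstar \<beta>_pstar] by blast
  from emeasure_prior_near[OF this] show ?thesis using that unfolding near_def by blast
qed

text \<open>Boxes and grid cells have width \<open>1 / n ^ 4\<close>, and coefficients are cut off at \<open>n powr (2 / pstar)\<close>, where
the prior tail is \<open>exp (- c * n\<^sup>2)\<close>. Up to constants in the exponents, the prior mass is then
\<open>exp (- \<Lambda>)\<close> and the grid has \<open>exp (K * ln n)\<close> points, and all three summands of the general bound tend to zero if \<open>n * r\<^sup>2\<close> exceeds a
large multiple of \<open>\<Lambda> + K * ln n\<close>. The constants \<open>T\<close> and \<open>c\<close> do not depend on the sieve, so \<open>K\<close> can be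
chosen afterwards in such a way that the prior mass of larger dimensions is below \<open>exp (- T * \<Lambda>)\<close>.\<close>

lemma posterior_rate_bound:
  assumes \<beta>_pstar: "pstar > 2 \<Longrightarrow> \<beta> < 1/2 + 1 / pstar" and A: "A \<ge> 0"
  obtains T c h where "T > 0" "c > 0" "h \<longlonglongrightarrow> 0"
    "eventually (\<lambda>n. \<forall>p k K \<Lambda> r G. rate_conditions \<gamma> A T c p k K \<Lambda> r n \<longrightarrow> G \<in> sets param_space \<longrightarrow>
        (\<forall>s. s \<notin> G \<longrightarrow> s \<in> outside_sieve K (real n powr (2 / pstar)) \<or> s \<in> far r) \<longrightarrow>
        measure M {\<omega> \<in> space M. \<bar>measure (post p n \<omega>) G - 1\<bar> > 1 / real n} \<le> h n) sequentially"
proof -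
  obtain a d where ad: "a > 0" "d > 0" and near_sets: "\<And>k \<eta>. near k \<eta> \<in> sets param_space"
    and mass: "\<And>p k \<eta>. k \<ge> 1 \<Longrightarrow> 0 < \<eta> \<Longrightarrow> \<eta> \<le> sqrt \<tau>0 \<Longrightarrow>
      ennreal (pmf p k * ((a * \<eta>) ^ k * exp (- d * real k))) \<le> emeasure (prior p g \<tau>0 \<beta>) (near k \<eta>)"
    using near_mass[OF \<beta>_pstar] by metis
  obtain D c0 where D: "D > 0" "c0 > 0"
    and out: "\<And>p K R. R \<ge> 0 \<Longrightarrow> emeasure (prior p g \<tau>0 \<beta>) (outside_sieve K R) \<le>
      ennreal (measure_pmf.prob p {k. k > K} + real K * D * exp (- c0 * R powr pstar))"
    using outside_sieve_prior by metis
  \<comment> \<open>\<open>T0 * \<Lambda>\<close> is the exponent \<open>t\<close> of the general bound: \<open>chi_const * A + 1\<close> for the projection, \<open>A + 5\<close> for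
     the prior mass, and \<open>2\<close> for the remaining terms, which are at most \<open>\<Lambda>\<close> each.\<close>
  define T0 where "T0 = chi_const * A + A + 8"
  define T where "T = T0 + 2"
  \<comment> \<open>a grid has at most \<open>(K + 1) * (n powr (2 / pstar + 6)) ^ K\<close> points, and \<open>K + 1\<close> is at most \<open>n ^ 3\<close>\<close>
  define c1 where "c1 = 2 / pstar + 9"
  define h where "h n = 3 / real n + real n ^ 2 * D * exp (T0 * real n powr (3/2) - c0 * real n ^ 2)" for n :: nat
  have T0: "T0 \<ge> 8" using A chi_const_nonneg by (simp add: T0_def)
  have h: "h \<longlonglongrightarrow> 0" unfolding h_def using D by real_asymp
  have large: "eventually (\<lambda>n. n \<ge> 1 \<and> real n \<ge> 3 \<and> ln (real n) \<ge> 3 \<and> ln (real n) \<ge> d - ln a \<and>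
      2 * real n * (1 / real n ^ 4) * real n ^ 2 * sqrt (2 * B) \<le> 1 \<and> 1 / real n ^ 4 \<le> sqrt \<tau>0 \<and>
      2 * (real n powr (2 / pstar)) * real n ^ 4 + 2 \<le> real n powr (2 / pstar + 6) \<and> real n ^ 2 + 1 \<le> real n ^ 3) sequentially"
  proof (intro eventually_conj)
    show "eventually (\<lambda>n. 1 / real n ^ 4 \<le> sqrt \<tau>0) sequentially" using tau0 by real_asymp
    show "eventually (\<lambda>n. 2 * (real n powr (2 / pstar)) * real n ^ 4 + 2 \<le> real n powr (2 / pstar + 6)) sequentially"
    proof -
      have "eventually (\<lambda>n. 2 * (real n powr x) * real n ^ 4 + 2 \<le> real n powr (x + 6)) sequentially" if "x > 0" for x
        using that by real_asymp
      then show ?thesis using pstar by simp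
    qed
  qed real_asymp+
  show ?thesis
  proof (rule that[of T "2 * c1" h])
    show "T > 0" "2 * c1 > 0" using T0 pstar by (auto simp: T_def c1_def add_pos_pos)
    show "h \<longlonglongrightarrow> 0" by (rule h)
    show "eventually (\<lambda>n. \<forall>p k K \<Lambda> r G. rate_conditions \<gamma> A T (2 * c1) p k K \<Lambda> r n \<longrightarrow> G \<in> sets param_space \<longrightarrow>
        (\<forall>s. s \<notin> G \<longrightarrow> s \<in> outside_sieve K (real n powr (2 / pstar)) \<or> s \<in> far r) \<longrightarrow>
        measure M {\<omega> \<in> space M. \<bar>measure (post p n \<omega>) G - 1\<bar> > 1 / real n} \<le> h n) sequentially"
      using large
    proof (rule eventually_mono, intro allI impI)
      fix n p k K \<Lambda> r G
      assume n: "n \<ge> 1 \<and> real n \<ge> 3 \<and> ln (real n) \<ge> 3 \<and> ln (real n) \<ge> d - ln a \<and>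
        2 * real n * (1 / real n ^ 4) * real n ^ 2 * sqrt (2 * B) \<le> 1 \<and> 1 / real n ^ 4 \<le> sqrt \<tau>0 \<and>
        2 * (real n powr (2 / pstar)) * real n ^ 4 + 2 \<le> real n powr (2 / pstar + 6) \<and> real n ^ 2 + 1 \<le> real n ^ 3"
        and rc: "rate_conditions \<gamma> A T (2 * c1) p k K \<Lambda> r n" and G: "G \<in> sets param_space"
        "\<forall>s. s \<notin> G \<longrightarrow> s \<in> outside_sieve K (real n powr (2 / pstar)) \<or> s \<in> far r"
      let ?ln = "ln (real n)"
      define \<eta> where "\<eta> = 1 / real n ^ 4"
      define R where "R = real n powr (2 / pstar)"
      have n0: "real n > 0" using n by linarith
      have k: "1 \<le> k" "k \<le> K" and K: "real K \<le> real n ^ 2" and \<Lambda>: "\<Lambda> \<le> real n powr (3/2)" "real k * ?ln \<le> \<Lambda>"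
        and bias: "real n * real k powr (- 2 * \<gamma>) \<le> A * \<Lambda>" and pk: "exp (- A * \<Lambda>) \<le> pmf p k"
        and tail: "measure_pmf.prob p {j. j > K} \<le> exp (- T * \<Lambda>)"
        and r: "0 \<le> r" "T * \<Lambda> + 2 * c1 * real K * ?ln \<le> real n * r\<^sup>2"
        using rc unfolding rate_conditions_def by auto
      have ln_le: "?ln \<le> \<Lambda>"
      proof -
        have "1 * ?ln \<le> real k * ?ln" using k n by (intro mult_right_mono) auto
        then show ?thesis using \<Lambda>(2) by linarith
      qed
      then have \<Lambda>3: "\<Lambda> \<ge> 3" using n by linarith
      have exp_ln: "exp (- ?ln) = 1 / real n" using n0 by (simp add: exp_minus inverse_eq_divide)
      have exp_\<Lambda>: "exp (- \<Lambda>) \<le> 1 / real n" using ln_le exp_ln by (metis exp_le_cancel_iff neg_le_iff_le)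
      \<comment> \<open>every coordinate costs at most \<open>5 * ln n\<close>: four for the width, and one for all constants\<close>
      have "exp (- (A + 5) * \<Lambda>) \<le> pmf p k * ((a * \<eta>) ^ k * exp (- d * real k))"
      proof -
        have "a * \<eta> = exp (ln a - 4 * ?ln)"
          using ad n0 by (simp add: \<eta>_def exp_diff exp_of_nat_mult[of 4 "ln (real n)", simplified])
        then have "(a * \<eta>) ^ k * exp (- d * real k) = exp (real k * (ln a - 4 * ?ln) + - d * real k)"
          by (simp add: exp_of_nat_mult[symmetric] exp_add[symmetric])
        moreover have "real k * (ln a - 4 * ?ln) + - d * real k \<ge> - 5 * \<Lambda>"
        proof -
          have "real k * (d - ln a) \<le> real k * ?ln" using n by (intro mult_left_mono) auto
          then show ?thesis using \<Lambda>(2) by (simp add: algebra_simps)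
        qed
        ultimately have "exp (- 5 * \<Lambda>) \<le> (a * \<eta>) ^ k * exp (- d * real k)" by simp
        then have "exp (- A * \<Lambda>) * exp (- 5 * \<Lambda>) \<le> pmf p k * ((a * \<eta>) ^ k * exp (- d * real k))"
          using pk by (intro mult_mono) auto
        then show ?thesis by (simp add: exp_add[symmetric] algebra_simps)
      qed
      then have "ennreal (exp (- (A + 5) * \<Lambda>)) \<le> ennreal (pmf p k * ((a * \<eta>) ^ k * exp (- d * real k)))" by (rule ennreal_leI)
      also have "\<dots> \<le> emeasure (prior p g \<tau>0 \<beta>) (near k \<eta>)"
        using n0 n by (intro mass k(1)) (auto simp: \<eta>_def)
      finally have near_mass: "ennreal (exp (- ((A + 5) * \<Lambda>))) \<le> emeasure (prior p g \<tau>0 \<beta>) (near k \<eta>)"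
        unfolding mult_minus_left .
      have small: "2 * real n * \<eta> * real K * sqrt (2 * B) \<le> 1"
      proof -
        have "2 * real n * \<eta> * real K * sqrt (2 * B) \<le> 2 * real n * \<eta> * real n ^ 2 * sqrt (2 * B)"
          using K B_nonneg by (intro mult_right_mono mult_left_mono) (auto simp: \<eta>_def)
        then show ?thesis using n unfolding \<eta>_def by linarith
      qed
      let ?e = "measure_pmf.prob p {j. j > K} + real K * D * exp (- c0 * R powr pstar)"
      have bound: "measure M {\<omega> \<in> space M. \<bar>measure (post p n \<omega>) G - 1\<bar> > exp (- ?ln)} \<le>
          exp (real n * (chi_const * real k powr (- 2 * \<gamma>)) - (chi_const * A + 1) * \<Lambda>) +
          (real K + 1) * (2 * R / \<eta> + 2) ^ K * exp (T0 * \<Lambda> / 2 - real n * r\<^sup>2 / 2) + exp (T0 * \<Lambda>) * ?e"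
      proof (rule posterior_concentration_bound[OF k _ r(1) _ small near_mass near_sets _ G(1)])
        show "(chi_const * A + 1) * \<Lambda> + (A + 5) * \<Lambda> + 3 + ?ln \<le> T0 * \<Lambda>"
          using \<Lambda>3 ln_le by (simp add: T0_def algebra_simps)
        show "\<And>s. s \<notin> G \<Longrightarrow> s \<in> outside_sieve K R \<or> s \<in> far r" using G(2) unfolding R_def by blast
        show "emeasure (prior p g \<tau>0 \<beta>) (outside_sieve K R) \<le> ennreal ?e" by (rule out) (simp add: R_def)
        show "0 \<le> ?e" using D by simp
      qed (use n0 in \<open>auto simp: R_def \<eta>_def\<close>)
      also have "\<dots> \<le> 1 / real n + 1 / real n + (1 / real n + real n ^ 2 * D * exp (T0 * real n powr (3/2) - c0 * real n ^ 2))"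
      proof (intro add_mono)
        have "chi_const * (real n * real k powr (- 2 * \<gamma>)) \<le> chi_const * (A * \<Lambda>)"
          using bias chi_const_nonneg by (rule mult_left_mono)
        then have "real n * (chi_const * real k powr (- 2 * \<gamma>)) - (chi_const * A + 1) * \<Lambda> \<le> - \<Lambda>" by (simp add: algebra_simps)
        then show "exp (real n * (chi_const * real k powr (- 2 * \<gamma>)) - (chi_const * A + 1) * \<Lambda>) \<le> 1 / real n"
          using exp_\<Lambda> by (meson exp_le_cancel_iff order_trans)
      next
        have K1: "K \<ge> 1" using k by linarith
        have "2 * R / \<eta> + 2 \<le> exp ((2 / pstar + 6) * ?ln)"
          using n n0 by (simp add: R_def \<eta>_def powr_def)
        then have "(2 * R / \<eta> + 2) ^ K \<le> exp ((2 / pstar + 6) * ?ln) ^ K"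
          by (intro power_mono) (auto simp: R_def \<eta>_def)
        also have "\<dots> = exp (real K * ((2 / pstar + 6) * ?ln))" by (rule exp_of_nat_mult[symmetric])
        finally have e1: "(2 * R / \<eta> + 2) ^ K \<le> exp (real K * ((2 / pstar + 6) * ?ln))" .
        have "real K + 1 \<le> real n ^ 3" using K n by linarith
        also have "\<dots> = exp (3 * ?ln)" using n0 by (simp add: exp_of_nat_mult[of 3 "ln (real n)", simplified])
        also have "\<dots> \<le> exp (real K * (3 * ?ln))" using K1 n by (simp add: mult_le_cancel_right1)
        finally have e2: "real K + 1 \<le> exp (real K * (3 * ?ln))" .
        have "(real K + 1) * (2 * R / \<eta> + 2) ^ K \<le> exp (real K * (3 * ?ln)) * exp (real K * ((2 / pstar + 6) * ?ln))"
          using e1 e2 by (intro mult_mono) (auto simp: R_def \<eta>_def)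
        also have "\<dots> = exp (c1 * real K * ?ln)" by (simp add: exp_add[symmetric] c1_def algebra_simps)
        finally have "(real K + 1) * (2 * R / \<eta> + 2) ^ K * exp (T0 * \<Lambda> / 2 - real n * r\<^sup>2 / 2) \<le>
            exp (c1 * real K * ?ln) * exp (T0 * \<Lambda> / 2 - real n * r\<^sup>2 / 2)"
          by (rule mult_right_mono) simp
        also have "\<dots> = exp (c1 * real K * ?ln + (T0 * \<Lambda> / 2 - real n * r\<^sup>2 / 2))" by (simp add: exp_add[symmetric])
        also have "\<dots> \<le> exp (- \<Lambda>)" using r(2) by (simp add: T_def algebra_simps)
        finally show "(real K + 1) * (2 * R / \<eta> + 2) ^ K * exp (T0 * \<Lambda> / 2 - real n * r\<^sup>2 / 2) \<le> 1 / real n"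
          using exp_\<Lambda> by linarith
      next
        have "R powr pstar = real n ^ 2"
          using pstar n0 by (simp add: R_def powr_powr powr_numeral)
        then have "real K * D * exp (- c0 * R powr pstar) \<le> real n ^ 2 * D * exp (- c0 * real n ^ 2)"
          using K D by (auto intro!: mult_right_mono)
        then have "exp (T0 * \<Lambda>) * ?e \<le> exp (T0 * \<Lambda>) * (exp (- T * \<Lambda>) + real n ^ 2 * D * exp (- c0 * real n ^ 2))"
          using tail by (intro mult_left_mono) auto
        also have "\<dots> = exp (- 2 * \<Lambda>) + real n ^ 2 * D * (exp (T0 * \<Lambda>) * exp (- c0 * real n ^ 2))"
        proof -
          have "exp (T0 * \<Lambda>) * exp (- T * \<Lambda>) = exp (- 2 * \<Lambda>)"
            unfolding exp_add[symmetric] by (simp add: T_def algebra_simps)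
          then show ?thesis by (simp add: distrib_left)
        qed
        also have "\<dots> \<le> 1 / real n + real n ^ 2 * D * exp (T0 * real n powr (3/2) - c0 * real n ^ 2)"
        proof (intro add_mono mult_left_mono)
          have "exp (- 2 * \<Lambda>) \<le> exp (- \<Lambda>)" using \<Lambda>3 by simp
          then show "exp (- 2 * \<Lambda>) \<le> 1 / real n" using exp_\<Lambda> by linarith
          have "T0 * \<Lambda> \<le> T0 * real n powr (3/2)" using \<Lambda>(1) T0 by (intro mult_left_mono) auto
          then show "exp (T0 * \<Lambda>) * exp (- c0 * real n ^ 2) \<le> exp (T0 * real n powr (3/2) - c0 * real n ^ 2)"
            by (simp add: exp_add[symmetric])
        qed (use D in auto)
        finally show "exp (T0 * \<Lambda>) * ?e \<le> 1 / real n + real n ^ 2 * D * exp (T0 * real n powr (3/2) - c0 * real n ^ 2)" .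
      qed
      also have "\<dots> = h n" by (simp add: h_def)
      finally show "measure M {\<omega> \<in> space M. \<bar>measure (post p n \<omega>) G - 1\<bar> > 1 / real n} \<le> h n"
        unfolding exp_ln .
    qed
  qed
qed

abbreviation concentrates :: "(nat \<Rightarrow> nat pmf) \<Rightarrow> (nat \<Rightarrow> real) \<Rightarrow> (nat \<Rightarrow> real) \<Rightarrow> bool" where
  "concentrates pk r \<rho> \<equiv>
     tendsto_in_prob M (\<lambda>n \<omega>. measure (post (pk n) n \<omega>)
         {(k, \<theta>). hellinger f0 (model_density \<phi> k \<theta>) \<le> r n}) 1 \<and>
     tendsto_in_prob M (\<lambda>n \<omega>. measure (post (pk n) n \<omega>)
         {(k, \<theta>). l2_dist \<theta>0 \<theta> \<le> \<rho> n}) 1"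

text \<open>On the sieve the \<open>l2\<close> distance is at most a constant times the Hellinger distance, provided that
\<open>sqrt K * r\<close> tends to zero; hence both concentration statements rest on the same exceptional set.\<close>

theorem posterior_rates:
  assumes \<beta>_pstar: "pstar > 2 \<Longrightarrow> \<beta> < 1/2 + 1 / pstar" and A: "A \<ge> 0"
  obtains T c where "T > 0" "c > 0"
    "\<forall>pk k K \<Lambda> r \<rho>. eventually (\<lambda>n. rate_conditions \<gamma> A T c (pk n) (k n) (K n) (\<Lambda> n) (r n) n) sequentially \<longrightarrow>
       (\<lambda>n. real (K n) * (r n)\<^sup>2) \<longlonglongrightarrow> 0 \<longrightarrow> eventually (\<lambda>n. l2_const * r n \<le> \<rho> n) sequentially \<longrightarrow>
       concentrates pk r \<rho>"
proof -
  obtain T c h where T: "T > 0" "c > 0" and h: "h \<longlonglongrightarrow> 0" and ev: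
    "eventually (\<lambda>n. \<forall>p k K \<Lambda> r G. rate_conditions \<gamma> A T c p k K \<Lambda> r n \<longrightarrow> G \<in> sets param_space \<longrightarrow>
        (\<forall>s. s \<notin> G \<longrightarrow> s \<in> outside_sieve K (real n powr (2 / pstar)) \<or> s \<in> far r) \<longrightarrow>
        measure M {\<omega> \<in> space M. \<bar>measure (post p n \<omega>) G - 1\<bar> > 1 / real n} \<le> h n) sequentially"
    by (rule posterior_rate_bound[OF \<beta>_pstar A]) (assumption, (rule that; assumption))
  have conv: "tendsto_in_prob M (\<lambda>n \<omega>. measure (post (pk n) n \<omega>) (G n)) 1"
    if rc: "eventually (\<lambda>n. rate_conditions \<gamma> A T c (pk n) (k n) (K n) (\<Lambda> n) (r n) n) sequentially"
      and G: "\<And>n. G n \<in> sets param_space"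
      and sub: "eventually (\<lambda>n. \<forall>s. s \<notin> G n \<longrightarrow> s \<in> outside_sieve (K n) (real n powr (2 / pstar)) \<or> s \<in> far (r n)) sequentially"
    for pk k K \<Lambda> r G
    unfolding tendsto_in_prob_def
  proof (intro conjI allI impI)
    fix n show "(\<lambda>\<omega>. measure (post (pk n) n \<omega>) (G n)) \<in> borel_measurable M"
      by (rule posterior_measurable[OF G])
  next
    fix \<delta> :: real assume \<delta>: "\<delta> > 0"
    let ?Y = "\<lambda>n \<omega>. measure (post (pk n) n \<omega>) (G n)"
    have "eventually (\<lambda>n. 1 / real n < \<delta>) sequentially" using \<delta> by real_asymp
    with rc sub ev have "eventually (\<lambda>n. measure M {\<omega> \<in> space M. \<bar>?Y n \<omega> - 1\<bar> > \<delta>} \<le> h n) sequentially"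
    proof eventually_elim
      case (elim n)
      note [measurable] = posterior_measurable[OF G, of "pk n" n n]
      have "measure M {\<omega> \<in> space M. \<bar>?Y n \<omega> - 1\<bar> > \<delta>} \<le> measure M {\<omega> \<in> space M. \<bar>?Y n \<omega> - 1\<bar> > 1 / real n}"
        using elim(4) by (intro M.finite_measure_mono) auto
      also have "\<dots> \<le> h n" using elim(1-3) G[of n] by blast
      finally show ?case .
    qed
    then show "(\<lambda>n. measure M {\<omega> \<in> space M. \<bar>?Y n \<omega> - 1\<bar> > \<delta>}) \<longlonglongrightarrow> 0"
      by (intro tendsto_sandwich[OF _ _ tendsto_const h]) auto
  qed
  show ?thesis
  proof (rule that[OF T], intro allI impI conjI)
    fix pk and k K :: "nat \<Rightarrow> nat" and \<Lambda> r \<rho> :: "nat \<Rightarrow> real"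
    assume rc: "eventually (\<lambda>n. rate_conditions \<gamma> A T c (pk n) (k n) (K n) (\<Lambda> n) (r n) n) sequentially"
      and Kr: "(\<lambda>n. real (K n) * (r n)\<^sup>2) \<longlonglongrightarrow> 0" and \<rho>: "eventually (\<lambda>n. l2_const * r n \<le> \<rho> n) sequentially"
    show "tendsto_in_prob M (\<lambda>n \<omega>. measure (post (pk n) n \<omega>)
         {(k, \<theta>). hellinger f0 (model_density \<phi> k \<theta>) \<le> r n}) 1"
    proof (rule conv[OF rc])
      show "{(k, \<theta>). hellinger f0 (model_density \<phi> k \<theta>) \<le> r n} \<in> sets param_space" for n
      proof -
        have "{(k, \<theta>). hellinger f0 (model_density \<phi> k \<theta>) \<le> r n} = space param_space - far (r n)"
          by (auto simp: far_def)
        then show ?thesis by (metis far_sets sets.compl_sets)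
      qed
    qed (auto simp: far_def not_le)
    show "tendsto_in_prob M (\<lambda>n \<omega>. measure (post (pk n) n \<omega>)
         {(k, \<theta>). l2_dist \<theta>0 \<theta> \<le> \<rho> n}) 1"
    proof (rule conv[OF rc])
      show "{(k :: nat, \<theta>). l2_dist \<theta>0 \<theta> \<le> \<rho> n} \<in> sets param_space" for n
      proof (rule sets_param_spaceI)
        fix k :: nat
        note [measurable] = l2_dist_measurable[of \<theta>0]
        have "{\<theta> \<in> space seq_space. l2_dist \<theta>0 \<theta> \<le> \<rho> n} \<in> sets seq_space" by measurable
        then show "{\<theta>. (k, \<theta>) \<in> {(k :: nat, \<theta>). l2_dist \<theta>0 \<theta> \<le> \<rho> n}} \<in> sets seq_space" by (simp add: space_PiM)
      qed
      have "(\<lambda>n. 4 * exp (b / 2) * sqrt (2 * B) * sqrt (real (K n) * (r n)\<^sup>2)) \<longlonglongrightarrow> 4 * exp (b / 2) * sqrt (2 * B) * sqrt 0"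
        by (intro tendsto_intros Kr)
      then have "eventually (\<lambda>n. 4 * exp (b / 2) * sqrt (2 * B) * sqrt (real (K n) * (r n)\<^sup>2) < 1) sequentially"
        by (rule order_tendstoD) simp
      with rc \<rho> show "eventually (\<lambda>n. \<forall>s. s \<notin> {(k :: nat, \<theta>). l2_dist \<theta>0 \<theta> \<le> \<rho> n} \<longrightarrow>
          s \<in> outside_sieve (K n) (real n powr (2 / pstar)) \<or> s \<in> far (r n)) sequentially"
      proof eventually_elim
        case (elim n)
        have r0: "r n \<ge> 0" using elim(1) by (simp add: rate_conditions_def)
        have "l2_dist \<theta>0 \<theta> \<le> \<rho> n" if "(k', \<theta>) \<notin> outside_sieve (K n) (real n powr (2 / pstar))" "(k', \<theta>) \<notin> far (r n)" for k' \<theta>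
        proof -
          have k': "k' \<le> K n" and supp: "\<And>l. l \<notin> {1..k'} \<Longrightarrow> \<theta> l = 0"
            using that(1) by (auto simp: outside_sieve_def not_less)
          have hr: "hellinger f0 (model_density \<phi> k' \<theta>) \<le> r n" using that(2) by (simp add: far_def)
          have "4 * exp (b / 2) * sqrt (2 * B * real (K n)) * hellinger f0 (model_density \<phi> k' \<theta>) \<le> 4 * exp (b / 2) * sqrt (2 * B * real (K n)) * r n"
            using B_nonneg by (intro mult_left_mono hr) auto
          also have "\<dots> = 4 * exp (b / 2) * sqrt (2 * B) * sqrt (real (K n) * (r n)\<^sup>2)"
            using r0 by (simp add: real_sqrt_mult)
          finally have "4 * exp (b / 2) * sqrt (2 * B * real (K n)) * hellinger f0 (model_density \<phi> k' \<theta>) \<le> 1"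
            using elim(3) by linarith
          from l2_dist_le_hellinger[OF k' supp this]
          have "l2_dist \<theta>0 \<theta> \<le> l2_const * hellinger f0 (model_density \<phi> k' \<theta>)" .
          also have "\<dots> \<le> l2_const * r n" using l2_const_pos by (intro mult_left_mono hr) auto
          finally show ?thesis using elim(2) by linarith
        qed
        then show ?case by auto
      qed
    qed
  qed
qed

end

lemma pmf_geometric_tail:
  fixes p :: "nat pmf"
  assumes s: "s \<ge> s0" "s0 > 0" and p: "\<And>k. k > K \<Longrightarrow> pmf p k \<le> exp (- s * real k)"
  shows "measure_pmf.prob p {k. k > K} \<le> exp (- s * real K) * (1 / (1 - exp (- s0)))"
proof -
  define q where "q = exp (- s0)"
  have q: "0 < q" "q < 1" using s by (auto simp: q_def)
  have "(\<lambda>i. measure_pmf.prob p {Suc K + i}) sums measure_pmf.prob p (\<Union>i. {Suc K + i})"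
    by (rule measure_pmf.finite_measure_UNION) (auto simp: disjoint_family_on_def)
  moreover have "(\<Union>i. {Suc K + i}) = {k. k > K}"
  proof (intro equalityI subsetI)
    fix k assume "k \<in> {k. k > K}"
    then have "k = Suc K + (k - Suc K)" by simp
    then show "k \<in> (\<Union>i. {Suc K + i})" by blast
  qed auto
  ultimately have 1: "(\<lambda>i. pmf p (Suc K + i)) sums measure_pmf.prob p {k. k > K}"
    by (simp add: measure_pmf_single)
  have 2: "(\<lambda>i. exp (- s * real K) * q ^ i) sums (exp (- s * real K) * (1 / (1 - q)))"
    using q by (intro sums_mult geometric_sums) auto
  have 3: "pmf p (Suc K + i) \<le> exp (- s * real K) * q ^ i" for i
  proof -
    have "pmf p (Suc K + i) \<le> exp (- s * real (Suc K + i))" by (rule p) simp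
    also have "\<dots> \<le> exp (- s * real K + real i * (- s0))"
    proof -
      have "real i * s0 \<le> real i * s" using s by (intro mult_left_mono) auto
      then show ?thesis using s by (simp add: algebra_simps)
    qed
    also have "\<dots> = exp (- s * real K) * q ^ i" unfolding exp_add exp_of_nat_mult q_def ..
    finally show ?thesis .
  qed
  show ?thesis using sums_le[OF 3 1 2] by (simp add: q_def)
qed

context iid_sample
begin

text \<open>The squared bias \<open>k powr (- 2 * \<gamma>)\<close> and the complexity \<open>k * ln n / n\<close> balance at
\<open>k = (n / ln n) powr (1 / (2 * \<gamma> + 1))\<close>. The prior has to give dimensions above \<open>K\<close> a mass below
\<open>exp (- T * k * ln n)\<close>; as its tail is \<open>exp (- c2 * K * L K)\<close>, this forces \<open>K\<close> to be of the order
\<open>k * ln n / L n\<close>, and the complexity of the sieve exceeds that of the best dimension by the factor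
\<open>ln n / L n\<close>. Since \<open>\<gamma> > 1/2\<close>, the product of \<open>K\<close> and the squared rate tends to zero polynomially.\<close>

theorem rates_PH:
  assumes \<beta>_pstar: "pstar > 2 \<Longrightarrow> \<beta> < 1/2 + 1 / pstar" and PH: "case_PH pk L"
  shows "\<exists>E>0. \<forall>\<epsilon>0\<ge>E.
     concentrates pk (\<lambda>n. ln (real n) / L (real n) * (\<epsilon>0 * rate_PH \<gamma> n))
       (\<lambda>n. (ln (real n))\<^sup>2 / L (real n) * (\<epsilon>0 * rate_PH \<gamma> n))"
proof -
  obtain p k0 c1 c2 where p: "\<And>n. pk n = p" and L: "L = (\<lambda>_. 1) \<and> k0 = 1 \<or> L = ln \<and> k0 = (2::nat)"
    and c: "c1 > 0" "c2 > 0" "\<And>k. k \<ge> k0 \<Longrightarrow> exp (- c1 * real k * L (real k)) \<le> pmf p k"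
      "\<And>k. k \<ge> k0 \<Longrightarrow> pmf p k \<le> exp (- c2 * real k * L (real k))"
    using PH unfolding case_PH_def by blast
  define w where "w = 1 / (2 * \<gamma> + 1)"
  have w: "0 < w" "w < 1/2" "1 - 2 * \<gamma> * w = w" using gamma_gt_half by (auto simp: w_def field_simps)
  define a where "a n = (real n / ln (real n)) powr w" for n
  define kn where "kn n = nat \<lceil>a n\<rceil>" for n
  define \<Lambda> where "\<Lambda> n = real (kn n) * ln (real n)" for n
  obtain T c' where T: "T > 0" "c' > 0" and rates:
    "\<forall>pk k K \<Lambda> r \<rho>. eventually (\<lambda>n. rate_conditions \<gamma> (1 + c1) T c' (pk n) (k n) (K n) (\<Lambda> n) (r n) n) sequentially \<longrightarrow>
       (\<lambda>n. real (K n) * (r n)\<^sup>2) \<longlonglongrightarrow> 0 \<longrightarrow> eventually (\<lambda>n. l2_const * r n \<le> \<rho> n) sequentially \<longrightarrow>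
       concentrates pk r \<rho>"
    by (rule posterior_rates[OF \<beta>_pstar, of "1 + c1"]) (assumption, use c(1) in simp, (rule that; assumption))
  \<comment> \<open>\<open>w / 2\<close> is a lower bound for the ratio \<open>L K / L n\<close>, because \<open>K\<close> is at least \<open>n powr (w / 2)\<close>\<close>
  define C5 where "C5 = 1 + (T + 1) / (c2 * (w / 2))"
  have C5: "C5 \<ge> 1" "c2 * (w / 2) * C5 \<ge> T + 1" using T c w by (auto simp: C5_def field_simps)
  define K where "K n = nat \<lceil>C5 * \<Lambda> n / L (real n)\<rceil>" for n
  define D0 where "D0 = 1 / (1 - exp (- (c2 * ln 2)))"
  define E where "E = 1 + 2 * (T + c' * (C5 + 1))"
  have E1: "E \<ge> 1" using T C5 by (simp add: E_def)
  have large: "eventually (\<lambda>n. real n \<ge> 3 \<and> ln (real n) \<ge> 1 \<and> real n powr (1/2) \<le> real n / ln (real n) \<and>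
      2 \<le> real n powr (w / 2) \<and> 2 * real n powr w \<le> real n \<and> C5 * (2 * real n powr w * ln (real n)) + 1 \<le> real n ^ 2 \<and>
      2 * real n powr w * ln (real n) \<le> real n powr (3/2) \<and> D0 \<le> real n \<and> l2_const \<le> ln (real n)) sequentially"
  proof (intro eventually_conj)
    show "eventually (\<lambda>n. 2 \<le> real n powr (w / 2)) sequentially" using w by real_asymp
    show "eventually (\<lambda>n. 2 * real n powr w \<le> real n) sequentially" using w by real_asymp
    show "eventually (\<lambda>n. C5 * (2 * real n powr w * ln (real n)) + 1 \<le> real n ^ 2) sequentially" using w C5 by real_asymp
    show "eventually (\<lambda>n. 2 * real n powr w * ln (real n) \<le> real n powr (3/2)) sequentially" using w by real_asymp
  qed real_asymp+
  have basic: "eventually (\<lambda>n. real n \<ge> 3 \<and> ln (real n) \<ge> 1 \<and> D0 \<le> real n \<and> l2_const \<le> ln (real n) \<and>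
      real n powr (w / 2) \<le> a n \<and> 2 \<le> a n \<and> a n \<le> real n powr w \<and> a n \<le> real (kn n) \<and> real (kn n) \<le> 2 * a n \<and> kn n \<le> n \<and>
      \<Lambda> n \<le> real n powr (3/2) \<and> ln (real n) \<le> \<Lambda> n \<and>
      1 \<le> L (real n) \<and> L (real n) \<le> ln (real n) \<and> real (K n) \<le> C5 * \<Lambda> n / L (real n) + 1 \<and> C5 * \<Lambda> n \<le> real (K n) * L (real n) \<and>
      kn n \<le> K n \<and> real (K n) \<le> C5 * (2 * real n powr w * ln (real n)) + 1 \<and> real (K n) \<le> real n ^ 2) sequentially"
    using large
  proof eventually_elim
    case (elim n)
    have n0: "real n > 0" and l0: "ln (real n) > 0" using elim by linarith+
    have "(real n powr (1/2)) powr w \<le> a n" unfolding a_def using elim w by (intro powr_mono2) auto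
    then have a1: "real n powr (w / 2) \<le> a n" by (simp add: powr_powr)
    then have a2: "2 \<le> a n" using elim by linarith
    have "real n / ln (real n) \<le> real n / 1" using elim n0 by (intro divide_left_mono) auto
    then have a3: "a n \<le> real n powr w" unfolding a_def using w n0 l0 by (intro powr_mono2) auto
    have k1: "a n \<le> real (kn n)" "real (kn n) \<le> a n + 1" using a2 unfolding kn_def by linarith+
    have k2: "real (kn n) \<le> 2 * a n" using k1 a2 by linarith
    have "real (kn n) \<le> real n" using k2 a3 elim by linarith
    then have k3: "kn n \<le> n" by simp
    have L1: "1 \<le> L (real n)" "L (real n) \<le> ln (real n)" using L elim by auto
    have \<Lambda>1: "\<Lambda> n \<le> 2 * real n powr w * ln (real n)"
      unfolding \<Lambda>_def using k2 a3 l0 by (intro mult_right_mono) auto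
    have "1 * ln (real n) \<le> \<Lambda> n" unfolding \<Lambda>_def using k1 a2 l0 by (intro mult_right_mono) auto
    then have \<Lambda>2: "ln (real n) \<le> \<Lambda> n" by simp
    define z where "z = C5 * \<Lambda> n / L (real n)"
    have z0: "z \<ge> 0" using C5 \<Lambda>2 l0 L1 by (simp add: z_def)
    have K1: "real (K n) \<le> z + 1" "z \<le> real (K n)" unfolding K_def z_def[symmetric] using z0 by linarith+
    have K2: "C5 * \<Lambda> n \<le> real (K n) * L (real n)"
      using K1(2) L1 unfolding z_def by (simp add: divide_le_eq)
    have "real (kn n) * L (real n) \<le> \<Lambda> n" unfolding \<Lambda>_def using L1 by (intro mult_left_mono) auto
    also have "\<dots> \<le> C5 * \<Lambda> n" using C5 \<Lambda>2 l0 by (simp add: mult_le_cancel_right1)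
    finally have "real (kn n) \<le> z" using L1 unfolding z_def by (simp add: le_divide_eq)
    then have K3: "kn n \<le> K n" using K1(2) by linarith
    have "z \<le> C5 * \<Lambda> n / 1" unfolding z_def using L1 C5 \<Lambda>2 l0 by (intro divide_left_mono) auto
    then have "z \<le> C5 * (2 * real n powr w * ln (real n))"
      using \<Lambda>1 C5 by (simp add: mult_left_mono order_trans)
    then have K4: "real (K n) \<le> C5 * (2 * real n powr w * ln (real n)) + 1" using K1 by linarith
    show ?case
      using elim a1 a2 a3 k1 k2 k3 L1 \<Lambda>1 \<Lambda>2 K1(1) K2 K3 K4 unfolding z_def by linarith
  qed
  have rate_sq: "real n * (rate_PH \<gamma> n)\<^sup>2 = a n * ln (real n)" "real n * a n powr (- 2 * \<gamma>) = a n * ln (real n)" if "real n \<ge> 3" "ln (real n) \<ge> 1" for n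
  proof -
    define y where "y = real n / ln (real n)"
    have l0: "ln (real n) > 0" using that by linarith
    then have y: "y > 0" "real n = y * ln (real n)" using that by (auto simp: y_def)
    have "rate_PH \<gamma> n = y powr (- (\<gamma> * w))"
      unfolding rate_PH_def y_def powr_minus using that l0 by (simp add: w_def powr_divide field_simps)
    then have "(rate_PH \<gamma> n)\<^sup>2 = y powr (- 2 * \<gamma> * w)"
      by (simp add: power2_eq_square powr_add[symmetric] mult.assoc)
    moreover have "a n powr (- 2 * \<gamma>) = y powr (- 2 * \<gamma> * w)"
      by (simp add: a_def y_def[symmetric] powr_powr algebra_simps)
    moreover have "real n * y powr (- 2 * \<gamma> * w) = a n * ln (real n)"
    proof -
      have "real n * y powr (- 2 * \<gamma> * w) = (y powr 1 * y powr (- 2 * \<gamma> * w)) * ln (real n)"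
        using y by (subst y(2)) simp
      also have "y powr 1 * y powr (- 2 * \<gamma> * w) = y powr w"
      proof -
        have "1 + - 2 * \<gamma> * w = w" using w(3) by linarith
        then show ?thesis unfolding powr_add[symmetric] by (simp only:)
      qed
      finally show ?thesis by (simp add: a_def y_def)
    qed
    ultimately show "real n * (rate_PH \<gamma> n)\<^sup>2 = a n * ln (real n)" "real n * a n powr (- 2 * \<gamma>) = a n * ln (real n)" by simp_all
  qed
  show ?thesis
  proof (intro exI[of _ E] conjI[of "E > 0"] allI impI)
    show "E > 0" using E1 by linarith
    fix \<epsilon>0 assume \<epsilon>0: "\<epsilon>0 \<ge> E"
    define r where "r n = ln (real n) / L (real n) * (\<epsilon>0 * rate_PH \<gamma> n)" for n
    have r_sq: "real n * (r n)\<^sup>2 = (ln (real n) / L (real n))\<^sup>2 * \<epsilon>0\<^sup>2 * (a n * ln (real n))" if "real n \<ge> 3" "ln (real n) \<ge> 1" for n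
      unfolding r_def power_mult_distrib rate_sq(1)[OF that, symmetric] by simp
    have rc: "eventually (\<lambda>n. rate_conditions \<gamma> (1 + c1) T c' (pk n) (kn n) (K n) (\<Lambda> n) (r n) n) sequentially"
      using basic
    proof eventually_elim
      case (elim n)
      have n: "real n \<ge> 3" "ln (real n) \<ge> 1" and \<Lambda>0: "\<Lambda> n > 0" and kn2: "kn n \<ge> 2" using elim by linarith+
      let ?q = "ln (real n) / L (real n)"
      have q1: "?q \<ge> 1" using elim by simp
      have b1: "real n * real (kn n) powr (- 2 * \<gamma>) \<le> (1 + c1) * \<Lambda> n"
      proof -
        have "real n * real (kn n) powr (- 2 * \<gamma>) \<le> real n * a n powr (- 2 * \<gamma>)"
          using elim gamma_gt_half by (intro mult_left_mono powr_mono2') auto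
        also have "\<dots> = a n * ln (real n)" by (rule rate_sq(2)[OF n])
        also have "\<dots> \<le> \<Lambda> n" unfolding \<Lambda>_def using elim n by (intro mult_right_mono) auto
        also have "\<dots> \<le> (1 + c1) * \<Lambda> n" using \<Lambda>0 c by simp
        finally show ?thesis .
      qed
      have b2: "exp (- (1 + c1) * \<Lambda> n) \<le> pmf (pk n) (kn n)"
      proof -
        have "L (real (kn n)) \<le> ln (real n)" using L n kn2 elim by auto
        then have "c1 * real (kn n) * L (real (kn n)) \<le> c1 * real (kn n) * ln (real n)"
          using c by (intro mult_left_mono) auto
        also have "\<dots> = c1 * \<Lambda> n" by (simp add: \<Lambda>_def)
        finally have "- (1 + c1) * \<Lambda> n \<le> - c1 * real (kn n) * L (real (kn n))" using \<Lambda>0 by (simp add: algebra_simps)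
        then have "exp (- (1 + c1) * \<Lambda> n) \<le> exp (- c1 * real (kn n) * L (real (kn n)))" by simp
        also have "\<dots> \<le> pmf (pk n) (kn n)" unfolding p using L kn2 by (intro c(3)) auto
        finally show ?thesis .
      qed
      have K2: "K n \<ge> 2" using kn2 elim by linarith
      have b3: "measure_pmf.prob (pk n) {j. j > K n} \<le> exp (- T * \<Lambda> n)"
      proof -
        have LK: "ln 2 \<le> L (real (K n))" using L K2 ln_2_less_1 by auto
        have Lmono: "L (real (K n)) \<le> L (real k)" if "k > K n" for k using L K2 that by auto
        have "measure_pmf.prob p {j. j > K n} \<le> exp (- (c2 * L (real (K n))) * real (K n)) * (1 / (1 - exp (- (c2 * ln 2))))"
        proof (rule pmf_geometric_tail)
          show "c2 * ln 2 \<le> c2 * L (real (K n))" using LK c by (intro mult_left_mono) auto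
          show "0 < c2 * ln 2" using c by simp
          fix k assume k: "k > K n"
          have "pmf p k \<le> exp (- c2 * real k * L (real k))" using L k K2 by (intro c(4)) auto
          also have "\<dots> \<le> exp (- (c2 * L (real (K n))) * real k)"
          proof -
            have "c2 * real k * L (real (K n)) \<le> c2 * real k * L (real k)" using Lmono[OF k] c by (intro mult_left_mono) auto
            then show ?thesis by (simp add: mult_ac)
          qed
          finally show "pmf p k \<le> exp (- (c2 * L (real (K n))) * real k)" .
        qed
        also have "\<dots> \<le> exp (- (T + 1) * \<Lambda> n) * exp (\<Lambda> n)"
        proof (intro mult_mono)
          have "L (real (K n)) \<ge> w / 2 * L (real n)"
          proof (cases "L = ln")
            case True
            have "real n powr (w / 2) \<le> real (K n)" using elim by linarith
            then have "ln (real n powr (w / 2)) \<le> ln (real (K n))" using n K2 by (subst ln_le_cancel_iff) auto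
            then show ?thesis using True n by (simp add: ln_powr)
          next
            case False
            then have "L = (\<lambda>_. 1)" using L by blast
            then show ?thesis using w by simp
          qed
          then have "c2 * real (K n) * (w / 2 * L (real n)) \<le> c2 * real (K n) * L (real (K n))"
            using c by (intro mult_left_mono) auto
          moreover have "c2 * (w / 2) * (C5 * \<Lambda> n) \<le> c2 * (w / 2) * (real (K n) * L (real n))"
            using elim c w by (intro mult_left_mono) auto
          moreover have "(T + 1) * \<Lambda> n \<le> c2 * (w / 2) * C5 * \<Lambda> n" using C5(2) \<Lambda>0 by (intro mult_right_mono) auto
          moreover have "c2 * (w / 2) * (C5 * \<Lambda> n) = c2 * (w / 2) * C5 * \<Lambda> n"
            "c2 * (w / 2) * (real (K n) * L (real n)) = c2 * real (K n) * (w / 2 * L (real n))"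
            "c2 * L (real (K n)) * real (K n) = c2 * real (K n) * L (real (K n))" by simp_all
          ultimately have "(T + 1) * \<Lambda> n \<le> c2 * L (real (K n)) * real (K n)" by linarith
          then show "exp (- (c2 * L (real (K n))) * real (K n)) \<le> exp (- (T + 1) * \<Lambda> n)"
            unfolding exp_le_cancel_iff mult_minus_left neg_le_iff_le .
          have "D0 \<le> exp (ln (real n))" using elim n by simp
          also have "\<dots> \<le> exp (\<Lambda> n)" unfolding exp_le_cancel_iff using elim by blast
          finally show "1 / (1 - exp (- (c2 * ln 2))) \<le> exp (\<Lambda> n)" unfolding D0_def .
        qed (use c in auto)
        also have "\<dots> = exp (- T * \<Lambda> n)" by (simp add: exp_add[symmetric] algebra_simps)
        finally show ?thesis unfolding p .
      qed
      have r0: "0 \<le> r n" using \<epsilon>0 E1 elim by (auto simp: r_def rate_PH_def intro!: mult_nonneg_nonneg)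
      have b4: "T * \<Lambda> n + c' * real (K n) * ln (real n) \<le> real n * (r n)\<^sup>2"
      proof -
        have q2: "?q \<le> ?q\<^sup>2" using q1 by (simp add: self_le_power)
        have "ln (real n) \<le> ?q * \<Lambda> n"
        proof -
          have "ln (real n) = ?q * L (real n)" using elim by simp
          also have "\<dots> \<le> ?q * \<Lambda> n" using elim q1 by (intro mult_left_mono) auto
          finally show ?thesis .
        qed
        moreover have "real (K n) * ln (real n) \<le> (C5 * \<Lambda> n / L (real n) + 1) * ln (real n)"
          using elim by (intro mult_right_mono) auto
        moreover have "(C5 * \<Lambda> n / L (real n) + 1) * ln (real n) = C5 * (?q * \<Lambda> n) + ln (real n)"
          by (simp add: distrib_right)
        moreover have "(C5 + 1) * (?q * \<Lambda> n) = C5 * (?q * \<Lambda> n) + ?q * \<Lambda> n" by (simp only: distrib_right mult_1)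
        ultimately have "real (K n) * ln (real n) \<le> (C5 + 1) * (?q * \<Lambda> n)" by linarith
        also have "\<dots> \<le> (C5 + 1) * (?q\<^sup>2 * \<Lambda> n)"
          using C5 \<Lambda>0 q2 by (intro mult_left_mono mult_right_mono) auto
        finally have "c' * (real (K n) * ln (real n)) \<le> c' * ((C5 + 1) * (?q\<^sup>2 * \<Lambda> n))"
          using T by (intro mult_left_mono) auto
        moreover have "T * \<Lambda> n \<le> T * (?q\<^sup>2 * \<Lambda> n)"
        proof -
          have "1 * \<Lambda> n \<le> ?q\<^sup>2 * \<Lambda> n" using q1 q2 \<Lambda>0 by (intro mult_right_mono) auto
          then show ?thesis using T by (intro mult_left_mono) auto
        qed
        ultimately have "T * \<Lambda> n + c' * real (K n) * ln (real n) \<le> (T + c' * (C5 + 1)) * (?q\<^sup>2 * \<Lambda> n)"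
          by (simp add: algebra_simps)
        also have "\<dots> \<le> (T + c' * (C5 + 1)) * (?q\<^sup>2 * (2 * (a n * ln (real n))))"
          unfolding \<Lambda>_def using elim T C5 by (intro mult_left_mono) (auto intro: mult_right_mono)
        also have "\<dots> = 2 * (T + c' * (C5 + 1)) * (?q\<^sup>2 * (a n * ln (real n)))" by simp
        also have "\<dots> \<le> \<epsilon>0\<^sup>2 * (?q\<^sup>2 * (a n * ln (real n)))"
        proof (rule mult_right_mono)
          have "2 * (T + c' * (C5 + 1)) \<le> E" by (simp add: E_def)
          also have "\<dots> \<le> E\<^sup>2" using E1 by (simp add: self_le_power)
          also have "\<dots> \<le> \<epsilon>0\<^sup>2" using \<epsilon>0 E1 by (intro power_mono) auto
          finally show "2 * (T + c' * (C5 + 1)) \<le> \<epsilon>0\<^sup>2" .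
        qed (use elim in simp)
        also have "\<dots> = real n * (r n)\<^sup>2" unfolding r_sq[OF n] by simp
        finally show ?thesis .
      qed
      show ?case
        unfolding rate_conditions_def using elim kn2 b1 b2 b3 b4 r0 by (simp add: \<Lambda>_def)
    qed
    have Kr: "(\<lambda>n. real (K n) * (r n)\<^sup>2) \<longlonglongrightarrow> 0"
    proof (rule tendsto_sandwich[OF _ _ tendsto_const])
      show "eventually (\<lambda>n. 0 \<le> real (K n) * (r n)\<^sup>2) sequentially" by simp
      show "eventually (\<lambda>n. real (K n) * (r n)\<^sup>2 \<le>
          (C5 * (2 * real n powr w * ln (real n)) + 1) * ((ln (real n))\<^sup>2 * \<epsilon>0\<^sup>2 * (real n powr w * ln (real n)) / real n)) sequentially"
        using basic
      proof eventually_elim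
        case (elim n)
        have n: "real n \<ge> 3" "ln (real n) \<ge> 1" using elim by linarith+
        have "ln (real n) / L (real n) \<le> ln (real n) / 1" using elim n by (intro divide_left_mono) auto
        then have "(ln (real n) / L (real n))\<^sup>2 \<le> (ln (real n))\<^sup>2" using elim n by (intro power_mono) auto
        then have "real n * (r n)\<^sup>2 \<le> (ln (real n))\<^sup>2 * \<epsilon>0\<^sup>2 * (real n powr w * ln (real n))"
          unfolding r_sq[OF n] using elim n by (intro mult_mono) auto
        then have "(r n)\<^sup>2 \<le> (ln (real n))\<^sup>2 * \<epsilon>0\<^sup>2 * (real n powr w * ln (real n)) / real n"
          using n by (simp add: le_divide_eq mult.commute)
        then show ?case using elim C5 n by (intro mult_mono) auto
      qed
      show "(\<lambda>n. (C5 * (2 * real n powr w * ln (real n)) + 1) * ((ln (real n))\<^sup>2 * \<epsilon>0\<^sup>2 * (real n powr w * ln (real n)) / real n)) \<longlonglongrightarrow> 0"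
        using w C5 by real_asymp
    qed
    have \<rho>: "eventually (\<lambda>n. l2_const * r n \<le> (ln (real n))\<^sup>2 / L (real n) * (\<epsilon>0 * rate_PH \<gamma> n)) sequentially"
      using basic rc
    proof eventually_elim
      case (elim n)
      have "l2_const * r n \<le> ln (real n) * r n" using elim by (intro mult_right_mono) (auto simp: rate_conditions_def)
      then show ?case by (simp add: r_def power2_eq_square)
    qed
    show "concentrates pk (\<lambda>n. ln (real n) / L (real n) * (\<epsilon>0 * rate_PH \<gamma> n))
       (\<lambda>n. (ln (real n))\<^sup>2 / L (real n) * (\<epsilon>0 * rate_PH \<gamma> n))"
      using rates[rule_format, OF rc Kr \<rho>] unfolding r_def .
  qed
qed

text \<open>The dimension is prescribed, so it serves for the approximation and for the sieve alike. Its complexity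
\<open>k * ln n\<close> and its squared bias times \<open>n\<close> are both at most of the order of \<open>n\<close> times the squared rate
times \<open>ln n\<close>, which leaves a further factor \<open>ln n\<close> to spare. As \<open>\<beta>\<close> and \<open>\<gamma>\<close> exceed \<open>1/2\<close>, the
dimension times the squared rate tends to zero.\<close>

theorem rates_D:
  assumes \<beta>_pstar: "pstar > 2 \<Longrightarrow> \<beta> < 1/2 + 1 / pstar" and D: "case_D \<beta> pk L"
  shows "\<exists>E>0. \<forall>\<epsilon>0\<ge>E.
     concentrates pk (\<lambda>n. ln (real n) / L (real n) * (\<epsilon>0 * rate_D \<beta> \<gamma> n))
       (\<lambda>n. (ln (real n))\<^sup>2 / L (real n) * (\<epsilon>0 * rate_D \<beta> \<gamma> n))"
proof -
  obtain kn where L: "L = (\<lambda>_. 1)" and kn: "\<And>n. n \<ge> 1 \<Longrightarrow> \<bar>real (kn n) - real n powr (1 / (2 * \<beta> + 1))\<bar> < 1"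
    and pk: "\<And>n. pk n = return_pmf (kn n)"
    using D unfolding case_D_def by blast
  define s where "s = 1 / (2 * \<beta> + 1)"
  define \<mu> where "\<mu> = min \<beta> \<gamma>"
  define A where "A = 2 powr (2 * \<gamma>)"
  define v where "v = s * (2 * \<mu> - 1)"
  have s: "0 < s" "s < 1/2" "1 - 2 * \<beta> * s = s" using beta by (auto simp: s_def field_simps)
  have \<mu>: "\<mu> > 1/2" "\<mu> \<le> \<beta>" "\<mu> \<le> \<gamma>" using beta gamma_gt_half by (auto simp: \<mu>_def)
  have v: "v > 0" using s \<mu> by (simp add: v_def)
  let ?e = "rate_D \<beta> \<gamma>"
  define \<Lambda> where "\<Lambda> n = 2 * real n * (?e n)\<^sup>2 * ln (real n)" for n
  obtain T c where T: "T > 0" "c > 0" and rates: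
    "\<forall>pk k K \<Lambda> r \<rho>. eventually (\<lambda>n. rate_conditions \<gamma> A T c (pk n) (k n) (K n) (\<Lambda> n) (r n) n) sequentially \<longrightarrow>
       (\<lambda>n. real (K n) * (r n)\<^sup>2) \<longlonglongrightarrow> 0 \<longrightarrow> eventually (\<lambda>n. l2_const * r n \<le> \<rho> n) sequentially \<longrightarrow>
       concentrates pk r \<rho>"
    by (rule posterior_rates[OF \<beta>_pstar, of A]) (assumption, simp add: A_def, (rule that; assumption))
  define E where "E = 1 + 2 * (T + c)"
  have E1: "E \<ge> 1" using T by (simp add: E_def)
  have large: "eventually (\<lambda>n. real n \<ge> 3 \<and> ln (real n) \<ge> 1 \<and> 2 \<le> real n powr s \<and> 2 * real n powr s \<le> real n ^ 2 \<and>
      2 * real n * (ln (real n))\<^sup>2 * ln (real n) \<le> real n powr (3/2) \<and> l2_const \<le> ln (real n)) sequentially"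
  proof (intro eventually_conj)
    show "eventually (\<lambda>n. 2 \<le> real n powr s) sequentially" using s by real_asymp
    show "eventually (\<lambda>n. 2 * real n powr s \<le> real n ^ 2) sequentially" using s by real_asymp
  qed real_asymp+
  have e_bounds: "real n powr (- 2 * \<mu> * s) \<le> (?e n)\<^sup>2 \<and> (?e n)\<^sup>2 \<le> (ln (real n))\<^sup>2 * real n powr (- 2 * \<mu> * s)"
    if n: "real n \<ge> 3" "ln (real n) \<ge> 1" for n
  proof -
    have sq: "(real n powr x)\<^sup>2 = real n powr (2 * x)" for x by (simp add: power2_eq_square powr_add[symmetric])
    have l2: "1 \<le> (ln (real n))\<^sup>2" using n by (simp add: one_le_power)
    show ?thesis
    proof (cases "\<gamma> \<ge> \<beta>")
      case True
      then have "\<mu> = \<beta>" by (simp add: \<mu>_def)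
      then have "(?e n)\<^sup>2 = (ln (real n))\<^sup>2 * real n powr (- 2 * \<mu> * s)"
        using True by (simp add: rate_D_def power_mult_distrib sq s_def)
      then show ?thesis using l2 by (simp add: mult_le_cancel_right1)
    next
      case False
      then have "\<mu> = \<gamma>" by (simp add: \<mu>_def)
      then have "(?e n)\<^sup>2 = real n powr (- 2 * \<mu> * s)"
        using False by (simp add: rate_D_def sq s_def)
      then show ?thesis using l2 by (simp add: mult_le_cancel_right1)
    qed
  qed
  have basic: "eventually (\<lambda>n. real n \<ge> 3 \<and> ln (real n) \<ge> 1 \<and> l2_const \<le> ln (real n) \<and> kn n \<ge> 1 \<and>
      real n powr s / 2 \<le> real (kn n) \<and> real (kn n) \<le> 2 * real n powr s \<and> real (kn n) \<le> real n ^ 2 \<and>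
      real n powr s \<le> real n * real n powr (- 2 * \<mu> * s) \<and> real n powr (- 2 * \<mu> * s) \<le> (?e n)\<^sup>2 \<and>
      (?e n)\<^sup>2 \<le> (ln (real n))\<^sup>2 * real n powr (- 2 * \<mu> * s) \<and> \<Lambda> n \<le> real n powr (3/2)) sequentially"
    using large
  proof eventually_elim
    case (elim n)
    have n: "real n \<ge> 3" "ln (real n) \<ge> 1" using elim by auto
    have "\<bar>real (kn n) - real n powr s\<bar> < 1" using kn[of n] n by (simp add: s_def)
    then have k: "real n powr s - 1 < real (kn n)" "real (kn n) < real n powr s + 1" by linarith+
    have k1: "real n powr s / 2 \<le> real (kn n)" "real (kn n) \<le> 2 * real n powr s" using k elim by linarith+
    then have k2: "kn n \<ge> 1" "real (kn n) \<le> real n ^ 2" using elim by linarith+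
    have "\<mu> * s \<le> \<beta> * s" using \<mu> s by (intro mult_right_mono) auto
    then have "s \<le> 1 + - 2 * \<mu> * s" using s(3) by linarith
    then have "real n powr s \<le> real n powr (1 + - 2 * \<mu> * s)" using n by (intro powr_mono) auto
    also have "\<dots> = real n * real n powr (- 2 * \<mu> * s)" unfolding powr_add using n by simp
    finally have m: "real n powr s \<le> real n * real n powr (- 2 * \<mu> * s)" .
    have "real n powr (- 2 * \<mu> * s) \<le> real n powr 0" using n \<mu> s by (intro powr_mono) auto
    then have "(ln (real n))\<^sup>2 * real n powr (- 2 * \<mu> * s) \<le> (ln (real n))\<^sup>2 * 1" using n by (intro mult_left_mono) auto
    then have "(?e n)\<^sup>2 \<le> (ln (real n))\<^sup>2" using e_bounds[OF n] by linarith
    then have "\<Lambda> n \<le> 2 * real n * (ln (real n))\<^sup>2 * ln (real n)"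
      unfolding \<Lambda>_def using n by (intro mult_right_mono mult_left_mono) auto
    then show ?case using elim k1 k2 m e_bounds[OF n] by linarith
  qed
  show ?thesis
  proof (intro exI[of _ E] conjI[of "E > 0"] allI impI)
    show "E > 0" using E1 by linarith
    fix \<epsilon>0 assume \<epsilon>0: "\<epsilon>0 \<ge> E"
    define r where "r n = ln (real n) / L (real n) * (\<epsilon>0 * ?e n)" for n
    have r_sq: "(r n)\<^sup>2 = \<epsilon>0\<^sup>2 * (ln (real n))\<^sup>2 * (?e n)\<^sup>2" for n by (simp add: r_def L power_mult_distrib)
    have rc: "eventually (\<lambda>n. rate_conditions \<gamma> A T c (pk n) (kn n) (kn n) (\<Lambda> n) (r n) n) sequentially"
      using basic
    proof eventually_elim
      case (elim n)
      have n: "real n \<ge> 3" "ln (real n) \<ge> 1" using elim by auto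
      have ne: "real n * real n powr (- 2 * \<mu> * s) \<le> real n * (?e n)\<^sup>2" using elim by (intro mult_left_mono) auto
      have b0: "real (kn n) * ln (real n) \<le> \<Lambda> n"
      proof -
        have "real (kn n) \<le> 2 * (real n * (?e n)\<^sup>2)" using elim ne by linarith
        then have "real (kn n) * ln (real n) \<le> 2 * (real n * (?e n)\<^sup>2) * ln (real n)" using n by (intro mult_right_mono) auto
        then show ?thesis by (simp add: \<Lambda>_def mult_ac)
      qed
      have \<Lambda>0: "\<Lambda> n \<ge> 0" using n by (simp add: \<Lambda>_def)
      have b1: "real n * real (kn n) powr (- 2 * \<gamma>) \<le> A * \<Lambda> n"
      proof -
        have "real (kn n) powr (- 2 * \<gamma>) \<le> (real n powr s / 2) powr (- 2 * \<gamma>)"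
          using elim gamma_gt_half n by (intro powr_mono2') auto
        also have "\<dots> = A * real n powr (- 2 * \<gamma> * s)"
          using n by (simp add: A_def powr_divide powr_powr powr_minus field_simps)
        also have "\<dots> \<le> A * real n powr (- 2 * \<mu> * s)"
        proof -
          have "\<mu> * s \<le> \<gamma> * s" using \<mu> s by (intro mult_right_mono) auto
          then have "- 2 * \<gamma> * s \<le> - 2 * \<mu> * s" by linarith
          then show ?thesis using n by (intro mult_left_mono powr_mono) (auto simp: A_def)
        qed
        finally have "real n * real (kn n) powr (- 2 * \<gamma>) \<le> real n * (A * real n powr (- 2 * \<mu> * s))"
          by (rule mult_left_mono) simp
        also have "\<dots> = A * (real n * real n powr (- 2 * \<mu> * s))" by simp
        also have "\<dots> \<le> A * (real n * (?e n)\<^sup>2)" by (rule mult_left_mono[OF ne]) (simp add: A_def)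
        also have "\<dots> \<le> A * \<Lambda> n"
        proof (intro mult_left_mono)
          have "(real n * (?e n)\<^sup>2) * 1 \<le> (real n * (?e n)\<^sup>2) * (2 * ln (real n))" using n by (intro mult_left_mono) auto
          then show "real n * (?e n)\<^sup>2 \<le> \<Lambda> n" by (simp add: \<Lambda>_def mult_ac)
        qed (simp add: A_def)
        finally show ?thesis .
      qed
      have r0: "0 \<le> r n" using \<epsilon>0 E1 n by (auto simp: r_def L rate_D_def intro!: mult_nonneg_nonneg)
      have b4: "T * \<Lambda> n + c * real (kn n) * ln (real n) \<le> real n * (r n)\<^sup>2"
      proof -
        have "c * (real (kn n) * ln (real n)) \<le> c * \<Lambda> n" using b0 T by (intro mult_left_mono) auto
        then have "T * \<Lambda> n + c * real (kn n) * ln (real n) \<le> (T + c) * \<Lambda> n" by (simp add: algebra_simps)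
        also have "\<dots> = 2 * (T + c) * (real n * (?e n)\<^sup>2 * ln (real n))" by (simp add: \<Lambda>_def)
        also have "\<dots> \<le> \<epsilon>0\<^sup>2 * (real n * (?e n)\<^sup>2 * (ln (real n))\<^sup>2)"
        proof (intro mult_mono)
          have "2 * (T + c) \<le> E" by (simp add: E_def)
          also have "\<dots> \<le> E\<^sup>2" using E1 by (simp add: self_le_power)
          also have "\<dots> \<le> \<epsilon>0\<^sup>2" using \<epsilon>0 E1 by (intro power_mono) auto
          finally show "2 * (T + c) \<le> \<epsilon>0\<^sup>2" .
          show "ln (real n) \<le> (ln (real n))\<^sup>2" using n by (simp add: self_le_power)
        qed (use n in auto)
        also have "\<dots> = real n * (r n)\<^sup>2" by (simp add: r_sq)
        finally show ?thesis .
      qed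
      have "exp (- A * \<Lambda> n) \<le> pmf (pk n) (kn n)" using \<Lambda>0 by (simp add: pk A_def)
      moreover have "measure_pmf.prob (pk n) {j. j > kn n} \<le> exp (- T * \<Lambda> n)" by (simp add: pk)
      ultimately show ?case
        unfolding rate_conditions_def using elim b0 b1 b4 r0 by simp
    qed
    have Kr: "(\<lambda>n. real (kn n) * (r n)\<^sup>2) \<longlonglongrightarrow> 0"
    proof (rule tendsto_sandwich[OF _ _ tendsto_const])
      show "eventually (\<lambda>n. 0 \<le> real (kn n) * (r n)\<^sup>2) sequentially" by simp
      show "eventually (\<lambda>n. real (kn n) * (r n)\<^sup>2 \<le> 2 * \<epsilon>0\<^sup>2 * ((ln (real n))\<^sup>2 * (ln (real n))\<^sup>2) * real n powr (- v)) sequentially"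
        using basic
      proof eventually_elim
        case (elim n)
        have "(r n)\<^sup>2 \<le> \<epsilon>0\<^sup>2 * (ln (real n))\<^sup>2 * ((ln (real n))\<^sup>2 * real n powr (- 2 * \<mu> * s))"
          unfolding r_sq using elim by (intro mult_left_mono) auto
        then have "real (kn n) * (r n)\<^sup>2 \<le> (2 * real n powr s) * (\<epsilon>0\<^sup>2 * (ln (real n))\<^sup>2 * ((ln (real n))\<^sup>2 * real n powr (- 2 * \<mu> * s)))"
          using elim by (intro mult_mono) auto
        also have "\<dots> = 2 * \<epsilon>0\<^sup>2 * ((ln (real n))\<^sup>2 * (ln (real n))\<^sup>2) * (real n powr s * real n powr (- 2 * \<mu> * s))" by simp
        also have "real n powr s * real n powr (- 2 * \<mu> * s) = real n powr (- v)"
          unfolding powr_add[symmetric] by (simp add: v_def algebra_simps)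
        finally show ?case .
      qed
      show "(\<lambda>n. 2 * \<epsilon>0\<^sup>2 * ((ln (real n))\<^sup>2 * (ln (real n))\<^sup>2) * real n powr (- v)) \<longlonglongrightarrow> 0" using v by real_asymp
    qed
    have \<rho>: "eventually (\<lambda>n. l2_const * r n \<le> (ln (real n))\<^sup>2 / L (real n) * (\<epsilon>0 * ?e n)) sequentially"
      using basic rc
    proof eventually_elim
      case (elim n)
      have "l2_const * r n \<le> ln (real n) * r n" using elim by (intro mult_right_mono) (auto simp: rate_conditions_def)
      then show ?case by (simp add: r_def power2_eq_square)
    qed
    show "concentrates pk (\<lambda>n. ln (real n) / L (real n) * (\<epsilon>0 * ?e n))
       (\<lambda>n. (ln (real n))\<^sup>2 / L (real n) * (\<epsilon>0 * ?e n))"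
      using rates[rule_format, OF rc Kr \<rho>] unfolding r_def .
  qed
qed

end

section \<open>The concentration theorem\<close>

lemma basis_and_smoothness:
  assumes \<gamma>: "\<gamma> > 0" and pq: "2 \<le> p" "1 \<le> q"
    and basis: "is_fourier_basis \<phi> \<and> p = 2 \<and> q = 2 \<and> f \<in> sobolev \<phi> \<gamma> \<or>
                is_wavelet_basis r \<phi> \<and> \<gamma> < r \<and> f \<in> besov \<phi> \<gamma> p q"
  shows "\<exists>B. bounded_basis \<phi> B" "\<exists>C. block_decay \<gamma> C (\<lambda>l. int01 (\<lambda>x. f x * \<phi> l x))"
proof -
  have o: "orthonormal_basis \<phi>" and \<phi>0: "\<phi> 0 = indicator {0..1}"
    using basis by (auto simp: is_fourier_basis_def is_wavelet_basis_def)
  have meas: "\<phi> l \<in> borel_measurable borel" if "l \<ge> 1" for l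
    using basis fourier_basis_measurable[OF _ that] wavelet_basis_measurable[OF _ that] by blast
  obtain B where "block_bounded B \<phi>"
    using basis fourier_basis_block_bounded wavelet_basis_block_bounded by metis
  then show "\<exists>B. bounded_basis \<phi> B"
    using meas \<phi>0 orthonormal_basis_imp_on[OF o] by (auto simp: bounded_basis_def)
  show "\<exists>C. block_decay \<gamma> C (\<lambda>l. int01 (\<lambda>x. f x * \<phi> l x))"
    using basis besov_block_decay[OF _ pq] sobolev_block_decay[OF _ o \<gamma>] by blast
qed

lemma esssup_real_bound:
  assumes "esssup M (\<lambda>x. ereal (f x)) < \<infinity>"
  obtains b where "AE x in M. f x \<le> b"
proof -
  have "AE x in M. ereal (f x) \<le> esssup M (\<lambda>x. ereal (f x))" by (rule esssup_AE)
  then have "AE x in M. f x \<le> real_of_ereal (esssup M (\<lambda>x. ereal (f x)))"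
  proof eventually_elim
    case (elim x)
    then show ?case using assms by (cases "esssup M (\<lambda>x. ereal (f x))") auto
  qed
  then show ?thesis by (rule that)
qed

theorem theorem3p1:
  fixes M :: "'w measure" and X :: "nat \<Rightarrow> 'w \<Rightarrow> real"
    and f0 :: "real \<Rightarrow> real" and \<phi> :: "nat \<Rightarrow> real \<Rightarrow> real" and \<theta>0 :: "nat \<Rightarrow> real"
    and g :: "real \<Rightarrow> real" and pstar \<tau>0 \<beta> \<gamma> r :: real and p q :: ereal
    and pk :: "nat \<Rightarrow> nat pmf" and L :: "real \<Rightarrow> real" and \<epsilon> :: "nat \<Rightarrow> real"
  assumes f0: "f0 \<in> density_class"
    and log_f0_bounded: "esssup (restrict_space lborel {0..1}) (\<lambda>x. ereal \<bar>ln (f0 x)\<bar>) < \<infinity>"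
    and M: "prob_space M"
    and X_indep: "prob_space.indep_vars M (\<lambda>_. borel) X {1..}"
    and X_density: "\<And>i. i \<ge> 1 \<Longrightarrow>
          distributed M lborel (X i) (\<lambda>x. ennreal (f0 x) * indicator {0..1} x)"
    and \<gamma>: "\<gamma> > 1/2"
    and pq: "2 \<le> p" "1 \<le> q"
    and basis: "is_fourier_basis \<phi> \<and> p = 2 \<and> q = 2 \<and> (\<lambda>x. ln (f0 x)) \<in> sobolev \<phi> \<gamma> \<or>
                is_wavelet_basis r \<phi> \<and> \<gamma> < r \<and> (\<lambda>x. ln (f0 x)) \<in> besov \<phi> \<gamma> p q"
    and \<theta>0: "L2_sums \<phi> {1..} \<theta>0 (\<lambda>x. ln (f0 x) - int01 (\<lambda>y. ln (f0 y)))"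
    and \<beta>: "1/2 < \<beta>" "\<beta> < 1"
    and pstar: "pstar > 0"
    and g: "coordinate_density pstar g"
    and \<tau>0: "\<tau>0 > 0"
    and \<beta>_pstar: "pstar \<le> 2 \<Longrightarrow> \<beta> < 1/2 + pstar / 2" "pstar > 2 \<Longrightarrow> \<beta> < 1/2 + 1 / pstar"
    and prior_on_k: "case_PH pk L \<and> \<epsilon> = rate_PH \<gamma> \<or> case_D \<beta> pk L \<and> \<epsilon> = rate_D \<beta> \<gamma>"
  shows "\<exists>E>0. \<forall>\<epsilon>0\<ge>E.
     tendsto_in_prob M (\<lambda>n \<omega>. measure (posterior \<phi> (prior (pk n) g \<tau>0 \<beta>) n (\<lambda>i. X i \<omega>))
         {(k, \<theta>). hellinger f0 (model_density \<phi> k \<theta>) \<le> ln (real n) / L (real n) * (\<epsilon>0 * \<epsilon> n)}) 1 \<and>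
     tendsto_in_prob M (\<lambda>n \<omega>. measure (posterior \<phi> (prior (pk n) g \<tau>0 \<beta>) n (\<lambda>i. X i \<omega>))
         {(k, \<theta>). l2_dist \<theta>0 \<theta> \<le> (ln (real n))\<^sup>2 / L (real n) * (\<epsilon>0 * \<epsilon> n)}) 1"
proof -
  have \<gamma>0: "\<gamma> > 0" using \<gamma> by linarith
  note smooth = basis_and_smoothness[OF \<gamma>0 pq basis]
  obtain B where B: "bounded_basis \<phi> B" using smooth(1) by blast
  interpret bounded_basis \<phi> B by (rule B)
  have f0': "f0 \<in> borel_measurable borel" "\<And>x. f0 x \<ge> 0" "integrable U01 f0" "(LINT x|U01. f0 x) = 1"
    "AE x in U01. f0 x > 0" "in_L2 (\<lambda>x. ln (f0 x))"
    using f0 by (auto simp: density_class_def set_integrable_def integrable_restrict_space int01_eq AE_restrict_space_iff)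
  obtain b where b: "AE x in U01. \<bar>ln (f0 x)\<bar> \<le> b" by (rule esssup_real_bound[OF log_f0_bounded])
  have bounded: "AE x in U01. f0 x > 0 \<and> \<bar>ln (f0 x)\<bar> \<le> b" using f0'(5) b by eventually_elim simp
  \<comment> \<open>constants are orthogonal to all basis functions but the first\<close>
  have coef: "\<theta>0 l = int01 (\<lambda>x. ln (f0 x) * \<phi> l x)" if l: "l \<ge> 1" for l
  proof -
    have phi: "in_L2 (\<phi> l)" using phi_orthonormal by (simp add: orthonormal_on_def)
    let ?m = "int01 (\<lambda>y. ln (f0 y))"
    have "\<theta>0 l = (LINT x|U01. (ln (f0 x) - ?m) * \<phi> l x)"
      using l by (intro L2_sums_coefficient[OF in_L2_diff[OF f0'(6) in_L2_const] orthonormal_on_subset[OF phi_orthonormal] \<theta>0]) auto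
    also have "\<dots> = (LINT x|U01. ln (f0 x) * \<phi> l x - ?m * \<phi> l x)" by (simp only: left_diff_distrib)
    also have "\<dots> = (LINT x|U01. ln (f0 x) * \<phi> l x)"
      using in_L2_mult_integrable[OF f0'(6) phi] in_L2_integrable[OF phi] integral_phi[OF l] by simp
    finally show ?thesis by (simp add: int01_eq)
  qed
  obtain C where C: "block_decay \<gamma> C (\<lambda>l. int01 (\<lambda>x. ln (f0 x) * \<phi> l x))" using smooth(2) by blast
  have decay: "block_decay \<gamma> C \<theta>0"
  proof -
    have "(\<Sum>l\<in>dyadic_block j. (\<theta>0 l)\<^sup>2) = (\<Sum>l\<in>dyadic_block j. (int01 (\<lambda>x. ln (f0 x) * \<phi> l x))\<^sup>2)" for j
    proof (rule sum.cong[OF refl])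
      fix l assume "l \<in> dyadic_block j"
      moreover have "1 \<le> (2::nat) ^ j" by simp
      ultimately have "l \<ge> 1" by (meson atLeastLessThan_iff order_trans)
      then show "(\<theta>0 l)\<^sup>2 = (int01 (\<lambda>x. ln (f0 x) * \<phi> l x))\<^sup>2" by (simp only: coef)
    qed
    then show ?thesis using C unfolding block_decay_def by simp
  qed
  interpret prob_space M by (rule M)
  interpret iid_sample \<phi> B f0 \<theta>0 \<gamma> C b g pstar \<tau>0 \<beta> M X
    by unfold_locales (use f0' bounded \<theta>0 decay \<gamma> g pstar \<tau>0 \<beta> X_indep X_density in auto)
  show ?thesis
    using prior_on_k rates_PH[OF \<beta>_pstar(2)] rates_D[OF \<beta>_pstar(2)] by (elim disjE conjE) blast+
qed

end
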